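(* For each $T>0$, there exists a class of (Schwartz class) solutions of the Boussinesq equation $u_{tt}=u_{xx}+(u^2)_{xx}+u_{xxxx}$ that blow up at time $T$.
   Context: Schwartz class solution of the Boussinesq equation on $\mathbb R\times[0,T)$ with initial data $u_0,u_1\in\mathcal S(\mathbb R)$ (Schwartz space): a smooth real-valued function $u(x,t)$ on $\mathbb R\times[0,T)$ which satisfies $u_{tt}=u_{xx}+(u^2)_{xx}+u_{xxxx}$ there, $u(x,0)=u_0(x)$ and $u_t(x,0)=u_1(x)$ for $x\in\mathbb R$, and such that for each integer $N\ge1$ and each $\tau\in[0,T)$, $\sup_{x\in\mathbb R,\,t\in[0,\tau]}\sum_{i=0}^N(1+|x|)^N|\partial_x^iu(x,t)|<\infty$. A Schwartz class solution $u$ on $\mathbb R\times[0,T)$ is said to blow up at time $T$ if there exists no Schwartz class solution $\tilde u$ on $\mathbb R\times[0,\tilde T)$ with $\tilde T>T$ which coincides with $u$ for $t\in[0,T)$. "There exists a class" in particular asserts existence of at least one such solution for each $T>0$. *)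

theory Defs
  imports "HOL-Analysis.Analysis"
begin

text \<open>
  A function of space and time is curried: \<open>u x t\<close>.  The time derivative is taken within
  \<open>{0..}\<close>: it is two-sided for \<open>t > 0\<close> and one-sided at \<open>t = 0\<close>.  For \<open>0 \<le> t < T\<close> it
  depends only on the values of \<open>u x\<close> on \<open>{0..<T}\<close>, so values of \<open>u\<close> outside the
  domain \<open>UNIV \<times> {0..<T}\<close> play no role in anything below.
\<close>

definition Dx :: "(real \<Rightarrow> real \<Rightarrow> real) \<Rightarrow> real \<Rightarrow> real \<Rightarrow> real" where
  "Dx u = (\<lambda>x t. deriv (\<lambda>y. u y t) x)"

definition Dt :: "(real \<Rightarrow> real \<Rightarrow> real) \<Rightarrow> real \<Rightarrow> real \<Rightarrow> real" where
  "Dt u = (\<lambda>x t. vector_derivative (\<lambda>s. u x s) (at t within {0..}))"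

text \<open>\<open>Ck_on T k u\<close>: all mixed partial derivatives of \<open>u\<close> of order at most \<open>k\<close>, taken in any
  sequence, exist and are jointly continuous on \<open>UNIV \<times> {0..<T}\<close>, the boundary \<open>t = 0\<close>
  included.\<close>

primrec Ck_on :: "real \<Rightarrow> nat \<Rightarrow> (real \<Rightarrow> real \<Rightarrow> real) \<Rightarrow> bool" where
  "Ck_on T 0 u \<longleftrightarrow> continuous_on (UNIV \<times> {0..<T}) (\<lambda>(x, t). u x t)"
| "Ck_on T (Suc k) u \<longleftrightarrow>
     continuous_on (UNIV \<times> {0..<T}) (\<lambda>(x, t). u x t) \<and>
     (\<forall>x. \<forall>t\<in>{0..<T}. (\<lambda>y. u y t) differentiable (at x)) \<and>
     (\<forall>x. \<forall>t\<in>{0..<T}. (\<lambda>s. u x s) differentiable (at t within {0..})) \<and>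
     Ck_on T k (Dx u) \<and> Ck_on T k (Dt u)"

definition smooth_on_strip :: "real \<Rightarrow> (real \<Rightarrow> real \<Rightarrow> real) \<Rightarrow> bool" where
  "smooth_on_strip T u \<longleftrightarrow> (\<forall>k. Ck_on T k u)"

definition schwartz :: "(real \<Rightarrow> real) \<Rightarrow> bool" where
  "schwartz f \<longleftrightarrow>
     (\<forall>n x. (deriv ^^ n) f differentiable (at x)) \<and>
     (\<forall>m n. bounded (range (\<lambda>x. x ^ m * (deriv ^^ n) f x)))"

definition schwartz_class_solution ::
  "real \<Rightarrow> (real \<Rightarrow> real) \<Rightarrow> (real \<Rightarrow> real) \<Rightarrow> (real \<Rightarrow> real \<Rightarrow> real) \<Rightarrow> bool" where
  "schwartz_class_solution T u0 u1 u \<longleftrightarrow>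
     schwartz u0 \<and> schwartz u1 \<and>
     smooth_on_strip T u \<and>
     (\<forall>x. \<forall>t\<in>{0..<T}.
        Dt (Dt u) x t
          = Dx (Dx u) x t + Dx (Dx (\<lambda>y s. (u y s)\<^sup>2)) x t + Dx (Dx (Dx (Dx u))) x t) \<and>
     (\<forall>x. u x 0 = u0 x) \<and>
     (\<forall>x. Dt u x 0 = u1 x) \<and>
     (\<forall>N\<ge>1. \<forall>\<tau>\<in>{0..<T}.
        bdd_above ((\<lambda>(x, t). \<Sum>i=0..N. (1 + \<bar>x\<bar>) ^ N * \<bar>(Dx ^^ i) u x t\<bar>) ` (UNIV \<times> {0..\<tau>})))"

text \<open>The continuation \<open>v\<close> may be required to have finite lifetime \<open>T'\<close>, since a solution on
  \<open>UNIV \<times> {0..}\<close> restricts to one on every finite strip.  Its initial data are not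
  prescribed; they agree with those of \<open>u\<close> because \<open>v\<close> coincides with \<open>u\<close> on \<open>{0..<T}\<close>.\<close>

definition blows_up_at :: "real \<Rightarrow> (real \<Rightarrow> real \<Rightarrow> real) \<Rightarrow> bool" where
  "blows_up_at T u \<longleftrightarrow>
     \<not> (\<exists>T' v0 v1 v. T' > T \<and> schwartz_class_solution T' v0 v1 v \<and>
          (\<forall>x. \<forall>t\<in>{0..<T}. v x t = u x t))"

end

theory Submission
  imports Defs "HOL-Complex_Analysis.Cauchy_Integral_Formula"
begin

text \<open>
  High frequencies of the equation grow like \<open>exp (k\<^sup>2 t)\<close>, so a solution that is smooth up to, but
  not at, time \<open>T\<close> is built by working in the reversed time \<open>s = T - t\<close> and keeping only the modes
  that decay in \<open>s\<close>, starting from a profile with a kink at \<open>s = 0\<close>.  For the Fourier transform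
  \<open>a k s\<close> (real and even in \<open>k\<close>) the equation reads \<open>a'' = (k ^ 4 - k\<^sup>2) a - k\<^sup>2 (a * a)\<close>.  With a Green
  function satisfying \<open>green'' = (k ^ 4 - k\<^sup>2) green - k\<^sup>2 \<delta>\<close> in \<open>\<tau>\<close> and bounded by a multiple of
  \<open>exp (- \<bar>k\<bar> \<bar>\<tau>\<bar>)\<close>, the fixed point of
  \<open>a = \<epsilon> green k s / (1 + k\<^sup>2) + \<integral> green k (s - r) (a * a) dr\<close> exists for small \<open>\<epsilon>\<close> on a time interval
  of any length and is bounded by a multiple of \<open>exp (- s \<bar>k\<bar>) / (1 + k\<^sup>2)\<close>.  Hence the solution is
  analytic in \<open>x\<close> for \<open>s > 0\<close>.  At \<open>s = 0\<close> the nonlinear term is \<open>O(\<bar>k\<bar> ^ -3)\<close>, so \<open>a k 0\<close> is of exact order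
  \<open>1 / k\<^sup>2\<close> and the limit profile is not twice differentiable at \<open>x = 0\<close>.
\<close>

section \<open>Difference quotients\<close>

text \<open>The weight is deliberately much weaker than the decay \<open>exp (- k\<^sup>2 s)\<close>
  of the linear modes. A Gaussian weight is not stable under convolution: splitting \<open>k\<close>
  into two halves loses half of the exponent. Since \<open>\<bar>k\<bar>\<close> is subadditive,
  \<open>exp (- s \<bar>k\<bar>) / (1 + k\<^sup>2)\<close> is reproduced by convolution up to a
  constant, and a kernel with the same rate \<open>\<bar>k\<bar>\<close> reproduces it under the
  time integral. The contraction constant is then a multiple of \<open>S M\<close>, so a long time
  interval is paid for by a small solution. The fixed point is found in a sup norm, which gives no
  regularity in \<open>k\<close>, while spatial decay depends on such regularity. Hence
  \<open>green\<close> has to be smooth in \<open>k\<close> also at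
  \<open>\<bar>k\<bar> = 1\<close>, where \<open>k ^ 4 - k\<^sup>2\<close> changes sign. The
  singularity is planted in the linear term: \<open>green k 0\<close> stays away from 0 for
  \<open>\<bar>k\<bar> \<ge> 1\<close>, so the factor \<open>1 / (1 + k\<^sup>2)\<close> fixes the
  order of the tail. The solution itself remains bounded up to the final time; what is lost there is
  smoothness.\<close>

definition dq :: "real \<Rightarrow> (real \<Rightarrow> 'a::real_normed_vector) \<Rightarrow> real \<Rightarrow> 'a" where
  "dq h f = (\<lambda>x. (f (x + h) - f x) /\<^sub>R h)"

lemma dq_add: "dq h (\<lambda>x. f x + g x) = (\<lambda>x. dq h f x + dq h g x)"
  by (auto simp: dq_def scaleR_diff_right scaleR_add_right)

lemma dq_pow_add: "(dq h ^^ m) (\<lambda>x. f x + g x) = (\<lambda>x. (dq h ^^ m) f x + (dq h ^^ m) g x)"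
  by (induction m) (simp_all add: dq_add)

lemma dq_pow_linear:
  assumes "bounded_linear L"
  shows "(dq h ^^ m) (\<lambda>x. L (f x)) = (\<lambda>x. L ((dq h ^^ m) f x))"
proof -
  interpret L: bounded_linear L by fact
  show ?thesis
    by (induction m) (simp_all add: dq_def L.diff L.scale)
qed

lemma dq_pow_shift: "(dq h ^^ m) (\<lambda>x. f (x + c)) = (\<lambda>x. (dq h ^^ m) f (x + c))"
proof (induction m)
  case (Suc m)
  then show ?case
    by (simp add: dq_def add.commute add.left_commute)
qed simp

lemma dq_pow_Suc: "(dq h ^^ Suc m) f k = ((dq h ^^ m) f (k + h) - (dq h ^^ m) f k) /\<^sub>R h"
  by (simp add: dq_def)

lemma dq_mult:
  fixes f g :: "real \<Rightarrow> real"
  shows "dq h (\<lambda>x. f x * g x) x = dq h f x * g (x + h) + f x * dq h g x"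
  by (simp add: dq_def divide_inverse algebra_simps)

lemma dq_sum: "dq h (\<lambda>x. \<Sum>j\<in>A. f j x) x = (\<Sum>j\<in>A. dq h (f j) x)"
  by (simp add: dq_def sum_subtractf flip: scaleR_right.sum)

lemma dq_cmult:
  fixes f :: "real \<Rightarrow> real"
  shows "dq h (\<lambda>x. c * f x) x = c * dq h f x"
  by (simp add: dq_def field_simps)

text \<open>Each quotient that falls on \<open>f\<close> leaves \<open>g\<close> evaluated one step
  \<open>h\<close> further on, by \<open>dq_mult\<close>; hence the shift by \<open>j h\<close>. The
  induction is Pascal's rule.\<close>

lemma dq_pow_mult:
  fixes f g :: "real \<Rightarrow> real"
  shows "(dq h ^^ m) (\<lambda>x. f x * g x) x =
    (\<Sum>j\<le>m. of_nat (m choose j) * ((dq h ^^ j) f x * (dq h ^^ (m - j)) g (x + of_nat j * h)))"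
proof (induction m arbitrary: x)
  case (Suc m)
  let ?F = "\<lambda>j. (dq h ^^ j) f" and ?G = "\<lambda>j. (dq h ^^ j) g"
  have IH: "(dq h ^^ m) (\<lambda>x. f x * g x) =
      (\<lambda>x. \<Sum>j\<le>m. of_nat (m choose j) * (?F j x * ?G (m - j) (x + of_nat j * h)))"
    using Suc.IH by blast
  have shift: "dq h (\<lambda>x. ?G n (x + c)) = (\<lambda>x. ?G (Suc n) (x + c))" for n c
    using dq_pow_shift[where h = h and m = 1 and f = "?G n" and c = c] by simp
  have "(dq h ^^ Suc m) (\<lambda>x. f x * g x) x =
     (\<Sum>j\<le>m. of_nat (m choose j) * dq h (\<lambda>x. ?F j x * ?G (m - j) (x + of_nat j * h)) x)"
    by (simp add: IH dq_sum dq_cmult)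
  also have "\<dots> = (\<Sum>j\<le>m. of_nat (m choose j) * (?F (Suc j) x * ?G (m - j) (x + of_nat (Suc j) * h)))
     + (\<Sum>j\<le>m. of_nat (m choose j) * (?F j x * ?G (Suc m - j) (x + of_nat j * h)))"
    by (simp add: dq_mult shift sum.distrib [symmetric] algebra_simps Suc_diff_le)
  \<comment> \<open>Both sums are brought to the range \<open>j \<le> Suc m\<close>: this one by an
    index shift with coefficient 0 at \<open>j = 0\<close>, the next one because
    \<open>m choose Suc m = 0\<close>.\<close>
  also have "(\<Sum>j\<le>m. of_nat (m choose j) * (?F (Suc j) x * ?G (m - j) (x + of_nat (Suc j) * h)))
     = (\<Sum>j\<le>Suc m. of_nat (if j = 0 then 0 else m choose (j - 1)) * (?F j x * ?G (Suc m - j) (x + of_nat j * h)))"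
    by (subst sum.atMost_Suc_shift) simp
  also have "(\<Sum>j\<le>m. of_nat (m choose j) * (?F j x * ?G (Suc m - j) (x + of_nat j * h)))
     = (\<Sum>j\<le>Suc m. of_nat (m choose j) * (?F j x * ?G (Suc m - j) (x + of_nat j * h)))"
    by simp
  also have "(\<Sum>j\<le>Suc m. of_nat (if j = 0 then 0 else m choose (j - 1)) * (?F j x * ?G (Suc m - j) (x + of_nat j * h)))
     + (\<Sum>j\<le>Suc m. of_nat (m choose j) * (?F j x * ?G (Suc m - j) (x + of_nat j * h)))
     = (\<Sum>j\<le>Suc m. of_nat (Suc m choose j) * (?F j x * ?G (Suc m - j) (x + of_nat j * h)))"
    unfolding sum.distrib [symmetric] distrib_right [symmetric] of_nat_add [symmetric]
    by (rule sum.cong) (auto simp: choose_reduce_nat)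
  finally show ?case .
qed simp

lemma shift_iterate:
  fixes \<phi> :: "real \<Rightarrow> real"
  assumes "\<And>x y. \<bar>y - x\<bar> \<le> 1 \<Longrightarrow> \<phi> y \<le> K * \<phi> x" and "K \<ge> 0" and "\<bar>h\<bar> \<le> 1"
  shows "\<phi> (x + of_nat j * h) \<le> K ^ j * \<phi> x"
proof (induction j)
  case (Suc j)
  have "\<phi> (x + of_nat (Suc j) * h) \<le> K * \<phi> (x + of_nat j * h)"
    using assms(3) by (intro assms(1)) (simp add: algebra_simps)
  also have "\<dots> \<le> K * (K ^ j * \<phi> x)"
    using Suc assms(2) by (rule mult_left_mono)
  finally show ?case by simp
qed simp

text \<open>Mean value inequality, once per quotient. The point at which the derivative is taken may
  be up to \<open>h \<le> 1\<close> away, which costs a factor \<open>K\<close> each time.\<close>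

lemma dq_pow_deriv_bound:
  fixes f :: "nat \<Rightarrow> real \<Rightarrow> 'a::real_normed_vector"
  assumes "\<And>j x. (f j has_vector_derivative f (Suc j) x) (at x)"
    and "\<And>x. norm (f m x) \<le> C * \<phi> x"
    and "\<And>x y. \<bar>y - x\<bar> \<le> 1 \<Longrightarrow> \<phi> y \<le> K * \<phi> x"
    and "0 < h" "h \<le> 1" "C \<ge> 0" "K \<ge> 0"
  shows "norm ((dq h ^^ m) (f 0) x) \<le> C * K ^ m * \<phi> x"
  using assms(1,2,6)
proof (induction m arbitrary: f C x)
  case (Suc m)
  \<comment> \<open>Quotients of a chain of derivatives again form such a chain, so the induction
    hypothesis applies to \<open>g\<close>, with \<open>C * K\<close> in place of
    \<open>C\<close>.\<close>
  define g where "g j = dq h (f j)" for j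
  have "(g j has_vector_derivative g (Suc j) x) (at x)" for j x
  proof -
    have "((\<lambda>x. f j (x + h)) has_vector_derivative f (Suc j) (x + h)) (at x)"
    proof -
      have "((\<lambda>x. x + h) has_vector_derivative 1) (at x)"
        unfolding has_real_derivative_iff_has_vector_derivative [symmetric]
        by (auto intro!: derivative_eq_intros)
      from vector_diff_chain_at[OF this Suc.prems(1)] show ?thesis by (simp add: o_def)
    qed
    from bounded_linear.has_vector_derivative[OF bounded_linear_scaleR_right
        has_vector_derivative_diff[OF this Suc.prems(1)]]
    show ?thesis
      unfolding g_def dq_def .
  qed
  moreover have "norm (g m x) \<le> (C * K) * \<phi> x" for x
  proof -
    have "norm (f m (x + h) - f m x) \<le> C * K * \<phi> x * norm (x + h - x)"
    proof (rule differentiable_bound[where f' = "\<lambda>y v. v *\<^sub>R f (Suc m) y" and S = "{x..x+h}"])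
      fix y assume y: "y \<in> {x..x + h}"
      show "(f m has_derivative (\<lambda>v. v *\<^sub>R f (Suc m) y)) (at y within {x..x + h})"
        using Suc.prems(1)[of m y] unfolding has_vector_derivative_def by (rule has_derivative_at_withinI)
      have *: "norm (f (Suc m) y) \<le> C * (K * \<phi> x)"
        using Suc.prems(2)[of y] mult_left_mono[OF assms(3)[where x=x and y=y] \<open>C \<ge> 0\<close>] y assms(4,5) by simp
      show "onorm (\<lambda>v. v *\<^sub>R f (Suc m) y) \<le> C * K * \<phi> x"
      proof (intro onorm_le)
        fix v :: real
        show "norm (v *\<^sub>R f (Suc m) y) \<le> C * K * \<phi> x * norm v"
          using mult_right_mono[OF *, of "norm v"] by (simp add: mult_ac)
      qed
    qed (use assms in auto)
    then show ?thesis
      using assms(4) by (simp add: g_def dq_def inverse_eq_divide pos_divide_le_eq mult_ac)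
  qed
  moreover have "C * K \<ge> 0"
    using assms(7) Suc.prems(3) by simp
  ultimately have "norm ((dq h ^^ m) (g 0) x) \<le> (C * K) * K ^ m * \<phi> x"
    by (rule Suc.IH)
  then show ?case
    by (simp add: g_def funpow_swap1 mult.assoc)
qed simp

section \<open>Estimates for all difference quotients, uniform in the step\<close>

text \<open>
  All estimates are uniform in a parameter \<open>p \<in> P\<close> (a time) and, essentially, in the step \<open>h\<close>:
  under the Fourier transform \<open>dq h ^^ m\<close> is multiplication by a function that tends to
  \<open>(- \<i> x) ^ m\<close>, so such bounds give spatial decay without differentiating in the frequency.
\<close>

definition symbol_bound :: "'p set \<Rightarrow> ('p \<Rightarrow> real \<Rightarrow> real) \<Rightarrow> ('p \<Rightarrow> real \<Rightarrow> real) \<Rightarrow> bool" where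
  "symbol_bound P \<phi> f \<longleftrightarrow> (\<forall>m. \<exists>C. \<forall>p\<in>P. \<forall>h\<in>{0<..1}. \<forall>x. \<bar>(dq h ^^ m) (f p) x\<bar> \<le> C * \<phi> p x)"

lemma symbol_boundE:
  assumes "symbol_bound P \<phi> f" "\<And>p x. p \<in> P \<Longrightarrow> \<phi> p x \<ge> 0"
  obtains C :: "nat \<Rightarrow> real" where "\<And>m. C m \<ge> 0"
    "\<And>m p h x. p \<in> P \<Longrightarrow> 0 < h \<Longrightarrow> h \<le> 1 \<Longrightarrow> \<bar>(dq h ^^ m) (f p) x\<bar> \<le> C m * \<phi> p x"
proof -
  have "\<forall>m. \<exists>C. \<forall>p\<in>P. \<forall>h\<in>{0<..1}. \<forall>x. \<bar>(dq h ^^ m) (f p) x\<bar> \<le> C * \<phi> p x"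
    using assms(1) by (simp add: symbol_bound_def)
  then obtain C where C: "\<And>m p h x. p \<in> P \<Longrightarrow> h \<in> {0<..1} \<Longrightarrow> \<bar>(dq h ^^ m) (f p) x\<bar> \<le> C m * \<phi> p x"
    by metis
  show ?thesis
  proof (rule that[of "\<lambda>m. \<bar>C m\<bar>"])
    fix m p and h x :: real assume "p \<in> P" "0 < h" "h \<le> 1"
    then have "\<bar>(dq h ^^ m) (f p) x\<bar> \<le> C m * \<phi> p x" by (intro C) auto
    also have "\<dots> \<le> \<bar>C m\<bar> * \<phi> p x"
      using assms(2)[OF \<open>p \<in> P\<close>] by (intro mult_right_mono) auto
    finally show "\<bar>(dq h ^^ m) (f p) x\<bar> \<le> \<bar>C m\<bar> * \<phi> p x" .
  qed simp
qed

text \<open>The discrete Leibniz rule shifts the second factor alone, so only \<open>\<psi>\<close>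
  is compared with its own values at neighbouring points.\<close>

lemma symbol_bound_mult:
  assumes f: "symbol_bound P \<phi> f" and g: "symbol_bound P \<psi> g"
    and nn: "\<And>p x. p \<in> P \<Longrightarrow> \<phi> p x \<ge> 0" "\<And>p x. p \<in> P \<Longrightarrow> \<psi> p x \<ge> 0"
    and st: "\<And>p x y. p \<in> P \<Longrightarrow> \<bar>y - x\<bar> \<le> 1 \<Longrightarrow> \<psi> p y \<le> K * \<psi> p x" and "K \<ge> 0"
  shows "symbol_bound P (\<lambda>p x. \<phi> p x * \<psi> p x) (\<lambda>p x. f p x * g p x)"
proof -
  obtain F where F: "\<And>m. F m \<ge> 0"
    "\<And>m p h x. p \<in> P \<Longrightarrow> 0 < h \<Longrightarrow> h \<le> 1 \<Longrightarrow> \<bar>(dq h ^^ m) (f p) x\<bar> \<le> F m * \<phi> p x"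
    using symbol_boundE[OF f nn(1)] by blast
  obtain G where G: "\<And>m. G m \<ge> 0"
    "\<And>m p h x. p \<in> P \<Longrightarrow> 0 < h \<Longrightarrow> h \<le> 1 \<Longrightarrow> \<bar>(dq h ^^ m) (g p) x\<bar> \<le> G m * \<psi> p x"
    using symbol_boundE[OF g nn(2)] by blast
  show ?thesis
    unfolding symbol_bound_def
  proof (intro allI exI ballI)
    fix m p x and h :: real assume p: "p \<in> P" and h: "h \<in> {0<..1}"
    have "\<bar>(dq h ^^ m) (\<lambda>x. f p x * g p x) x\<bar> \<le>
      (\<Sum>j\<le>m. \<bar>of_nat (m choose j) * ((dq h ^^ j) (f p) x * (dq h ^^ (m - j)) (g p) (x + of_nat j * h))\<bar>)"
      unfolding dq_pow_mult by (rule sum_abs)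
    also have "\<dots> \<le> (\<Sum>j\<le>m. of_nat (m choose j) * ((F j * \<phi> p x) * (G (m - j) * (K ^ j * \<psi> p x))))"
    proof (rule sum_mono)
      fix j
      have "\<bar>(dq h ^^ (m - j)) (g p) (x + of_nat j * h)\<bar> \<le> G (m - j) * \<psi> p (x + of_nat j * h)"
        using G(2)[OF p] h by simp
      also have "\<dots> \<le> G (m - j) * (K ^ j * \<psi> p x)"
        using h by (intro mult_left_mono G shift_iterate st p \<open>K \<ge> 0\<close>) auto
      finally show "\<bar>of_nat (m choose j) * ((dq h ^^ j) (f p) x * (dq h ^^ (m - j)) (g p) (x + of_nat j * h))\<bar>
        \<le> of_nat (m choose j) * ((F j * \<phi> p x) * (G (m - j) * (K ^ j * \<psi> p x)))"
        unfolding abs_mult using F(2)[OF p, of h j x] h F(1)[of j] nn(1)[OF p, of x]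
        by (intro mult_mono mult_nonneg_nonneg) auto
    qed
    also have "\<dots> = (\<Sum>j\<le>m. of_nat (m choose j) * F j * G (m - j) * K ^ j) * (\<phi> p x * \<psi> p x)"
      by (simp add: sum_distrib_right sum_distrib_left mult_ac)
    finally show "\<bar>(dq h ^^ m) (\<lambda>x. f p x * g p x) x\<bar> \<le>
       (\<Sum>j\<le>m. of_nat (m choose j) * F j * G (m - j) * K ^ j) * (\<phi> p x * \<psi> p x)" .
  qed
qed

lemma dq_pow_zero: "(dq h ^^ m) (\<lambda>x. 0) = (\<lambda>x. 0)"
  by (induction m) (simp_all add: dq_def)

lemma symbol_bound_finite_order:
  assumes "\<And>p h. h > 0 \<Longrightarrow> (dq h ^^ n) (f p) = (\<lambda>x. 0)"
    and "\<And>m. m < n \<Longrightarrow> \<exists>C. \<forall>p\<in>P. \<forall>h\<in>{0<..1}. \<forall>x. \<bar>(dq h ^^ m) (f p) x\<bar> \<le> C * \<phi> p x"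
  shows "symbol_bound P \<phi> f"
  unfolding symbol_bound_def
proof
  fix m
  show "\<exists>C. \<forall>p\<in>P. \<forall>h\<in>{0<..1}. \<forall>x. \<bar>(dq h ^^ m) (f p) x\<bar> \<le> C * \<phi> p x"
  proof (cases "m < n")
    case False
    then obtain k where "m = k + n" by (metis add.commute le_Suc_ex not_less)
    then have "(dq h ^^ m) (f p) x = 0" if "h > 0" for h p x
      using assms(1)[of h p] that by (simp add: funpow_add dq_pow_zero)
    then show ?thesis by (intro exI[of _ 0]) auto
  qed (use assms in auto)
qed

lemma symbol_bound_power: "symbol_bound P (\<lambda>p x. (1 + \<bar>x\<bar>) ^ i) (\<lambda>p x. x ^ i)"
proof (induction i)
  case 0
  show ?case
    by (rule symbol_bound_finite_order[where n = 1]) (auto simp: dq_def intro!: exI[of _ 1])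
next
  case (Suc i)
  have dq1: "dq h (\<lambda>x::real. x) = (\<lambda>x. 1)" if "h > 0" for h :: real
    using that by (auto simp: dq_def)
  have x: "symbol_bound P (\<lambda>p x. 1 + \<bar>x\<bar>) (\<lambda>p x. x)"
  proof (rule symbol_bound_finite_order[where n = 2])
    fix h :: real assume "h > 0"
    then show "(dq h ^^ 2) (\<lambda>x. x) = (\<lambda>x. 0::real)"
      by (simp add: numeral_2_eq_2 dq1) (simp add: dq_def)
  next
    fix m :: nat assume "m < 2"
    then consider "m = 0" | "m = 1" by linarith
    then show "\<exists>C. \<forall>p\<in>P. \<forall>h\<in>{0<..1}. \<forall>x. \<bar>(dq h ^^ m) (\<lambda>x. x) x\<bar> \<le> C * (1 + \<bar>x\<bar>)"
      by cases (auto simp: dq1 intro!: exI[of _ 1])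
  qed
  have "symbol_bound P (\<lambda>p x. (1 + \<bar>x\<bar>) * (1 + \<bar>x\<bar>) ^ i) (\<lambda>p x. x * x ^ i)"
  proof (rule symbol_bound_mult[OF x Suc, where K = "2 ^ i"])
    fix x y :: real assume "\<bar>y - x\<bar> \<le> 1"
    then have "(1 + \<bar>y\<bar>) ^ i \<le> (2 * (1 + \<bar>x\<bar>)) ^ i" by (intro power_mono) auto
    then show "(1 + \<bar>y\<bar>) ^ i \<le> 2 ^ i * (1 + \<bar>x\<bar>) ^ i" unfolding power_mult_distrib .
  qed auto
  then show ?case by simp
qed

text \<open>Cauchy's inequality on discs of radius \<open>r / 2\<close> bounds all derivatives along
  the real axis, and these bound the quotients. With \<open>r \<le> 1\<close> such a disc stays
  within distance 1 of its centre, where the weight varies by at most the factor \<open>K\<close>;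
  this enters once here and \<open>m\<close> times in the mean value steps.\<close>

lemma symbol_bound_holomorphic:
  fixes F :: "'p \<Rightarrow> complex \<Rightarrow> complex"
  assumes hol: "\<And>p. p \<in> P \<Longrightarrow> F p holomorphic_on {z. \<bar>Im z\<bar> < r}" and "r > 0" "r \<le> 1"
    and bd: "\<And>p z. p \<in> P \<Longrightarrow> \<bar>Im z\<bar> < r \<Longrightarrow> norm (F p z) \<le> C * \<phi> p (Re z)"
    and st: "\<And>p x y. p \<in> P \<Longrightarrow> \<bar>y - x\<bar> \<le> 1 \<Longrightarrow> \<phi> p y \<le> K * \<phi> p x" and "K \<ge> 0" "C \<ge> 0"
  shows "symbol_bound P \<phi> (\<lambda>p x. Re (F p (of_real x)))"
  unfolding symbol_bound_def
proof (intro allI exI ballI)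
  fix m p x and h :: real assume p: "p \<in> P" and h: "h \<in> {0<..1}"
  let ?S = "{z. \<bar>Im z\<bar> < r}"
  have op: "open ?S"
    by (intro open_Collect_less continuous_intros)
  define f where "f j x = (deriv ^^ j) (F p) (complex_of_real x)" for j x
  have "(f j has_vector_derivative f (Suc j) x) (at x)" for j x
  proof -
    have "((deriv ^^ j) (F p) has_field_derivative f (Suc j) x) (at (complex_of_real x))"
      using holomorphic_higher_deriv[OF hol[OF p] op, of j] op \<open>r > 0\<close>
      by (auto simp: f_def intro!: holomorphic_derivI)
    then show ?thesis
      unfolding f_def[of j, abs_def] by (rule has_vector_derivative_real_field)
  qed
  moreover have "norm (f m x) \<le> (fact m * (C * K) / (r / 2) ^ m) * \<phi> p x" for x
  proof -
    have sub: "cball (of_real x) (r / 2) \<subseteq> ?S"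
    proof
      fix w assume "w \<in> cball (complex_of_real x) (r/2)"
      then have "norm (w - of_real x) \<le> r/2" by (simp add: dist_norm norm_minus_commute)
      then show "w \<in> ?S" using abs_Im_le_cmod[of "w - of_real x"] \<open>r > 0\<close> by simp
    qed
    have "norm ((deriv ^^ m) (F p) (complex_of_real x)) \<le> fact m * (C * (K * \<phi> p x)) / (r / 2) ^ m"
    proof (rule Cauchy_inequality)
      show "F p holomorphic_on ball (complex_of_real x) (r / 2)"
        by (rule holomorphic_on_subset[OF hol[OF p]]) (use sub ball_subset_cball in blast)
      show "continuous_on (cball (complex_of_real x) (r / 2)) (F p)"
        using holomorphic_on_imp_continuous_on[OF hol[OF p]] sub continuous_on_subset by blast
      fix w assume w: "norm (complex_of_real x - w) = r / 2"
      then have "w \<in> ?S" using sub by (auto simp: dist_norm)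
      then have "norm (F p w) \<le> C * \<phi> p (Re w)" using bd[OF p] by simp
      also have "\<dots> \<le> C * (K * \<phi> p x)"
        using w abs_Re_le_cmod[of "complex_of_real x - w"] \<open>r \<le> 1\<close>
        by (intro mult_left_mono st p \<open>C \<ge> 0\<close>) auto
      finally show "norm (F p w) \<le> C * (K * \<phi> p x)" .
    qed (use \<open>r > 0\<close> in auto)
    then show ?thesis by (simp add: f_def mult_ac)
  qed
  ultimately have *: "norm ((dq h ^^ m) (f 0) x) \<le> (fact m * (C * K) / (r / 2) ^ m) * K ^ m * \<phi> p x"
    using h \<open>K \<ge> 0\<close> \<open>C \<ge> 0\<close> \<open>r > 0\<close> by (intro dq_pow_deriv_bound st p) auto
  have "(dq h ^^ m) (\<lambda>x. Re (F p (of_real x))) x = Re ((dq h ^^ m) (f 0) x)"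
    using dq_pow_linear[OF bounded_linear_Re, where h = h and m = m and f = "f 0"] by (simp add: f_def)
  then show "\<bar>(dq h ^^ m) (\<lambda>x. Re (F p (of_real x))) x\<bar> \<le> (fact m * (C * K) / (r / 2) ^ m) * K ^ m * \<phi> p x"
    using * abs_Re_le_cmod order_trans by metis
qed

section \<open>Entire functions of the squared frequency\<close>

text \<open>
  With \<open>W = \<omega>\<^sup>2\<close> these are \<open>cosh \<omega>\<close> and \<open>sinh \<omega> / \<omega>\<close>, written as entire functions of \<open>W\<close>
  because \<open>\<omega> = sqrt (k ^ 4 - k\<^sup>2)\<close> has branch points on the real axis.
\<close>

definition cosh_sqrt :: "'a \<Rightarrow> 'a::{real_normed_field,banach}" where
  "cosh_sqrt X = (\<Sum>n. inverse (fact (2 * n)) * X ^ n)"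

definition sinhc_sqrt :: "'a \<Rightarrow> 'a::{real_normed_field,banach}" where
  "sinhc_sqrt X = (\<Sum>n. inverse (fact (2 * n + 1)) * X ^ n)"

lemma summable_inverse_fact_ge:
  fixes X :: "'a::{real_normed_field,banach}"
  assumes "\<And>n. k n \<ge> n"
  shows "summable (\<lambda>n. inverse (fact (k n)) * X ^ n)"
proof (rule summable_comparison_test)
  show "summable (\<lambda>n. inverse (fact n) * norm X ^ n)" by (rule summable_exp)
  have "inverse (fact (k n)) * norm X ^ n \<le> inverse (fact n) * norm X ^ n" for n
    using assms[of n] by (intro mult_right_mono le_imp_inverse_le fact_mono) auto
  then show "\<exists>N. \<forall>n\<ge>N. norm (inverse (fact (k n)) * X ^ n) \<le> inverse (fact n) * norm X ^ n"
    by (auto simp: norm_mult norm_inverse norm_power)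
qed

lemma summable_cosh_sqrt: "summable (\<lambda>n. inverse (fact (2 * n)) * (X::'a::{real_normed_field,banach}) ^ n)"
  by (rule summable_inverse_fact_ge) simp

lemma summable_sinhc_sqrt: "summable (\<lambda>n. inverse (fact (2 * n + 1)) * (X::'a::{real_normed_field,banach}) ^ n)"
  by (rule summable_inverse_fact_ge) simp

lemma DERIV_cosh_sqrt: "(cosh_sqrt has_field_derivative sinhc_sqrt X / 2) (at (X::'a::{real_normed_field,banach}))"
proof -
  have *: "diffs (\<lambda>n. inverse (fact (2 * n))) = (\<lambda>n. inverse (fact (2 * n + 1)) / (2::'a))"
  proof
    fix n
    have "(fact (2 * Suc n) :: 'a) = 2 * of_nat (Suc n) * fact (2 * n + 1)"
      by (simp add: algebra_simps)
    moreover have "(of_nat (Suc n) :: 'a) \<noteq> 0" by (rule of_nat_neq_0)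
    ultimately show "diffs (\<lambda>n. inverse (fact (2 * n))) n = inverse (fact (2 * n + 1)) / (2::'a)"
      unfolding diffs_def by (simp add: field_simps del: fact_Suc of_nat_Suc)
  qed
  have "(cosh_sqrt has_field_derivative (\<Sum>n. diffs (\<lambda>n. inverse (fact (2 * n))) n * X ^ n)) (at X)"
    unfolding cosh_sqrt_def [abs_def] by (rule termdiffs_strong_converges_everywhere[OF summable_cosh_sqrt])
  also have "(\<Sum>n. diffs (\<lambda>n. inverse (fact (2 * n))) n * X ^ n) = (\<Sum>n. (inverse (fact (2 * n + 1)) * X ^ n) / 2)"
    unfolding * by (simp add: mult_ac)
  also have "\<dots> = sinhc_sqrt X / 2"
    unfolding sinhc_sqrt_def by (rule suminf_divide[OF summable_sinhc_sqrt])
  finally show ?thesis .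
qed

text \<open>Solving for \<open>D\<close> would mean dividing by \<open>X\<close>. The identity in
  product form also covers \<open>X = 0\<close>, and it is the form in which the derivative of
  \<open>Sh\<close> uses it.\<close>

lemma DERIV_sinhc_sqrt: "\<exists>D. (sinhc_sqrt has_field_derivative D) (at (X::'a::{real_normed_field,banach})) \<and> cosh_sqrt X = sinhc_sqrt X + 2 * X * D"
proof -
  let ?c = "\<lambda>n. inverse (fact (2 * n + 1)) :: 'a"
  define D where "D = (\<Sum>n. diffs ?c n * X ^ n)"
  have D: "(sinhc_sqrt has_field_derivative D) (at X)"
    unfolding sinhc_sqrt_def [abs_def] D_def by (rule termdiffs_strong_converges_everywhere[OF summable_sinhc_sqrt])
  have "summable (\<lambda>n. diffs ?c n * X ^ n)"
    by (rule termdiff_converges_all[OF summable_sinhc_sqrt])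
  then have sums: "(\<lambda>n. X * (diffs ?c n * X ^ n)) sums (X * D)"
    unfolding D_def by (intro sums_mult summable_sums)
  have "(\<lambda>n. of_nat (Suc n) * ?c (Suc n) * X ^ Suc n) sums (X * D)"
    using sums by (simp add: diffs_def mult_ac)
  then have "(\<lambda>n. of_nat n * ?c n * X ^ n) sums (X * D)"
    by (subst (asm) sums_Suc_iff) simp
  then have "(\<lambda>n. ?c n * X ^ n + 2 * (of_nat n * ?c n * X ^ n)) sums (sinhc_sqrt X + 2 * (X * D))"
    unfolding sinhc_sqrt_def by (intro sums_add sums_mult summable_sums summable_sinhc_sqrt)
  moreover have "?c n * X ^ n + 2 * (of_nat n * ?c n * X ^ n) = inverse (fact (2 * n)) * X ^ n" for n
  proof -
    have "(fact (2 * n + 1) :: 'a) = of_nat (2 * n + 1) * fact (2 * n)" by simp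
    moreover have "(of_nat (2 * n + 1) :: 'a) \<noteq> 0" using of_nat_neq_0[of "2 * n", where 'a = 'a] by simp
    ultimately have "(1 + 2 * of_nat n) * ?c n = inverse (fact (2 * n))"
      by (simp add: del: fact_Suc)
    then have "(1 + 2 * of_nat n) * ?c n * X ^ n = inverse (fact (2 * n)) * X ^ n"
      by (simp only:)
    then show ?thesis by (simp only: distrib_right mult_1_left mult.assoc)
  qed
  ultimately have "cosh_sqrt X = sinhc_sqrt X + 2 * (X * D)"
    unfolding cosh_sqrt_def by (simp add: sums_iff)
  with D show ?thesis by (auto simp: mult.assoc)
qed

lemma cosh_sqrt_0 [simp]: "cosh_sqrt 0 = (1::'a::{real_normed_field,banach})"
  unfolding cosh_sqrt_def using powser_zero[of "\<lambda>n. inverse (fact (2 * n)) :: 'a"] by simp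

lemma cosh_sqrt_square: "cosh_sqrt (w\<^sup>2) = cosh (w::'a::{real_normed_field,banach})"
proof -
  have "(\<lambda>n. if even (2 * n) then w ^ (2 * n) /\<^sub>R fact (2 * n) else 0) sums cosh w"
    by (subst sums_mono_reindex[of "\<lambda>n. 2 * n"]) (auto simp: strict_mono_def intro: cosh_converges)
  then show ?thesis
    unfolding cosh_sqrt_def
    by (simp add: sums_iff scaleR_conv_of_real power_mult nonzero_of_real_inverse)
qed

lemma sinhc_sqrt_square: "w * sinhc_sqrt (w\<^sup>2) = sinh (w::'a::{real_normed_field,banach})"
proof -
  have "(\<lambda>n. if even (2 * n + 1) then 0 else w ^ (2 * n + 1) /\<^sub>R fact (2 * n + 1)) sums sinh w"
    by (subst sums_mono_reindex[of "\<lambda>n. 2 * n + 1"])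
       (auto simp: strict_mono_def intro: sinh_converges elim!: oddE)
  then have "(\<lambda>n. w * (inverse (fact (2 * n + 1)) * (w\<^sup>2) ^ n)) sums sinh w"
    by (simp add: scaleR_conv_of_real nonzero_of_real_inverse mult_ac del: fact_Suc flip: power_mult)
  moreover have "(\<lambda>n. w * (inverse (fact (2 * n + 1)) * (w\<^sup>2) ^ n)) sums (w * sinhc_sqrt (w\<^sup>2))"
    unfolding sinhc_sqrt_def by (intro sums_mult summable_sums summable_sinhc_sqrt)
  ultimately show ?thesis by (metis sums_unique2)
qed

lemma cosh_sqrt_of_real: "cosh_sqrt (of_real x) = (of_real (cosh_sqrt x) :: complex)"
  unfolding cosh_sqrt_def using suminf_of_real[OF summable_cosh_sqrt[of x], where 'a = complex] by simp

lemma sinhc_sqrt_of_real: "sinhc_sqrt (of_real x) = (of_real (sinhc_sqrt x) :: complex)"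
  unfolding sinhc_sqrt_def using suminf_of_real[OF summable_sinhc_sqrt[of x], where 'a = complex] 
  by (simp del: fact_Suc)

lemma continuous_on_cosh_sqrt [continuous_intros]:
  "continuous_on A f \<Longrightarrow> continuous_on A (\<lambda>x. cosh_sqrt (f x :: 'a::{real_normed_field,banach}))"
  by (rule continuous_on_compose2[of UNIV cosh_sqrt])
     (auto intro!: continuous_at_imp_continuous_on DERIV_isCont DERIV_cosh_sqrt)

lemma continuous_on_sinhc_sqrt [continuous_intros]:
  "continuous_on A f \<Longrightarrow> continuous_on A (\<lambda>x. sinhc_sqrt (f x :: 'a::{real_normed_field,banach}))"
  by (rule continuous_on_compose2[of UNIV sinhc_sqrt])
     (auto intro!: continuous_at_imp_continuous_on, metis DERIV_isCont DERIV_sinhc_sqrt)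

lemma holomorphic_on_cosh_sqrt [holomorphic_intros]:
  "f holomorphic_on A \<Longrightarrow> (\<lambda>x. cosh_sqrt (f x)) holomorphic_on A"
  using holomorphic_on_compose_gen[of f A cosh_sqrt UNIV] DERIV_cosh_sqrt
  by (auto simp: o_def holomorphic_on_open)

lemma holomorphic_on_sinhc_sqrt [holomorphic_intros]:
  "f holomorphic_on A \<Longrightarrow> (\<lambda>x. sinhc_sqrt (f x)) holomorphic_on A"
  using holomorphic_on_compose_gen[of f A sinhc_sqrt UNIV] DERIV_sinhc_sqrt
  by (auto simp: o_def holomorphic_on_open)

section \<open>Real fundamental solutions of \<open>y'' = W y\<close>, for either sign of
  \<open>W\<close>\<close>

definition Ch :: "real \<Rightarrow> real \<Rightarrow> real" where "Ch W \<tau> = cosh_sqrt (W * \<tau>\<^sup>2)"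
definition Sh :: "real \<Rightarrow> real \<Rightarrow> real" where "Sh W \<tau> = \<tau> * sinhc_sqrt (W * \<tau>\<^sup>2)"

lemma Ch_0 [simp]: "Ch W 0 = 1" and Sh_0 [simp]: "Sh W 0 = 0"
  by (simp_all add: Ch_def Sh_def)

lemma Ch_minus [simp]: "Ch W (- \<tau>) = Ch W \<tau>" and Sh_minus [simp]: "Sh W (- \<tau>) = - Sh W \<tau>"
  by (simp_all add: Ch_def Sh_def)

lemma DERIV_Ch: "((Ch W) has_real_derivative W * Sh W \<tau>) (at \<tau>)"
proof -
  have "((\<lambda>\<tau>. cosh_sqrt (W * \<tau>\<^sup>2)) has_real_derivative sinhc_sqrt (W * \<tau>\<^sup>2) / 2 * (W * (2 * \<tau>))) (at \<tau>)"
    by (rule DERIV_chain2[OF DERIV_cosh_sqrt]) (auto intro!: derivative_eq_intros)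
  then show ?thesis by (simp add: Ch_def [abs_def] Sh_def mult_ac)
qed

lemma DERIV_Sh: "((Sh W) has_real_derivative Ch W \<tau>) (at \<tau>)"
proof -
  obtain D where D: "(sinhc_sqrt has_field_derivative D) (at (W * \<tau>\<^sup>2))" "cosh_sqrt (W * \<tau>\<^sup>2) = sinhc_sqrt (W * \<tau>\<^sup>2) + 2 * (W * \<tau>\<^sup>2) * D"
    using DERIV_sinhc_sqrt by blast
  show ?thesis
    unfolding Sh_def [abs_def]
    by (rule derivative_eq_intros DERIV_chain2[where f = sinhc_sqrt and g = "\<lambda>\<tau>. W * \<tau>\<^sup>2", OF D(1)] refl)+
       (simp add: Ch_def D(2), simp add: algebra_simps power2_eq_square)
qed

lemmas DERIV_Ch' [derivative_intros] = DERIV_chain2[OF DERIV_Ch]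
lemmas DERIV_Sh' [derivative_intros] = DERIV_chain2[OF DERIV_Sh]

text \<open>With the difference of the two arguments frozen at \<open>s - r\<close>, the expression
  \<open>f\<close> is constant in \<open>x\<close>; its values at \<open>x = s\<close> and
  \<open>x = 0\<close> are the two sides. The same device gives \<open>Sh_diff\<close>.\<close>

lemma Ch_diff: "Ch W (s - r) = Ch W s * Ch W r - W * Sh W s * Sh W r"
proof -
  define f where "f x = Ch W x * Ch W (x - (s - r)) - W * Sh W x * Sh W (x - (s - r))" for x
  have "(f has_real_derivative 0) (at x)" for x
    unfolding f_def [abs_def] by (auto intro!: derivative_eq_intros simp: algebra_simps)
  then have "f s = f 0" by (metis DERIV_isconst_all)
  then show ?thesis using Ch_minus[of W "s - r"] by (simp add: f_def)
qed

lemma Sh_diff: "Sh W (s - r) = Sh W s * Ch W r - Ch W s * Sh W r"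
proof -
  define f where "f x = Sh W x * Ch W (x - (s - r)) - Ch W x * Sh W (x - (s - r))" for x
  have "(f has_real_derivative 0) (at x)" for x
    unfolding f_def [abs_def] by (auto intro!: derivative_eq_intros simp: algebra_simps)
  then have "f s = f 0" by (metis DERIV_isconst_all)
  then show ?thesis using Sh_minus[of W "s - r"] by (simp add: f_def)
qed

lemma Ch_Sh_square: "(Ch W s)\<^sup>2 - W * (Sh W s)\<^sup>2 = 1"
  using Ch_diff[of W s s] by (simp add: power2_eq_square mult.assoc)

section \<open>The error function divided by its argument, as an entire function of the
  square\<close>

definition gint :: "complex \<Rightarrow> complex" where
  "gint W = integral {0..1} (\<lambda>r. exp (- W * of_real (r\<^sup>2)))"

lemma holomorphic_gint: "gint holomorphic_on UNIV"
proof -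
  have "(\<lambda>W. integral (cbox 0 (1::real)) (\<lambda>r. exp (- W * of_real (r\<^sup>2)))) holomorphic_on UNIV"
  proof (rule leibniz_rule_holomorphic)
    fix W :: complex and t :: real
    show "((\<lambda>W. exp (- W * of_real (t\<^sup>2))) has_field_derivative (- of_real (t\<^sup>2) * exp (- W * of_real (t\<^sup>2)))) (at W within UNIV)"
      by (auto intro!: derivative_eq_intros)
    show "(\<lambda>r. exp (- W * of_real (r\<^sup>2))) integrable_on cbox 0 (1::real)"
      by (intro integrable_continuous continuous_intros)
    show "continuous_on (UNIV \<times> cbox 0 1) (\<lambda>(W, t). - complex_of_real (t\<^sup>2) * exp (- W * of_real (t\<^sup>2)))"
      by (auto simp: case_prod_unfold intro!: continuous_intros)
  qed auto
  then show ?thesis by (simp add: gint_def [abs_def])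
qed

lemma holomorphic_on_gint [holomorphic_intros]:
  "f holomorphic_on A \<Longrightarrow> (\<lambda>x. gint (f x)) holomorphic_on A"
  using holomorphic_on_compose_gen[OF _ holomorphic_gint, of f A] by (auto simp: o_def)

lemma continuous_on_gint [continuous_intros]:
  "continuous_on A f \<Longrightarrow> continuous_on A (\<lambda>x. gint (f x))"
  by (rule continuous_on_compose2[OF holomorphic_on_imp_continuous_on[OF holomorphic_gint]]) auto

definition rgint :: "real \<Rightarrow> real" where
  "rgint W = integral {0..1} (\<lambda>r. exp (- W * r\<^sup>2))"

lemma gint_of_real: "gint (of_real W) = of_real (rgint W)"
proof -
  have "((\<lambda>r. exp (- W * r\<^sup>2)) has_integral rgint W) {0..1}"
    unfolding rgint_def
    by (intro integrable_integral integrable_continuous_real continuous_intros)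
  from has_integral_linear[OF this bounded_linear_of_real[where 'a = complex]]
  show ?thesis
    by (auto simp: gint_def o_def exp_of_real [symmetric] intro!: integral_unique)
qed

text \<open>The substitution \<open>z = w r\<close> turns the integral into an increment of an
  entire primitive \<open>F\<close> of \<open>exp (- z\<^sup>2)\<close>. Up to the factor
  \<open>sqrt pi / 2\<close> the product \<open>w gint (w\<^sup>2)\<close> is the error
  function.\<close>

lemma DERIV_mult_gint: "((\<lambda>w. w * gint (w\<^sup>2)) has_field_derivative exp (- (w\<^sup>2))) (at w)"
proof -
  have "(\<lambda>z::complex. exp (- (z\<^sup>2))) holomorphic_on UNIV" by (intro holomorphic_intros)
  then obtain F :: "complex \<Rightarrow> complex" where F: "\<And>z. (F has_field_derivative exp (- (z\<^sup>2))) (at z)"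
    using holomorphic_convex_primitive'[of UNIV "\<lambda>z. exp (- (z\<^sup>2))"] by auto
  have "w * gint (w\<^sup>2) = F w - F 0" for w
  proof -
    have "((\<lambda>r. w * exp (- (w\<^sup>2) * of_real (r\<^sup>2))) has_integral (F (w * of_real 1) - F (w * of_real 0))) {0..1}"
    proof (rule fundamental_theorem_of_calculus)
      fix x :: real
      have "((\<lambda>z. F (w * z)) has_field_derivative exp (- ((w * of_real x)\<^sup>2)) * w) (at (of_real x))"
        by (rule DERIV_chain2[OF F]) (auto intro!: derivative_eq_intros)
      then have "((\<lambda>r. F (w * of_real r)) has_vector_derivative exp (- ((w * of_real x)\<^sup>2)) * w) (at x)"
        by (rule has_vector_derivative_real_field)
      then show "((\<lambda>r. F (w * of_real r)) has_vector_derivative w * exp (- (w\<^sup>2) * of_real (x\<^sup>2))) (at x within {0..1})"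
        by (auto simp: power_mult_distrib mult.commute intro: has_vector_derivative_at_within)
    qed auto
    moreover have "((\<lambda>r. w * exp (- (w\<^sup>2) * of_real (r\<^sup>2))) has_integral (w * gint (w\<^sup>2))) {0..1}"
      unfolding gint_def
      by (intro has_integral_mult_right integrable_integral integrable_continuous_real continuous_intros)
    ultimately show ?thesis by (auto dest: has_integral_unique)
  qed
  then show ?thesis by (auto intro!: derivative_eq_intros F)
qed

lemma DERIV_mult_rgint: "((\<lambda>x. x * rgint (x\<^sup>2)) has_real_derivative exp (- (x\<^sup>2))) (at x)"
proof -
  have "((\<lambda>x. of_real x * gint ((of_real x)\<^sup>2)) has_vector_derivative exp (- ((of_real x)\<^sup>2))) (at x)"
    by (rule has_vector_derivative_real_field[OF DERIV_mult_gint])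
  from bounded_linear.has_vector_derivative[OF bounded_linear_Re this]
  have "((\<lambda>x. x * rgint (x\<^sup>2)) has_vector_derivative Re (exp (- ((of_real x)\<^sup>2)))) (at x)"
    by (simp add: gint_of_real [symmetric] del: of_real_power) (simp add: gint_of_real of_real_power [symmetric] del: of_real_power)
  then show ?thesis
    unfolding has_real_derivative_iff_has_vector_derivative
    by (simp add: Re_exp flip: of_real_power of_real_minus)
qed

definition hgauss :: "real \<Rightarrow> real" where "hgauss x = x * rgint (x\<^sup>2)"

lemma DERIV_hgauss: "(hgauss has_real_derivative exp (- (x\<^sup>2))) (at x)"
  unfolding hgauss_def [abs_def] by (rule DERIV_mult_rgint)

lemma hgauss_mono: "x \<le> y \<Longrightarrow> hgauss x \<le> hgauss y"
  by (rule DERIV_nonneg_imp_nondecreasing[where f = hgauss]) (auto intro!: exI DERIV_hgauss)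

text \<open>\<open>exp (- x\<^sup>2)\<close> serves as a tail majorant because for
  \<open>x \<ge> 1\<close> it decreases at the rate \<open>2 x exp (- x\<^sup>2)\<close>, faster
  than \<open>hgauss\<close> grows.\<close>

lemma hgauss_tail:
  assumes "1 \<le> x" "x \<le> y"
  shows "hgauss y + exp (- (y\<^sup>2)) \<le> hgauss x + exp (- (x\<^sup>2))"
proof (rule DERIV_nonpos_imp_nonincreasing[where f = "\<lambda>x. hgauss x + exp (- (x\<^sup>2))"])
  fix z assume "x \<le> z" "z \<le> y"
  have "((\<lambda>x. hgauss x + exp (- (x\<^sup>2))) has_real_derivative exp (- (z\<^sup>2)) * (1 - 2 * z)) (at z)"
    by (auto intro!: derivative_eq_intros DERIV_hgauss simp: algebra_simps)
  moreover have "exp (- (z\<^sup>2)) * (1 - 2 * z) \<le> 0"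
    using \<open>x \<le> z\<close> assms by (intro mult_nonneg_nonpos) auto
  ultimately show "\<exists>D. ((\<lambda>x. hgauss x + exp (- (x\<^sup>2))) has_real_derivative D) (at z) \<and> D \<le> 0" by blast
qed (use assms in auto)

text \<open>The number \<open>sqrt pi / 2\<close>, introduced as a supremum so that both tail bounds
  follow at once from \<open>hgauss_le\<close>.\<close>

definition hgauss_lim :: real where "hgauss_lim = (SUP x. hgauss x)"

lemma hgauss_le: "1 \<le> x \<Longrightarrow> hgauss y \<le> hgauss x + exp (- (x\<^sup>2))"
  using hgauss_tail[of x y] hgauss_mono[of y x] exp_gt_zero[of "- (x\<^sup>2)"] exp_gt_zero[of "- (y\<^sup>2)"]
  by (cases "x \<le> y") linarith+

lemma hgauss_lim_bounds: "hgauss x \<le> hgauss_lim" "1 \<le> x \<Longrightarrow> hgauss_lim \<le> hgauss x + exp (- (x\<^sup>2))"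
proof -
  have "bdd_above (range hgauss)"
    using hgauss_le[of 1] by (intro bdd_aboveI[of _ "hgauss 1 + exp (- (1\<^sup>2))"]) auto
  then show "hgauss x \<le> hgauss_lim" unfolding hgauss_lim_def by (intro cSUP_upper) auto
  show "hgauss_lim \<le> hgauss x + exp (- (x\<^sup>2))" if "1 \<le> x"
    unfolding hgauss_lim_def by (intro cSUP_least hgauss_le that) auto
qed

lemma hgauss_lim_pos: "hgauss_lim > 0"
proof -
  have "hgauss 0 < hgauss 1"
    by (rule DERIV_pos_imp_increasing[where f = hgauss]) (auto intro!: exI DERIV_hgauss)
  then show ?thesis using hgauss_lim_bounds(1)[of 1] by (simp add: hgauss_def)
qed

section \<open>The regularised kernel with parameter \<open>W\<close>\<close>

text \<open>
  For \<open>W = \<omega>\<^sup>2\<close> this solves \<open>G'' = W G - \<delta>\<close>.  The decaying solution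
  \<open>exp (- \<omega> \<bar>\<tau>\<bar>) / (2 \<omega>) = cosh (\<omega> \<tau>) / (2 \<omega>) - sinh (\<omega> \<bar>\<tau>\<bar>) / (2 \<omega>)\<close> is not analytic in \<open>W\<close>;
  replacing \<open>1 / (2 \<omega>)\<close> by \<open>erf \<omega> / (2 \<omega>)\<close> makes it entire and costs only a homogeneous solution
  of size \<open>exp (- \<omega>\<^sup>2) cosh (\<omega> \<tau>)\<close>.  Here \<open>\<omega> gint (\<omega>\<^sup>2)\<close> is the primitive of \<open>exp (- z\<^sup>2)\<close>
  and \<open>hgauss_lim\<close> its limit at infinity.
\<close>

definition kern :: "complex \<Rightarrow> real \<Rightarrow> complex" where
  "kern W \<tau> = gint W / of_real (2 * hgauss_lim) * cosh_sqrt (W * of_real (\<tau>\<^sup>2))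
     - of_real \<bar>\<tau>\<bar> * sinhc_sqrt (W * of_real (\<tau>\<^sup>2)) / 2"

text \<open>Separates the decaying exponential from a correction whose coefficient is a Gaussian
  tail. The correction still carries the growing \<open>cosh\<close>, which the tail has to
  beat.\<close>

lemma kern_square:
  assumes "w \<noteq> 0"
  shows "kern (w\<^sup>2) \<tau> = (exp (- (w * of_real \<bar>\<tau>\<bar>)) / 2
     - (of_real hgauss_lim - w * gint (w\<^sup>2)) / of_real (2 * hgauss_lim) * cosh (w * of_real \<bar>\<tau>\<bar>)) / w"
proof -
  let ?v = "w * of_real \<bar>\<tau>\<bar>"
  have sq: "w\<^sup>2 * of_real (\<tau>\<^sup>2) = ?v\<^sup>2"
    by (simp add: power_mult_distrib flip: of_real_power)
  have 1: "w * (of_real \<bar>\<tau>\<bar> * sinhc_sqrt (w\<^sup>2 * of_real (\<tau>\<^sup>2))) = sinh ?v"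
    unfolding sq using sinhc_sqrt_square[of ?v] by (simp add: mult.assoc)
  have 2: "cosh_sqrt (w\<^sup>2 * of_real (\<tau>\<^sup>2)) = cosh ?v"
    unfolding sq by (rule cosh_sqrt_square)
  have 3: "exp (- ?v) = cosh ?v - sinh ?v"
    by (simp add: cosh_minus_sinh)
  have J: "complex_of_real hgauss_lim \<noteq> 0" using hgauss_lim_pos by simp
  have "w * kern (w\<^sup>2) \<tau> = w * gint (w\<^sup>2) / of_real (2 * hgauss_lim) * cosh ?v - sinh ?v / 2"
    unfolding kern_def 2 by (simp add: right_diff_distrib 1 [symmetric])
  also have "\<dots> = exp (- ?v) / 2
     - (of_real hgauss_lim - w * gint (w\<^sup>2)) / of_real (2 * hgauss_lim) * cosh ?v"
    unfolding 3 using J by (simp add: field_simps)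
  finally show ?thesis using assms by (simp add: eq_divide_eq mult.commute)
qed

text \<open>The tail bound on the real axis is carried to \<open>w\<close> along the vertical
  segment from \<open>Re w\<close>. There the derivative \<open>exp (- z\<^sup>2)\<close> has
  modulus at most \<open>exp ((Im w)\<^sup>2 - (Re w)\<^sup>2)\<close>, and the segment has length
  \<open>\<bar>Im w\<bar>\<close>.\<close>

lemma norm_hgauss_tail_complex:
  assumes "Re w \<ge> 1"
  shows "norm (of_real hgauss_lim - w * gint (w\<^sup>2)) \<le> (1 + \<bar>Im w\<bar>) * exp ((Im w)\<^sup>2 - (Re w)\<^sup>2)"
proof -
  let ?\<alpha> = "Re w" and ?\<beta> = "Im w"
  have "norm (of_real hgauss_lim - of_real ?\<alpha> * gint ((of_real ?\<alpha>)\<^sup>2)) \<le> exp (- (?\<alpha>\<^sup>2))"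
  proof -
    have "of_real hgauss_lim - of_real ?\<alpha> * gint ((of_real ?\<alpha>)\<^sup>2) = complex_of_real (hgauss_lim - hgauss ?\<alpha>)"
      using gint_of_real[of "?\<alpha>\<^sup>2"] by (simp add: hgauss_def)
    then show ?thesis
      using hgauss_lim_bounds[of ?\<alpha>] assms by (simp del: of_real_diff)
  qed
  also have "\<dots> \<le> exp (?\<beta>\<^sup>2 - ?\<alpha>\<^sup>2)" by simp
  finally have 1: "norm (of_real hgauss_lim - of_real ?\<alpha> * gint ((of_real ?\<alpha>)\<^sup>2)) \<le> exp (?\<beta>\<^sup>2 - ?\<alpha>\<^sup>2)" .
  have "norm (w * gint (w\<^sup>2) - of_real ?\<alpha> * gint ((of_real ?\<alpha>)\<^sup>2)) \<le> exp (?\<beta>\<^sup>2 - ?\<alpha>\<^sup>2) * norm (w - of_real ?\<alpha>)"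
  proof (rule field_differentiable_bound[where f = "\<lambda>w. w * gint (w\<^sup>2)" and S = "closed_segment (of_real ?\<alpha>) w"])
    fix z assume z: "z \<in> closed_segment (of_real ?\<alpha>) w"
    show "((\<lambda>w. w * gint (w\<^sup>2)) has_field_derivative exp (- (z\<^sup>2))) (at z within closed_segment (of_real ?\<alpha>) w)"
      by (rule has_field_derivative_at_within[OF DERIV_mult_gint])
    obtain u where u: "0 \<le> u" "u \<le> 1" "z = (1 - u) *\<^sub>R of_real ?\<alpha> + u *\<^sub>R w"
      using z by (auto simp: in_segment)
    have "Re z = ?\<alpha>" "Im z = u * ?\<beta>" unfolding u(3) by (simp_all add: algebra_simps)
    moreover have "(u * ?\<beta>)\<^sup>2 \<le> ?\<beta>\<^sup>2"
      using u mult_right_mono[of "u\<^sup>2" 1 "?\<beta>\<^sup>2"] by (simp add: power_mult_distrib power_le_one)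
    ultimately show "norm (exp (- (z\<^sup>2))) \<le> exp (?\<beta>\<^sup>2 - ?\<alpha>\<^sup>2)"
      by (simp add: power2_eq_square)
  qed auto
  also have "norm (w - of_real ?\<alpha>) = \<bar>?\<beta>\<bar>"
    by (simp add: cmod_def)
  finally have 2: "norm (w * gint (w\<^sup>2) - of_real ?\<alpha> * gint ((of_real ?\<alpha>)\<^sup>2)) \<le> exp (?\<beta>\<^sup>2 - ?\<alpha>\<^sup>2) * \<bar>?\<beta>\<bar>" .
  have "norm (of_real hgauss_lim - w * gint (w\<^sup>2)) \<le>
     norm (of_real hgauss_lim - of_real ?\<alpha> * gint ((of_real ?\<alpha>)\<^sup>2)) +
     norm (w * gint (w\<^sup>2) - of_real ?\<alpha> * gint ((of_real ?\<alpha>)\<^sup>2))"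
    by norm
  with 1 2 show ?thesis by (simp add: algebra_simps)
qed

lemma norm_cosh_le: "norm (cosh (z::complex)) \<le> exp (norm z)"
proof -
  have "norm (cosh z) \<le> (norm (exp z) + norm (exp (- z))) / 2"
    unfolding cosh_def using norm_triangle_ineq[of "exp z" "exp (- z)"] by simp
  also have "\<dots> \<le> exp (norm z)"
  proof -
    have "exp (Re z) \<le> exp (norm z)" "exp (- Re z) \<le> exp (norm z)"
      using complex_Re_le_cmod[of z] complex_Re_le_cmod[of "- z"] by simp_all
    from add_mono[OF this] show ?thesis by simp
  qed
  finally show ?thesis .
qed

lemma norm_kern_square:
  assumes "Re w \<ge> 1"
  shows "norm (kern (w\<^sup>2) \<tau>) \<le> (exp (- (Re w * \<bar>\<tau>\<bar>)) / 2
     + (1 + \<bar>Im w\<bar>) * exp ((Im w)\<^sup>2 - (Re w)\<^sup>2) / (2 * hgauss_lim) * exp (norm w * \<bar>\<tau>\<bar>)) / norm w"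
proof -
  have "w \<noteq> 0" using assms by auto
  have "norm (exp (- (w * of_real \<bar>\<tau>\<bar>)) / 2
     - (of_real hgauss_lim - w * gint (w\<^sup>2)) / of_real (2 * hgauss_lim) * cosh (w * of_real \<bar>\<tau>\<bar>))
     \<le> norm (exp (- (w * of_real \<bar>\<tau>\<bar>)) / 2)
     + norm ((of_real hgauss_lim - w * gint (w\<^sup>2)) / of_real (2 * hgauss_lim) * cosh (w * of_real \<bar>\<tau>\<bar>))"
    by (rule norm_triangle_ineq4)
  also have "norm (exp (- (w * of_real \<bar>\<tau>\<bar>)) / 2) = exp (- (Re w * \<bar>\<tau>\<bar>)) / 2"
    by simp
  also have "norm ((of_real hgauss_lim - w * gint (w\<^sup>2)) / of_real (2 * hgauss_lim) * cosh (w * of_real \<bar>\<tau>\<bar>))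
     \<le> (1 + \<bar>Im w\<bar>) * exp ((Im w)\<^sup>2 - (Re w)\<^sup>2) / (2 * hgauss_lim) * exp (norm w * \<bar>\<tau>\<bar>)"
  proof -
    have "norm (cosh (w * of_real \<bar>\<tau>\<bar>)) \<le> exp (norm w * \<bar>\<tau>\<bar>)"
      using norm_cosh_le[of "w * of_real \<bar>\<tau>\<bar>"] by (simp add: norm_mult)
    then show ?thesis
      unfolding norm_mult norm_divide using norm_hgauss_tail_complex[OF assms] hgauss_lim_pos
      by (intro mult_mono divide_right_mono) (auto simp: divide_right_mono)
  qed
  finally show ?thesis
    unfolding kern_square[OF \<open>w \<noteq> 0\<close>] norm_divide[of _ w] by (simp add: divide_right_mono)
qed

section \<open>The Green function\<close>

text \<open>Of the two roots, \<open>z\<^sup>2 csqrt (1 - 1 / z\<^sup>2)\<close> is the one close to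
  \<open>z\<^sup>2\<close>. The principal root has nonnegative real part, so
  \<open>csqrt v + 1\<close> has modulus at least 1, and its product with
  \<open>w - z\<^sup>2\<close> is \<open>-1\<close>.\<close>

lemma sqrt_symbol:
  assumes "2 \<le> \<bar>Re z\<bar>" "\<bar>Im z\<bar> \<le> 1 / 2"
  obtains w where "w\<^sup>2 = z ^ 4 - z\<^sup>2" "norm (w - z\<^sup>2) \<le> 1"
proof
  define v where "v = 1 - 1 / z\<^sup>2"
  have "z \<noteq> 0" using assms by auto
  show "(z\<^sup>2 * csqrt v)\<^sup>2 = z ^ 4 - z\<^sup>2"
    using \<open>z \<noteq> 0\<close> by (simp add: power_mult_distrib v_def field_simps flip: power_mult)
  have "Re (csqrt v) \<ge> 0"
    using csqrt_principal[of v] by auto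
  then have ge: "norm (csqrt v + 1) \<ge> 1"
    using complex_Re_le_cmod[of "csqrt v + 1"] by (simp del: csqrt.sel)
  have "(csqrt v - 1) * (csqrt v + 1) = v - 1"
    by (simp add: algebra_simps flip: power2_eq_square)
  then have "(z\<^sup>2 * csqrt v - z\<^sup>2) * (csqrt v + 1) = z\<^sup>2 * (v - 1)"
    by (metis mult.assoc mult.right_neutral right_diff_distrib')
  also have "\<dots> = -1" using \<open>z \<noteq> 0\<close> by (simp add: v_def)
  finally have "norm (z\<^sup>2 * csqrt v - z\<^sup>2) * norm (csqrt v + 1) = 1"
    by (metis norm_minus_cancel norm_mult norm_one)
  then show "norm (z\<^sup>2 * csqrt v - z\<^sup>2) \<le> 1"
    using ge mult_left_mono[OF ge, of "norm (z\<^sup>2 * csqrt v - z\<^sup>2)"] by simp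
qed

definition green_complex :: "complex \<Rightarrow> real \<Rightarrow> complex" where
  "green_complex z \<tau> = z\<^sup>2 * kern (z ^ 4 - z\<^sup>2) \<tau>"

lemma holomorphic_green_complex: "(\<lambda>z. green_complex z \<tau>) holomorphic_on A"
  unfolding green_complex_def kern_def by (intro holomorphic_intros) (use hgauss_lim_pos in auto)

text \<open>Since \<open>Re w \<ge> x\<^sup>2 - 2 \<ge> x\<close>, the exponential part decays at
  least at the rate \<open>x = \<bar>Re z\<bar>\<close>. In the correction the tail is
  \<open>exp (- x ^ 4)\<close> up to lower order in the exponent, which absorbs the growth
  \<open>exp ((x\<^sup>2 + 2) S)\<close> for every \<open>S\<close>.\<close>

lemma norm_green_complex_large:
  assumes x: "2 \<le> \<bar>Re z\<bar>" "\<bar>Im z\<bar> \<le> 1 / 2" and \<tau>: "\<bar>\<tau>\<bar> \<le> S"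
  shows "norm (green_complex z \<tau>) \<le> 3 * (1 / 2 + exp ((4 + S)\<^sup>2 + 2 * S) / (2 * hgauss_lim)) * exp (- (\<bar>Re z\<bar> * \<bar>\<tau>\<bar>))"
proof -
  obtain w where w: "w\<^sup>2 = z ^ 4 - z\<^sup>2" "norm (w - z\<^sup>2) \<le> 1"
    using sqrt_symbol[OF x] .
  define x where "x = \<bar>Re z\<bar>"
  have x2: "x \<ge> 2" using assms by (simp add: x_def)
  then have xx: "2 * x \<le> x\<^sup>2" by (simp add: power2_eq_square)
  have im: "(Im z)\<^sup>2 \<le> 1 / 4"
    using power_mono[of "\<bar>Im z\<bar>" "1/2" 2] assms by (simp add: power2_eq_square)
  have Rez2: "Re (z\<^sup>2) = x\<^sup>2 - (Im z)\<^sup>2" by (simp add: x_def power2_eq_square)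
  have "\<bar>Im (z\<^sup>2)\<bar> = 2 * (x * \<bar>Im z\<bar>)" by (simp add: x_def abs_mult Im_power2)
  also have "\<dots> \<le> x" using mult_left_mono[OF assms(2), of x] x2 by simp
  finally have Imz2: "\<bar>Im (z\<^sup>2)\<bar> \<le> x" .
  have nz: "norm (z\<^sup>2) \<le> x\<^sup>2 + 1 / 4"
    using im by (simp add: norm_power cmod_power2 x_def)
  have Rew: "Re w \<ge> x\<^sup>2 - 2"
    using abs_Re_le_cmod[of "w - z\<^sup>2"] w(2) im Rez2 by simp
  have Imw: "\<bar>Im w\<bar> \<le> x + 1"
    using abs_Im_le_cmod[of "w - z\<^sup>2"] w(2) Imz2 by simp
  have nw: "norm w \<le> x\<^sup>2 + 2"
    using norm_triangle_ineq2[of w "z\<^sup>2"] w(2) nz by simp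
  have Rew1: "Re w \<ge> x" "Re w \<ge> 1" using Rew xx x2 by linarith+
  have S: "S \<ge> 0" using \<tau> by linarith
  have "norm (kern (w\<^sup>2) \<tau>) \<le> (exp (- (x * \<bar>\<tau>\<bar>)) / 2
     + exp ((4 + S)\<^sup>2 + 2 * S) * exp (- (x * \<bar>\<tau>\<bar>)) / (2 * hgauss_lim)) / norm w"
  proof (rule order.trans[OF norm_kern_square[OF Rew1(2)] divide_right_mono[OF add_mono]])
    show "exp (- (Re w * \<bar>\<tau>\<bar>)) / 2 \<le> exp (- (x * \<bar>\<tau>\<bar>)) / 2"
      using Rew1(1) by (simp add: mult_right_mono)
    have "(1 + \<bar>Im w\<bar>) * exp ((Im w)\<^sup>2 - (Re w)\<^sup>2) * exp (norm w * \<bar>\<tau>\<bar>)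
       \<le> exp (x + 2) * exp ((x + 1)\<^sup>2 - (x\<^sup>2 - 2)\<^sup>2) * exp ((x\<^sup>2 + 2) * S)"
    proof (intro mult_mono)
      have "1 + \<bar>Im w\<bar> \<le> 1 + (x + 1)" using Imw by simp
      also have "\<dots> \<le> exp (x + 1)" by (rule exp_ge_add_one_self)
      also have "\<dots> \<le> exp (x + 2)" by simp
      finally show "1 + \<bar>Im w\<bar> \<le> exp (x + 2)" .
      have "(Im w)\<^sup>2 \<le> (x + 1)\<^sup>2" using power_mono[OF Imw, of 2] by simp
      moreover have "(x\<^sup>2 - 2)\<^sup>2 \<le> (Re w)\<^sup>2" using Rew xx x2 by (intro power_mono) auto
      ultimately show "exp ((Im w)\<^sup>2 - (Re w)\<^sup>2) \<le> exp ((x + 1)\<^sup>2 - (x\<^sup>2 - 2)\<^sup>2)" by simp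
      show "exp (norm w * \<bar>\<tau>\<bar>) \<le> exp ((x\<^sup>2 + 2) * S)" using nw \<tau> by (simp add: mult_mono)
    qed auto
    also have "\<dots> = exp (x + 2 + ((x + 1)\<^sup>2 - (x\<^sup>2 - 2)\<^sup>2) + (x\<^sup>2 + 2) * S)"
      by (simp add: exp_add)
    also have "\<dots> \<le> exp ((4 + S)\<^sup>2 + 2 * S - x * \<bar>\<tau>\<bar>)"
    proof -
      \<comment> \<open>Completing the square: the exponent plus \<open>x \<bar>\<tau>\<bar>\<close>
        is at most \<open>2 (4 + S) x\<^sup>2 - x ^ 4 + 2 S\<close>, which is largest at
        \<open>x\<^sup>2 = 4 + S\<close>. This is the origin of the constant
        \<open>(4 + S)\<^sup>2 + 2 S\<close>.\<close>
      have "0 \<le> (x\<^sup>2 - (4 + S))\<^sup>2" by simp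
      moreover have "x * \<bar>\<tau>\<bar> \<le> x\<^sup>2 * S" using xx x2 \<tau> by (intro mult_mono) auto
      ultimately have "x + 2 + ((x + 1)\<^sup>2 - (x\<^sup>2 - 2)\<^sup>2) + (x\<^sup>2 + 2) * S \<le> (4 + S)\<^sup>2 + 2 * S - x * \<bar>\<tau>\<bar>"
        using xx x2 by (simp add: power2_diff power2_sum algebra_simps)
      then show ?thesis by simp
    qed
    also have "\<dots> = exp ((4 + S)\<^sup>2 + 2 * S) * exp (- (x * \<bar>\<tau>\<bar>))"
      by (simp flip: exp_add)
    finally show "(1 + \<bar>Im w\<bar>) * exp ((Im w)\<^sup>2 - (Re w)\<^sup>2) / (2 * hgauss_lim) * exp (norm w * \<bar>\<tau>\<bar>)
       \<le> exp ((4 + S)\<^sup>2 + 2 * S) * exp (- (x * \<bar>\<tau>\<bar>)) / (2 * hgauss_lim)"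
      using hgauss_lim_pos by (simp add: divide_right_mono)
  qed auto
  then have "norm (green_complex z \<tau>) \<le> norm (z\<^sup>2) * ((exp (- (x * \<bar>\<tau>\<bar>)) / 2
     + exp ((4 + S)\<^sup>2 + 2 * S) * exp (- (x * \<bar>\<tau>\<bar>)) / (2 * hgauss_lim)) / norm w)"
    unfolding green_complex_def w(1) [symmetric] norm_mult by (rule mult_left_mono) simp
  also have "\<dots> = (norm (z\<^sup>2) / norm w) * ((1 / 2 + exp ((4 + S)\<^sup>2 + 2 * S) / (2 * hgauss_lim)) * exp (- (x * \<bar>\<tau>\<bar>)))"
    by (simp add: algebra_simps add_divide_distrib)
  also have "\<dots> \<le> 3 * ((1 / 2 + exp ((4 + S)\<^sup>2 + 2 * S) / (2 * hgauss_lim)) * exp (- (x * \<bar>\<tau>\<bar>)))"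
  proof (rule mult_right_mono)
    have "norm w \<ge> x\<^sup>2 - 2" using complex_Re_le_cmod[of w] Rew by linarith
    moreover have "x\<^sup>2 \<ge> 4" using power_mono[OF x2, of 2] by simp
    ultimately have "norm (z\<^sup>2) \<le> 3 * norm w" "norm w > 0" using nz by linarith+
    then show "norm (z\<^sup>2) / norm w \<le> 3" by (simp add: pos_divide_le_eq)
    show "0 \<le> (1 / 2 + exp ((4 + S)\<^sup>2 + 2 * S) / (2 * hgauss_lim)) * exp (- (x * \<bar>\<tau>\<bar>))"
      using hgauss_lim_pos by (intro mult_nonneg_nonneg add_nonneg_nonneg) auto
  qed
  finally show ?thesis by (simp only: x_def mult.assoc)
qed

text \<open>For \<open>\<bar>Re z\<bar> < 2\<close> no root of the symbol is chosen: compactness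
  bounds \<open>green_complex\<close>, and the weight is at least \<open>exp (- 2 S)\<close>
  there.\<close>

lemma norm_green_complex_bound:
  assumes "S \<ge> 0"
  obtains C where "C \<ge> 0" "\<And>z \<tau>. \<bar>Im z\<bar> \<le> 1 / 2 \<Longrightarrow> \<bar>\<tau>\<bar> \<le> S \<Longrightarrow> norm (green_complex z \<tau>) \<le> C * exp (- (\<bar>Re z\<bar> * \<bar>\<tau>\<bar>))"
proof -
  let ?K = "cbox (Complex (-2) (-(1/2))) (Complex 2 (1/2)) \<times> {-S..S}"
  have "continuous_on ?K (\<lambda>(z, \<tau>). green_complex z \<tau>)"
    unfolding green_complex_def kern_def case_prod_unfold
    by (intro continuous_intros) (use hgauss_lim_pos in auto)
  then have "bounded ((\<lambda>(z, \<tau>). green_complex z \<tau>) ` ?K)"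
    by (intro compact_imp_bounded compact_continuous_image compact_Times) auto
  then obtain B where "\<forall>x\<in>(\<lambda>(z, \<tau>). green_complex z \<tau>) ` ?K. norm x \<le> B"
    unfolding bounded_iff by blast
  then have B: "norm (green_complex z \<tau>) \<le> B" if "(z, \<tau>) \<in> ?K" for z \<tau>
    using that by force
  have "norm (green_complex 0 0) \<le> B" using assms by (intro B) (auto simp: in_cbox_complex_iff)
  then have B0: "B \<ge> 0" using norm_ge_zero order_trans by blast
  define C1 where "C1 = 3 * (1 / 2 + exp ((4 + S)\<^sup>2 + 2 * S) / (2 * hgauss_lim))"
  have C1: "C1 \<ge> 0" unfolding C1_def using hgauss_lim_pos by simp
  show ?thesis
  proof (rule that[of "max C1 (B * exp (2 * S))"])
    show "max C1 (B * exp (2 * S)) \<ge> 0" using C1 by simp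
    fix z \<tau> assume z: "\<bar>Im z\<bar> \<le> 1 / 2" "\<bar>\<tau>\<bar> \<le> S"
    show "norm (green_complex z \<tau>) \<le> max C1 (B * exp (2 * S)) * exp (- (\<bar>Re z\<bar> * \<bar>\<tau>\<bar>))"
    proof (cases "2 \<le> \<bar>Re z\<bar>")
      case True
      then have "norm (green_complex z \<tau>) \<le> C1 * exp (- (\<bar>Re z\<bar> * \<bar>\<tau>\<bar>))"
        unfolding C1_def using z by (intro norm_green_complex_large) auto
      then show ?thesis by (rule order_trans) (simp add: mult_right_mono)
    next
      case False
      then have "norm (green_complex z \<tau>) \<le> B"
        using z by (intro B) (auto simp: in_cbox_complex_iff)
      also have "\<bar>Re z\<bar> * \<bar>\<tau>\<bar> \<le> 2 * S" using False z by (intro mult_mono) auto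
      then have "B \<le> B * exp (2 * S) * exp (- (\<bar>Re z\<bar> * \<bar>\<tau>\<bar>))"
        using B0 by (simp add: mult.assoc mult_left_le flip: exp_add) (simp add: mult_le_cancel_left1)
      also have "\<dots> \<le> max C1 (B * exp (2 * S)) * exp (- (\<bar>Re z\<bar> * \<bar>\<tau>\<bar>))"
        by (simp add: mult_right_mono)
      finally show ?thesis .
    qed
  qed
qed

definition green :: "real \<Rightarrow> real \<Rightarrow> real" where
  "green k \<tau> = k\<^sup>2 * (rgint (k ^ 4 - k\<^sup>2) / (2 * hgauss_lim) * Ch (k ^ 4 - k\<^sup>2) \<tau> - Sh (k ^ 4 - k\<^sup>2) \<bar>\<tau>\<bar> / 2)"

lemma green_complex_of_real: "green_complex (of_real k) \<tau> = of_real (green k \<tau>)"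
proof -
  have "(of_real k) ^ 4 - (of_real k)\<^sup>2 = complex_of_real (k ^ 4 - k\<^sup>2)" by simp
  then have "green_complex (of_real k) \<tau> = (of_real k)\<^sup>2 * kern (complex_of_real (k ^ 4 - k\<^sup>2)) \<tau>"
    unfolding green_complex_def by simp
  also have "\<dots> = of_real (green k \<tau>)"
    unfolding kern_def green_def Ch_def Sh_def of_real_mult [symmetric] cosh_sqrt_of_real sinhc_sqrt_of_real gint_of_real
    by simp
  finally show ?thesis .
qed

lemma green_minus [simp]: "green (- k) \<tau> = green k \<tau>"
  by (simp add: green_def)

lemma continuous_on_green: "continuous_on A (\<lambda>(k, \<tau>). green k \<tau>)"
proof -
  have "continuous_on A (\<lambda>p. Re (green_complex (of_real (fst p)) (snd p)))"
    unfolding green_complex_def kern_def by (intro continuous_intros) (use hgauss_lim_pos in auto)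
  then show ?thesis by (simp add: green_complex_of_real case_prod_unfold)
qed

text \<open>Keeping only \<open>r \<le> 1 / k\<^sup>2\<close> in the integral is enough: there
  \<open>(k ^ 4 - k\<^sup>2) r\<^sup>2 \<le> 1\<close>, so the integrand is at least
  \<open>exp (-1)\<close>, and the length \<open>1 / k\<^sup>2\<close> cancels the prefactor
  \<open>k\<^sup>2\<close>. This keeps the tail of the profile from becoming too small.\<close>

lemma green_0_ge:
  assumes "\<bar>k\<bar> \<ge> 1"
  shows "green k 0 \<ge> exp (-1) / (2 * hgauss_lim)"
proof -
  let ?W = "k ^ 4 - k\<^sup>2"
  have k2: "k\<^sup>2 \<ge> 1" using assms by (simp add: abs_le_square_iff[of 1 k, simplified])
  then have "k \<noteq> 0" by auto
  have "k\<^sup>2 * (exp (-1) * (1 / k\<^sup>2)) \<le> k\<^sup>2 * rgint ?W"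
  proof (rule mult_left_mono)
    have "exp (-1) * (1 / k\<^sup>2) = integral {0..1 / k\<^sup>2} (\<lambda>r. exp (-1))" using k2 by simp
    also have "\<dots> \<le> integral {0..1 / k\<^sup>2} (\<lambda>r. exp (- ?W * r\<^sup>2))"
    proof (intro integral_le integrable_continuous_real continuous_intros)
      fix r assume r: "r \<in> {0..1 / k\<^sup>2}"
      have "?W * r\<^sup>2 \<le> k ^ 4 * r\<^sup>2" by (intro mult_right_mono) auto
      also have "\<dots> = (k\<^sup>2 * r)\<^sup>2" by (simp add: power_mult_distrib flip: power_mult)
      also have "\<dots> \<le> 1" using r \<open>k \<noteq> 0\<close> by (intro power_le_one) (auto simp: pos_le_divide_eq mult.commute)
      finally show "exp (- 1) \<le> exp (- ?W * r\<^sup>2)" by (simp add: algebra_simps)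
    qed
    also have "\<dots> \<le> rgint ?W"
      unfolding rgint_def using k2 \<open>k \<noteq> 0\<close>
      by (intro integral_subset_le integrable_continuous_real continuous_intros) (auto simp: divide_le_eq)
    finally show "exp (-1) * (1 / k\<^sup>2) \<le> rgint ?W" .
  qed auto
  then have "exp (-1) \<le> k\<^sup>2 * rgint ?W" using k2 by (auto split: if_splits)
  then have "exp (-1) / (2 * hgauss_lim) \<le> k\<^sup>2 * rgint ?W / (2 * hgauss_lim)"
    using hgauss_lim_pos by (intro divide_right_mono) auto
  then show ?thesis by (simp add: green_def)
qed

lemma symbol_bound_green:
  assumes "S \<ge> 0"
  shows "symbol_bound {-S..S} (\<lambda>\<tau> k. exp (- (\<bar>k\<bar> * \<bar>\<tau>\<bar>))) (\<lambda>\<tau> k. green k \<tau>)"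
proof -
  obtain C where C: "C \<ge> 0" "\<And>z \<tau>. \<bar>Im z\<bar> \<le> 1 / 2 \<Longrightarrow> \<bar>\<tau>\<bar> \<le> S \<Longrightarrow> norm (green_complex z \<tau>) \<le> C * exp (- (\<bar>Re z\<bar> * \<bar>\<tau>\<bar>))"
    using norm_green_complex_bound[OF assms] by blast
  have "symbol_bound {-S..S} (\<lambda>\<tau> k. exp (- (\<bar>k\<bar> * \<bar>\<tau>\<bar>))) (\<lambda>\<tau> k. Re (green_complex (of_real k) \<tau>))"
  proof (rule symbol_bound_holomorphic[where r = "1 / 2" and C = C and K = "exp S" and F = "\<lambda>\<tau> z. green_complex z \<tau>"])
    fix \<tau> x y assume "\<tau> \<in> {-S..S}" and xy: "\<bar>y - x\<bar> \<le> (1::real)"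
    then have "\<bar>x\<bar> * \<bar>\<tau>\<bar> \<le> (\<bar>y\<bar> + 1) * \<bar>\<tau>\<bar>" "\<bar>\<tau>\<bar> \<le> S" by (auto intro!: mult_right_mono)
    then have "- (\<bar>y\<bar> * \<bar>\<tau>\<bar>) \<le> S + - (\<bar>x\<bar> * \<bar>\<tau>\<bar>)" by (simp add: algebra_simps)
    then have "exp (- (\<bar>y\<bar> * \<bar>\<tau>\<bar>)) \<le> exp (S + - (\<bar>x\<bar> * \<bar>\<tau>\<bar>))" by simp
    then show "exp (- (\<bar>y\<bar> * \<bar>\<tau>\<bar>)) \<le> exp S * exp (- (\<bar>x\<bar> * \<bar>\<tau>\<bar>))" by (simp only: exp_add)
  qed (use C in \<open>auto intro: holomorphic_green_complex\<close>)
  then show ?thesis by (simp add: green_complex_of_real)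
qed

lemma inverse_quadratic_shift:
  assumes "\<bar>y - x\<bar> \<le> (1::real)"
  shows "1 / (1 + y\<^sup>2) \<le> 4 * (1 / (1 + x\<^sup>2))"
proof -
  have "(x - y)\<^sup>2 \<le> 1" using assms by (simp add: abs_square_le_1 abs_minus_commute)
  moreover have "x\<^sup>2 \<le> 2 * (x - y)\<^sup>2 + 2 * y\<^sup>2"
    using zero_le_power2[of "x - 2 * y"] by (simp add: power2_eq_square algebra_simps)
  ultimately have "1 + x\<^sup>2 \<le> 4 * (1 + y\<^sup>2)" by (smt (verit) zero_le_power2)
  then show ?thesis by (simp add: field_simps add_pos_nonneg)
qed

text \<open>The poles at plus and minus \<open>\<i>\<close> lie outside the strip of half-width
  \<open>1 / 2\<close>, in which
  \<open>Re (1 + z\<^sup>2) \<ge> (1 + (Re z)\<^sup>2) / 2\<close>.\<close>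

lemma symbol_bound_inverse_quadratic: "symbol_bound P (\<lambda>p k. 1 / (1 + k\<^sup>2)) (\<lambda>p k. 1 / (1 + k\<^sup>2))"
proof -
  have "symbol_bound P (\<lambda>p k. 1 / (1 + k\<^sup>2)) (\<lambda>p k. Re (1 / (1 + (of_real k)\<^sup>2)))"
  proof (rule symbol_bound_holomorphic[where r = "1 / 2" and C = 2 and K = 4 and F = "\<lambda>p z. 1 / (1 + z\<^sup>2)"])
    have re: "Re (1 + z\<^sup>2) \<ge> (1 + (Re z)\<^sup>2) / 2" if "\<bar>Im z\<bar> < 1 / 2" for z
    proof -
      have "(Im z)\<^sup>2 \<le> 1 / 4" using power_mono[of "\<bar>Im z\<bar>" "1/2" 2] that by (simp add: power2_eq_square)
      then show ?thesis using zero_le_power2[of "Re z"] by (simp add: power2_eq_square)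
    qed
    have nz: "1 + z\<^sup>2 \<noteq> 0" if "\<bar>Im z\<bar> < 1 / 2" for z
    proof
      assume eq: "1 + z\<^sup>2 = 0"
      have "(1 + (Re z)\<^sup>2) / 2 \<le> 0" using re[OF that] unfolding eq by simp
      moreover have "1 + (Re z)\<^sup>2 > 0" by (simp add: add_pos_nonneg)
      ultimately show False by (metis half_gt_zero leD)
    qed
    show "(\<lambda>z. 1 / (1 + z\<^sup>2)) holomorphic_on {z. \<bar>Im z\<bar> < 1 / 2}"
      using nz by (intro holomorphic_intros) auto
    show "norm (1 / (1 + z\<^sup>2)) \<le> 2 * (1 / (1 + (Re z)\<^sup>2))" if "\<bar>Im z\<bar> < 1 / 2" for z
    proof -
      have "(1 + (Re z)\<^sup>2) / 2 \<le> norm (1 + z\<^sup>2)" using re[OF that] complex_Re_le_cmod order_trans by blast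
      moreover have "1 + (Re z)\<^sup>2 > 0" by (simp add: add_pos_nonneg)
      moreover have "1 / n \<le> 1 / (d / 2)" if "d / 2 \<le> n" "0 < d" for n d :: real
        using that by (simp add: field_simps)
      ultimately have "1 / norm (1 + z\<^sup>2) \<le> 1 / ((1 + (Re z)\<^sup>2) / 2)" by blast
      then show ?thesis by (simp add: norm_divide)
    qed
  qed (use inverse_quadratic_shift in auto)
  moreover have "Re (1 / (1 + (of_real k)\<^sup>2)) = 1 / (1 + k\<^sup>2)" for k
    by (metis Re_complex_of_real of_real_1 of_real_add of_real_divide of_real_power)
  ultimately show ?thesis by simp
qed

section \<open>Weighted convolution\<close>

lemma continuous_on_LINT:
  fixes f :: "'x::{first_countable_topology,t2_space} \<Rightarrow> real \<Rightarrow> real"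
  assumes cont: "\<And>l. continuous_on U (\<lambda>x. f x l)"
    and meas: "\<And>x. x \<in> U \<Longrightarrow> f x \<in> borel_measurable lborel"
    and bd: "\<And>x l. x \<in> U \<Longrightarrow> \<bar>f x l\<bar> \<le> D l" and D: "integrable lborel D"
  shows "continuous_on U (\<lambda>x. LINT l|lborel. f x l)"
  unfolding continuous_on_sequentially
proof (intro allI ballI impI)
  fix X :: "nat \<Rightarrow> 'x" and a assume a: "a \<in> U" "(\<forall>n. X n \<in> U) \<and> X \<longlonglongrightarrow> a"
  have "(\<lambda>n. LINT l|lborel. f (X n) l) \<longlonglongrightarrow> (LINT l|lborel. f a l)"
  proof (rule integral_dominated_convergence[where w = D])
    have "(\<lambda>n. f (X n) l) \<longlonglongrightarrow> f a l" for l
      using cont[of l] a unfolding continuous_on_sequentially by (auto simp: o_def)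
    then show "AE l in lborel. (\<lambda>n. f (X n) l) \<longlonglongrightarrow> f a l" by simp
  qed (use a meas bd D in auto)
  then show "((\<lambda>x. LINT l|lborel. f x l) \<circ> X) \<longlonglongrightarrow> (LINT l|lborel. f a l)" by (simp add: o_def)
qed

lemma one_plus_square_pos: "1 + x\<^sup>2 > (0::real)"
  by (simp add: add_pos_nonneg)

lemma integrable_inverse_quadratic: "integrable lborel (\<lambda>x::real. 1 / (1 + x\<^sup>2))"
proof -
  let ?f = "\<lambda>x::real. 1 / (1 + x\<^sup>2)"
  have "(\<integral>\<^sup>+x. ennreal (?f x) * indicator {0..} x \<partial>lborel) = ennreal (pi / 2 - arctan 0)"
  proof (rule nn_integral_FTC_atLeast)
    show "DERIV arctan x :> ?f x" for x
      using DERIV_arctan[of x] by (simp add: inverse_eq_divide)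
    show "(arctan \<longlongrightarrow> pi / 2) at_top" by (rule tendsto_arctan_at_top)
  qed auto
  then have "(\<integral>\<^sup>+x. ennreal (norm (indicator {0..} x * ?f x)) \<partial>lborel) < \<infinity>"
    by (simp add: abs_mult indicator_mult_ennreal mult.commute ennreal_mult'' ennreal_indicator)
  then have 1: "integrable lborel (\<lambda>x. indicator {0..} x * ?f x)"
    by (intro integrableI_bounded) auto
  from lborel_integrable_real_affine[OF this, of "-1" 0]
  have 2: "integrable lborel (\<lambda>x. indicator {0..} (- x) * ?f x)" by simp
  show ?thesis
    by (rule Bochner_Integration.integrable_bound[OF Bochner_Integration.integrable_add[OF 1 2]])
       (auto intro!: AE_I2 simp: indicator_def)
qed

definition quad_mass :: real where "quad_mass = (LINT x|lborel. 1 / (1 + x\<^sup>2))"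

lemma quad_mass_nonneg: "quad_mass \<ge> 0"
  unfolding quad_mass_def by (rule Bochner_Integration.integral_nonneg) simp

definition wt :: "real \<Rightarrow> real \<Rightarrow> real" where "wt k s = exp (- (s * \<bar>k\<bar>)) / (1 + k\<^sup>2)"

lemma wt_pos: "wt k s > 0"
  by (simp add: wt_def one_plus_square_pos)

lemma wt_minus [simp]: "wt (- k) s = wt k s"
  by (simp add: wt_def)

lemma wt_le: "s \<ge> 0 \<Longrightarrow> wt k s \<le> 1 / (1 + k\<^sup>2)"
  unfolding wt_def using one_plus_square_pos[of k] by (intro divide_right_mono) auto

lemma continuous_on_wt: "continuous_on A (\<lambda>(k, s). wt k s)"
proof -
  have "1 + (fst p)\<^sup>2 \<noteq> (0::real)" for p :: "real \<times> real"
    using one_plus_square_pos[of "fst p"] by linarith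
  then show ?thesis
    unfolding wt_def case_prod_unfold by (intro continuous_intros ballI) auto
qed

text \<open>The exponentials combine by the triangle inequality. The quadratic part rests on
  \<open>2 (k - l)\<^sup>2 + 2 l\<^sup>2 - k\<^sup>2 = (k - 2 l)\<^sup>2\<close>. The remaining
  factor is integrable in \<open>l\<close> with mass \<open>4 quad_mass\<close>, whatever
  \<open>k\<close> is, so functions dominated by the weight form a convolution algebra.\<close>

lemma wt_mult:
  assumes "s \<ge> 0"
  shows "wt (k - l) s * wt l s \<le> wt k s * (2 * (1 / (1 + l\<^sup>2)) + 2 * (1 / (1 + (k - l)\<^sup>2)))"
proof -
  let ?a = "1 + (k - l)\<^sup>2" and ?b = "1 + l\<^sup>2" and ?c = "1 + k\<^sup>2"
  have pos: "?a > 0" "?b > 0" "?c > 0" by (rule one_plus_square_pos)+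
  have "k\<^sup>2 \<le> 2 * (k - l)\<^sup>2 + 2 * l\<^sup>2"
    using zero_le_power2[of "k - 2 * l"] by (simp add: power2_eq_square algebra_simps)
  then have c: "?c \<le> 2 * ?a + 2 * ?b" by simp
  have "s * \<bar>k\<bar> \<le> s * (\<bar>k - l\<bar> + \<bar>l\<bar>)" using assms by (intro mult_left_mono) auto
  then have "exp (- (s * \<bar>k - l\<bar>)) * exp (- (s * \<bar>l\<bar>)) \<le> exp (- (s * \<bar>k\<bar>))"
    by (simp add: algebra_simps flip: exp_add)
  then have "wt (k - l) s * wt l s \<le> exp (- (s * \<bar>k\<bar>)) * (1 / (?a * ?b))"
    unfolding wt_def using pos by (simp add: divide_right_mono)
  also have "1 / (?a * ?b) \<le> (2 / ?b + 2 / ?a) / ?c"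
  proof -
    have "?c / (?a * ?b) \<le> (2 * ?a + 2 * ?b) / (?a * ?b)" using c pos by (intro divide_right_mono) auto
    also have "(2 * a + 2 * b) / (a * b) = 2 / b + 2 / a" if "a > 0" "b > 0" for a b :: real
      using that by (simp add: field_simps)
    from this[OF pos(1,2)] have "(2 * ?a + 2 * ?b) / (?a * ?b) = 2 / ?b + 2 / ?a" .
    finally show ?thesis using pos by (simp add: pos_le_divide_eq mult.commute)
  qed
  then have "exp (- (s * \<bar>k\<bar>)) * (1 / (?a * ?b)) \<le> exp (- (s * \<bar>k\<bar>)) * ((2 / ?b + 2 / ?a) / ?c)"
    by (rule mult_left_mono) simp
  finally show ?thesis by (simp add: wt_def)
qed

definition conv :: "(real \<Rightarrow> real) \<Rightarrow> (real \<Rightarrow> real) \<Rightarrow> real \<Rightarrow> real" where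
  "conv f g k = (LINT l|lborel. f (k - l) * g l)"

lemma integrable_conv_majorant:
  "integrable lborel (\<lambda>l. 2 * (1 / (1 + l\<^sup>2)) + 2 * (1 / (1 + (k - l)\<^sup>2 :: real)))"
  and integral_conv_majorant:
  "(LINT l|lborel. 2 * (1 / (1 + l\<^sup>2)) + 2 * (1 / (1 + (k - l)\<^sup>2))) = 4 * quad_mass"
proof -
  note i1 = integrable_inverse_quadratic
  have i2: "integrable lborel (\<lambda>l. 1 / (1 + (k - l)\<^sup>2))"
    using lborel_integrable_real_affine[OF i1, of "-1" k] by simp
  have e2: "(LINT l|lborel. 1 / (1 + (k - l)\<^sup>2)) = quad_mass"
    using lborel_integral_real_affine[of "-1" "\<lambda>l. 1 / (1 + l\<^sup>2)" k] by (simp add: quad_mass_def)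
  show "integrable lborel (\<lambda>l. 2 * (1 / (1 + l\<^sup>2)) + 2 * (1 / (1 + (k - l)\<^sup>2 :: real)))"
    by (intro Bochner_Integration.integrable_add integrable_mult_right i1 i2)
  show "(LINT l|lborel. 2 * (1 / (1 + l\<^sup>2)) + 2 * (1 / (1 + (k - l)\<^sup>2))) = 4 * quad_mass"
  proof -
    have "(LINT l|lborel. 2 * (1 / (1 + l\<^sup>2)) + 2 * (1 / (1 + (k - l)\<^sup>2)))
      = (LINT l|lborel. 2 * (1 / (1 + l\<^sup>2))) + (LINT l|lborel. 2 * (1 / (1 + (k - l)\<^sup>2)))"
      by (intro Bochner_Integration.integral_add integrable_mult_right i1 i2)
    then show ?thesis unfolding integral_mult_right_zero e2 quad_mass_def by linarith
  qed
qed

lemma conv_bound: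
  assumes [measurable]: "f \<in> borel_measurable borel" "g \<in> borel_measurable borel"
    and f: "\<And>l. \<bar>f l\<bar> \<le> A * wt l s" and g: "\<And>l. \<bar>g l\<bar> \<le> B * wt l s" and "s \<ge> 0"
  shows "integrable lborel (\<lambda>l. f (k - l) * g l)"
    and "\<bar>conv f g k\<bar> \<le> A * B * (4 * quad_mass) * wt k s"
proof -
  let ?m = "\<lambda>l. 2 * (1 / (1 + l\<^sup>2)) + 2 * (1 / (1 + (k - l)\<^sup>2))"
  have A: "A \<ge> 0" and B: "B \<ge> 0"
    using f[of 0] g[of 0] wt_pos[of 0 s] by (metis abs_ge_zero dual_order.trans not_less zero_le_mult_iff)+
  have bd: "\<bar>f (k - l) * g l\<bar> \<le> A * B * wt k s * ?m l" for l
  proof -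
    have "\<bar>f (k - l) * g l\<bar> \<le> (A * wt (k - l) s) * (B * wt l s)"
      unfolding abs_mult using A less_imp_le[OF wt_pos] by (intro mult_mono f g) auto
    also have "\<dots> = A * B * (wt (k - l) s * wt l s)" by simp
    also have "\<dots> \<le> A * B * (wt k s * ?m l)"
      using A B \<open>s \<ge> 0\<close> by (intro mult_left_mono wt_mult) auto
    finally show ?thesis by (simp add: mult.assoc)
  qed
  have im: "integrable lborel (\<lambda>l. A * B * wt k s * ?m l)"
    by (intro integrable_mult_right integrable_conv_majorant)
  show int: "integrable lborel (\<lambda>l. f (k - l) * g l)"
    by (rule Bochner_Integration.integrable_bound[OF im])
       (use bd in \<open>auto intro!: AE_I2 intro: order_trans[OF _ abs_ge_self]\<close>)
  have "\<bar>conv f g k\<bar> \<le> (LINT l|lborel. A * B * wt k s * ?m l)"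
    unfolding conv_def by (rule integral_abs_bound[THEN order_trans])
      (intro integral_mono im bd Bochner_Integration.integrable_abs int)
  also have "\<dots> = A * B * (4 * quad_mass) * wt k s"
    by (subst integral_mult_right_zero) (simp only: integral_conv_majorant mult_ac)
  finally show "\<bar>conv f g k\<bar> \<le> A * B * (4 * quad_mass) * wt k s" .
qed

lemma conv_minus_even:
  assumes "\<And>k. f (- k) = f k" "\<And>k. g (- k) = g k"
  shows "conv f g (- k) = conv f g k"
proof -
  have "conv f g (- k) = (LINT l|lborel. f (- k - (0 + -1 * l)) * g (0 + - 1 * l))"
    unfolding conv_def by (subst lborel_integral_real_affine[of "-1" _ 0]) auto
  also have "\<dots> = conv f g k"
    unfolding conv_def using assms(1)[of "k - _"] assms(2) by (simp add: minus_diff_commute)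
  finally show ?thesis .
qed

lemma continuous_on_conv:
  fixes a b :: "real \<Rightarrow> real \<Rightarrow> real"
  assumes a: "continuous_on (UNIV \<times> T) (\<lambda>(k, s). a k s)" and b: "continuous_on (UNIV \<times> T) (\<lambda>(k, s). b k s)"
    and bda: "\<And>k s. s \<in> T \<Longrightarrow> \<bar>a k s\<bar> \<le> A * wt k s" and bdb: "\<And>k s. s \<in> T \<Longrightarrow> \<bar>b k s\<bar> \<le> B * wt k s"
    and T: "T \<subseteq> {0..}"
  shows "continuous_on (UNIV \<times> T) (\<lambda>(k, s). conv (\<lambda>k. a k s) (\<lambda>k. b k s) k)"
proof (cases "T = {}")
  case False
  have ca: "continuous_on (UNIV \<times> T) (\<lambda>p. a (fst p - l) (snd p))" for l
    using continuous_on_compose2[OF a, of "UNIV \<times> T" "\<lambda>p. (fst p - l, snd p)"]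
    by (auto simp: continuous_intros image_subset_iff)
  have cb: "continuous_on (UNIV \<times> T) (\<lambda>p. b l (snd p))" for l
    using continuous_on_compose2[OF b, of "UNIV \<times> T" "\<lambda>p. (l, snd p)"]
    by (auto simp: continuous_intros image_subset_iff)
  have ca': "continuous_on UNIV (\<lambda>l. a (k - l) s)" if "s \<in> T" for k s
    using continuous_on_compose2[OF a, of UNIV "\<lambda>l. (k - l, s)"] that
    by (auto simp: continuous_intros image_subset_iff)
  have cb': "continuous_on UNIV (\<lambda>l. b l s)" if "s \<in> T" for s
    using continuous_on_compose2[OF b, of UNIV "\<lambda>l. (l, s)"] that
    by (auto simp: continuous_intros image_subset_iff)
  have A: "A \<ge> 0" and B: "B \<ge> 0"
    using False bda[of _ 0] bdb[of _ 0] wt_pos[of 0]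
    by (metis abs_ge_zero dual_order.trans equals0I not_less zero_le_mult_iff)+
  have "continuous_on (UNIV \<times> T) (\<lambda>p. LINT l|lborel. a (fst p - l) (snd p) * b l (snd p))"
  proof (rule continuous_on_LINT)
    show "continuous_on (UNIV \<times> T) (\<lambda>p. a (fst p - l) (snd p) * b l (snd p))" for l
      by (intro continuous_on_mult ca cb)
    show "(\<lambda>l. a (fst p - l) (snd p) * b l (snd p)) \<in> borel_measurable lborel" if "p \<in> UNIV \<times> T" for p :: "real \<times> real"
    proof -
      have "continuous_on UNIV (\<lambda>l. a (fst p - l) (snd p) * b l (snd p))"
        using that by (intro continuous_on_mult ca' cb') auto
      then show ?thesis by (simp add: borel_measurable_continuous_onI)
    qed
    show "integrable lborel (\<lambda>l. A * (B * (1 / (1 + l\<^sup>2))))"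
      by (intro integrable_mult_right integrable_inverse_quadratic)
    fix p :: "real \<times> real" and l assume p: "p \<in> UNIV \<times> T"
    then have s: "snd p \<ge> 0" "snd p \<in> T" using T by auto
    have le1: "wt k (snd p) \<le> 1" for k
      using wt_le[OF s(1), of k] one_plus_square_pos[of k] by (auto simp: divide_le_eq intro: order_trans)
    have "\<bar>a (fst p - l) (snd p)\<bar> \<le> A"
      using bda[OF s(2), of "fst p - l"] mult_left_mono[OF le1 A, of "fst p - l"] by simp
    moreover have "\<bar>b l (snd p)\<bar> \<le> B * (1 / (1 + l\<^sup>2))"
      using bdb[OF s(2), of l] mult_left_mono[OF wt_le[OF s(1), of l] B] by linarith
    ultimately show "\<bar>a (fst p - l) (snd p) * b l (snd p)\<bar> \<le> A * (B * (1 / (1 + l\<^sup>2)))"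
      unfolding abs_mult using A by (intro mult_mono) auto
  qed
  then show ?thesis by (simp add: conv_def case_prod_unfold)
qed simp

text \<open>The integral covers all of \<open>{0..S}\<close>, so sources at later times
  \<open>r > s\<close> act as well. An integral over \<open>{0..s}\<close> with zero initial data
  would excite the modes that grow like \<open>exp (k\<^sup>2 s)\<close>.\<close>

definition duhamel :: "real \<Rightarrow> (real \<Rightarrow> real \<Rightarrow> real) \<Rightarrow> real \<Rightarrow> real \<Rightarrow> real" where
  "duhamel S g k s = integral {0..S} (\<lambda>r. green k (s - r) * g k r)"

lemma continuous_on_green_mult:
  assumes "continuous_on {0..S} (g k)"
  shows "continuous_on {0..S} (\<lambda>r. green k (s - r) * g k r)"
proof -
  have "continuous_on {0..S} (\<lambda>r. (\<lambda>(k, \<tau>). green k \<tau>) (k, s - r))"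
    by (rule continuous_on_compose2[OF continuous_on_green[of UNIV]]) (auto intro!: continuous_intros)
  then show ?thesis using assms by (auto intro!: continuous_intros)
qed

text \<open>Kernel and weight have the same rate \<open>\<bar>k\<bar>\<close>, so
  \<open>s \<le> \<bar>s - r\<bar> + r\<close> is enough. The kernel's decay is spent on restoring
  the weight, hence the factor \<open>S\<close> in the bound of the integral below.\<close>

lemma wt_kernel:
  assumes "0 \<le> r"
  shows "exp (- (\<bar>k\<bar> * \<bar>s - r\<bar>)) * wt k r \<le> wt k s"
proof -
  have "\<bar>k\<bar> * s \<le> \<bar>k\<bar> * (\<bar>s - r\<bar> + r)" by (intro mult_left_mono) auto
  then have "exp (- (\<bar>k\<bar> * \<bar>s - r\<bar>)) * exp (- (r * \<bar>k\<bar>)) \<le> exp (- (s * \<bar>k\<bar>))"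
    by (simp add: algebra_simps flip: exp_add)
  then show ?thesis
    unfolding wt_def using one_plus_square_pos[of k] by (simp add: divide_right_mono)
qed

lemma duhamel_bound:
  assumes R: "\<And>\<tau>. \<bar>\<tau>\<bar> \<le> S \<Longrightarrow> \<bar>green k \<tau>\<bar> \<le> C * exp (- (\<bar>k\<bar> * \<bar>\<tau>\<bar>))" and "C \<ge> 0"
    and g: "continuous_on {0..S} (g k)" "\<And>r. r \<in> {0..S} \<Longrightarrow> \<bar>g k r\<bar> \<le> B * wt k r"
    and s: "s \<in> {0..S}"
  shows "\<bar>duhamel S g k s\<bar> \<le> C * S * B * wt k s"
proof -
  have B: "B \<ge> 0" using g(2)[OF s] wt_pos[of k s]
    by (metis abs_ge_zero dual_order.trans not_less zero_le_mult_iff)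
  have "\<bar>green k (s - r) * g k r\<bar> \<le> C * B * wt k s" if "r \<in> {0..S}" for r
  proof -
    have "\<bar>green k (s - r) * g k r\<bar> \<le> (C * exp (- (\<bar>k\<bar> * \<bar>s - r\<bar>))) * (B * wt k r)"
      unfolding abs_mult using that s \<open>C \<ge> 0\<close> by (intro mult_mono R g) auto
    also have "\<dots> = C * B * (exp (- (\<bar>k\<bar> * \<bar>s - r\<bar>)) * wt k r)" by simp
    also have "\<dots> \<le> C * B * wt k s"
      using that B \<open>C \<ge> 0\<close> by (intro mult_left_mono wt_kernel) auto
    finally show ?thesis .
  qed
  then have "norm (integral {0..S} (\<lambda>r. green k (s - r) * g k r)) \<le> C * B * wt k s * (S - 0)"
    using s by (intro integral_bound continuous_on_green_mult g) auto
  then show ?thesis by (simp add: duhamel_def mult_ac)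
qed

lemma duhamel_diff:
  assumes "continuous_on {0..S} (g k)" "continuous_on {0..S} (h k)"
  shows "duhamel S g k s - duhamel S h k s = duhamel S (\<lambda>k r. g k r - h k r) k s"
  unfolding duhamel_def right_diff_distrib
  by (rule Henstock_Kurzweil_Integration.integral_diff [symmetric];
      intro integrable_continuous_real continuous_on_green_mult assms)

lemma continuous_on_duhamel:
  assumes "continuous_on (UNIV \<times> {0..S}) (\<lambda>(k, s). g k s)"
  shows "continuous_on UNIV (\<lambda>(k, s). duhamel S g k s)"
proof -
  have "continuous_on (UNIV \<times> cbox 0 S) (\<lambda>(p, r). green (fst p) (snd p - r) * g (fst p) r)"
    unfolding case_prod_unfold
  proof (intro continuous_on_mult)
    show "continuous_on (UNIV \<times> cbox 0 S) (\<lambda>x. green (fst (fst x)) (snd (fst x) - snd x))"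
      using continuous_on_compose2[OF continuous_on_green[of UNIV], of "UNIV \<times> cbox 0 S" "\<lambda>x. (fst (fst x), snd (fst x) - snd x)"]
      by (auto simp: continuous_intros image_subset_iff)
    show "continuous_on (UNIV \<times> cbox 0 S) (\<lambda>x. g (fst (fst x)) (snd x))"
      using continuous_on_compose2[OF assms, of "UNIV \<times> cbox 0 S" "\<lambda>x. (fst (fst x), snd x)"]
      by (auto simp: continuous_intros image_subset_iff)
  qed
  from integral_continuous_on_param[OF this] show ?thesis
    by (simp add: duhamel_def case_prod_unfold)
qed

section \<open>The fixed point\<close>

lemma conv_square_diff:
  assumes [measurable]: "f \<in> borel_measurable borel" "g \<in> borel_measurable borel"
    and f: "\<And>l. \<bar>f l\<bar> \<le> M * wt l s" and g: "\<And>l. \<bar>g l\<bar> \<le> M * wt l s"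
    and d: "\<And>l. \<bar>f l - g l\<bar> \<le> D * wt l s" and "s \<ge> 0"
  shows "\<bar>conv f f k - conv g g k\<bar> \<le> 2 * D * M * (4 * quad_mass) * wt k s"
proof -
  note i = conv_bound(1)[where k = k and s = s]
  have "conv f f k - conv g g k = conv (\<lambda>l. f l - g l) f k + conv g (\<lambda>l. f l - g l) k"
  proof -
    have "integrable lborel (\<lambda>l. f (k - l) * f l)" "integrable lborel (\<lambda>l. g (k - l) * g l)"
      by (rule i[OF _ _ f f]; simp add: \<open>s \<ge> 0\<close>) (rule i[OF _ _ g g]; simp add: \<open>s \<ge> 0\<close>)
    moreover have "integrable lborel (\<lambda>l. (f (k - l) - g (k - l)) * f l)"
      by (rule i[OF _ _ d f]; simp add: \<open>s \<ge> 0\<close>)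
    moreover have "integrable lborel (\<lambda>l. g (k - l) * (f l - g l))"
      by (rule i[OF _ _ g d]; simp add: \<open>s \<ge> 0\<close>)
    ultimately show ?thesis
      unfolding conv_def
      by (simp add: algebra_simps flip: Bochner_Integration.integral_diff Bochner_Integration.integral_add)
  qed
  also have "\<bar>\<dots>\<bar> \<le> D * M * (4 * quad_mass) * wt k s + M * D * (4 * quad_mass) * wt k s"
  proof (rule order_trans[OF abs_triangle_ineq add_mono])
    show "\<bar>conv (\<lambda>l. f l - g l) f k\<bar> \<le> D * M * (4 * quad_mass) * wt k s"
      by (rule conv_bound(2)[OF _ _ d f]) (simp_all add: \<open>s \<ge> 0\<close>)
    show "\<bar>conv g (\<lambda>l. f l - g l) k\<bar> \<le> M * D * (4 * quad_mass) * wt k s"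
      by (rule conv_bound(2)[OF _ _ g d]) (simp_all add: \<open>s \<ge> 0\<close>)
  qed
  finally show ?thesis by (simp add: algebra_simps)
qed

text \<open>Banach's fixed point theorem for the quotient of \<open>a\<close> by the weight, in the
  ball of radius \<open>M\<close> of bounded continuous functions on the plane. The smallness of
  \<open>C S M (4 quad_mass)\<close> is exported because the estimate of the difference quotients
  relies on it again.\<close>

lemma exists_profile:
  assumes "S > 0"
  obtains a :: "real \<Rightarrow> real \<Rightarrow> real" and \<epsilon> M C where
    "C \<ge> 0" "M > 0" "\<epsilon> > 0"
    "\<And>k \<tau>. \<bar>\<tau>\<bar> \<le> S \<Longrightarrow> \<bar>green k \<tau>\<bar> \<le> C * exp (- (\<bar>k\<bar> * \<bar>\<tau>\<bar>))"
    "C * S * (M * (4 * quad_mass)) \<le> 1 / 4"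
    "continuous_on (UNIV \<times> {0..S}) (\<lambda>(k, s). a k s)"
    "\<And>k s. a (- k) s = a k s"
    "\<And>k s. s \<in> {0..S} \<Longrightarrow> \<bar>a k s\<bar> \<le> M * wt k s"
    "\<And>k s. s \<in> {0..S} \<Longrightarrow> a k s = \<epsilon> * (green k s / (1 + k\<^sup>2))
        + duhamel S (\<lambda>k s. conv (\<lambda>k. a k s) (\<lambda>k. a k s) k) k s"
proof -
  obtain C' where C': "\<And>m::nat. C' m \<ge> 0"
    "\<And>m p h x. p \<in> {-S..S} \<Longrightarrow> 0 < h \<Longrightarrow> h \<le> 1 \<Longrightarrow>
       \<bar>(dq h ^^ m) (\<lambda>k. green k p) x\<bar> \<le> C' m * exp (- (\<bar>x\<bar> * \<bar>p\<bar>))"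
    by (rule symbol_boundE[OF symbol_bound_green[of S]]) (use assms in auto)
  define C where "C = C' 0"
  have C0: "C \<ge> 0" using C' by (simp add: C_def)
  have R: "\<bar>green k \<tau>\<bar> \<le> C * exp (- (\<bar>k\<bar> * \<bar>\<tau>\<bar>))" if "\<bar>\<tau>\<bar> \<le> S" for k \<tau>
    using C'(2)[of \<tau> 1 0 k] that by (simp add: C_def abs_le_iff)
  define q where "q = 4 * quad_mass"
  have q: "q \<ge> 0" using quad_mass_nonneg by (simp add: q_def)
  \<comment> \<open>Chosen so that \<open>C S M q \<le> 1 / 4\<close>: the quadratic term then stays
    within half of the radius, and its Lipschitz constant is \<open>2 C S M q \<le> 1 / 2\<close>.
    The summand 1 keeps the denominator positive.\<close>
  define M where "M = 1 / (4 * (C * S * q + 1))"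
  have CSq: "C * S * q \<ge> 0" using C0 q assms by simp
  then have M: "M > 0" by (simp add: M_def)
  have CSM: "C * S * (M * q) \<le> 1 / 4"
    using CSq by (simp add: M_def field_simps)
  \<comment> \<open>The linear term may use up the other half of the radius
    \<open>M\<close>.\<close>
  define \<epsilon> where "\<epsilon> = M / (2 * (C + 1))"
  have \<epsilon>: "\<epsilon> > 0" using M C0 by (simp add: \<epsilon>_def)
  have \<epsilon>C: "\<epsilon> * C \<le> M / 2" using M C0 by (simp add: \<epsilon>_def field_simps)
  \<comment> \<open>Clamping times to \<open>{0..S}\<close> lets bounded continuous functions on the
    whole plane represent functions on the strip.\<close>
  define cl where "cl s = max 0 (min S s)" for s
  have cl: "cl s \<in> {0..S}" "s \<in> {0..S} \<Longrightarrow> cl s = s" for s using assms by (auto simp: cl_def)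
  have ccl: "continuous_on U cl" for U unfolding cl_def by (intro continuous_intros)
  \<comment> \<open>Reading \<open>A\<close> at \<open>\<bar>k\<bar>\<close> makes every candidate
    even in \<open>k\<close>, so evenness of the fixed point comes for free.\<close>
  define \<alpha> where "\<alpha> A k s = wt k (cl s) * apply_bcontfun A (\<bar>k\<bar>, cl s)" for A :: "(real \<times> real) \<Rightarrow>\<^sub>C real" and k s
  have cwt: "continuous_on U (\<lambda>p. wt (fst p) (cl (snd p)))" for U :: "(real \<times> real) set"
    using continuous_on_compose2[OF continuous_on_wt[of UNIV], of U "\<lambda>p. (fst p, cl (snd p))"]
      continuous_on_compose2[OF ccl[of UNIV], of U snd]
    by (auto simp: continuous_intros)
  have c\<alpha>: "continuous_on U (\<lambda>(k, s). \<alpha> A k s)" for A U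
    unfolding \<alpha>_def case_prod_unfold
    by (intro continuous_intros cwt continuous_on_compose2[OF continuous_on_apply_bcontfun[of UNIV A]]
        continuous_on_compose2[OF ccl[of UNIV]]) auto
  have m\<alpha>: "(\<lambda>k. \<alpha> A k s) \<in> borel_measurable borel" for A s
  proof -
    have "continuous_on UNIV (\<lambda>k. \<alpha> A k s)"
      using continuous_on_compose2[OF c\<alpha>[of UNIV A], of UNIV "\<lambda>k. (k, s)"] by (auto simp: continuous_intros)
    then show ?thesis by (rule borel_measurable_continuous_onI)
  qed
  have b\<alpha>: "\<bar>\<alpha> A k s\<bar> \<le> M * wt k s" if "norm A \<le> M" "s \<in> {0..S}" for A k s
    using mult_left_mono[OF order_trans[OF norm_bounded that(1)] less_imp_le[OF wt_pos[of k s]]] wt_pos[of k s]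
    by (simp add: \<alpha>_def cl(2)[OF that(2)] abs_mult mult.commute)
  have d\<alpha>: "\<bar>\<alpha> A k s - \<alpha> B k s\<bar> \<le> dist A B * wt k s" if "s \<in> {0..S}" for A B k s
  proof -
    have "\<bar>apply_bcontfun A (\<bar>k\<bar>, s) - apply_bcontfun B (\<bar>k\<bar>, s)\<bar> \<le> dist A B"
      using dist_bounded[of A "(\<bar>k\<bar>, s)" B] by (simp add: dist_real_def)
    from mult_left_mono[OF this less_imp_le[OF wt_pos[of k s]]] show ?thesis
      using wt_pos[of k s] by (simp add: \<alpha>_def cl(2)[OF that] abs_mult mult.commute flip: right_diff_distrib)
  qed
  define \<beta> where "\<beta> A k s = conv (\<lambda>k. \<alpha> A k s) (\<lambda>k. \<alpha> A k s) k" for A k s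
  have c\<beta>: "continuous_on (UNIV \<times> {0..S}) (\<lambda>(k, s). \<beta> A k s)" if "norm A \<le> M" for A
    unfolding \<beta>_def by (rule continuous_on_conv[where A = M and B = M]) (use c\<alpha> b\<alpha>[OF that] in auto)
  have c\<beta>': "continuous_on {0..S} (\<beta> A k)" if "norm A \<le> M" for A k
    using continuous_on_compose2[OF c\<beta>[OF that], of "{0..S}" "\<lambda>s. (k, s)"] by (auto simp: continuous_intros)
  have b\<beta>: "\<bar>\<beta> A k s\<bar> \<le> M * M * q * wt k s" if "norm A \<le> M" "s \<in> {0..S}" for A k s
    unfolding \<beta>_def q_def by (rule conv_bound(2)) (use m\<alpha> b\<alpha> that in auto)
  define F where "F A p = (\<epsilon> * (green (fst p) (cl (snd p)) / (1 + (fst p)\<^sup>2)) + duhamel S (\<beta> A) (fst p) (cl (snd p)))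
       / wt (fst p) (cl (snd p))" for A p
  have bF: "\<bar>F A p\<bar> \<le> M" if "norm A \<le> M" for A and p :: "real \<times> real"
  proof -
    let ?k = "fst p" and ?s = "cl (snd p)"
    have s: "?s \<in> {0..S}" by (rule cl)
    have "\<bar>green ?k ?s / (1 + ?k\<^sup>2)\<bar> \<le> C * wt ?k ?s"
      using divide_right_mono[OF R[of ?s ?k] less_imp_le[OF one_plus_square_pos[of ?k]]] s one_plus_square_pos[of ?k]
      by (simp add: wt_def abs_divide mult.commute)
    from mult_left_mono[OF this, of \<epsilon>] have "\<bar>\<epsilon> * (green ?k ?s / (1 + ?k\<^sup>2))\<bar> \<le> (\<epsilon> * C) * wt ?k ?s"
      unfolding abs_mult using \<epsilon> by (simp only: abs_of_pos mult.assoc)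
    also have "\<dots> \<le> M / 2 * wt ?k ?s" using \<epsilon>C less_imp_le[OF wt_pos] by (rule mult_right_mono)
    finally have 1: "\<bar>\<epsilon> * (green ?k ?s / (1 + ?k\<^sup>2))\<bar> \<le> M / 2 * wt ?k ?s" .
    have "\<bar>duhamel S (\<beta> A) ?k ?s\<bar> \<le> C * S * (M * M * q) * wt ?k ?s"
      by (rule duhamel_bound[OF R C0 c\<beta>' b\<beta> s]) (use that in auto)
    also have "C * S * (M * M * q) \<le> M / 2"
      using mult_left_mono[OF CSM, of M] M by (simp add: mult_ac)
    then have "C * S * (M * M * q) * wt ?k ?s \<le> M / 2 * wt ?k ?s" by (rule mult_right_mono) (simp add: less_imp_le wt_pos)
    finally have 2: "\<bar>duhamel S (\<beta> A) ?k ?s\<bar> \<le> M / 2 * wt ?k ?s" .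
    have "\<bar>\<epsilon> * (green ?k ?s / (1 + ?k\<^sup>2)) + duhamel S (\<beta> A) ?k ?s\<bar> \<le> M * wt ?k ?s"
      using abs_triangle_ineq[THEN order_trans, OF add_mono[OF 1 2]] by (simp flip: distrib_right)
    then show ?thesis
      unfolding F_def abs_divide using wt_pos[of ?k ?s] by (simp add: pos_divide_le_eq)
  qed
  have cF: "continuous_on UNIV (F A)" if "norm A \<le> M" for A
  proof -
    have cp: "continuous_on UNIV (\<lambda>p::real \<times> real. (fst p, cl (snd p)))"
      by (intro continuous_intros continuous_on_compose2[OF ccl[of UNIV]]) auto
    have 1: "continuous_on UNIV (\<lambda>p. green (fst p) (cl (snd p)))"
      using continuous_on_compose2[OF continuous_on_green[of UNIV] cp] by simp
    have 2: "continuous_on UNIV (\<lambda>p. duhamel S (\<beta> A) (fst p) (cl (snd p)))"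
      using continuous_on_compose2[OF continuous_on_duhamel[OF c\<beta>[OF that]] cp] by simp
    have "1 + (fst p)\<^sup>2 \<noteq> (0::real)" "wt (fst p) (cl (snd p)) \<noteq> 0" for p :: "real \<times> real"
      using one_plus_square_pos[of "fst p"] wt_pos[of "fst p" "cl (snd p)"] by auto
    then show ?thesis
      unfolding F_def by (intro continuous_intros 1 2 cwt) auto
  qed
  have appF: "apply_bcontfun (Bcontfun (F A)) = F A" if "norm A \<le> M" for A
    by (rule Bcontfun_inverse) (rule bcontfun_normI[OF cF[OF that], of M], use bF[OF that] in simp)
  have "\<exists>!A\<in>cball 0 M. Bcontfun (F A) = A"
  proof (rule Banach_fix)
    show "complete (cball (0::(real \<times> real) \<Rightarrow>\<^sub>C real) M)" by (simp add: complete_eq_closed)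
    show "cball (0::(real \<times> real) \<Rightarrow>\<^sub>C real) M \<noteq> {}" using M by simp
    show "(\<lambda>A. Bcontfun (F A)) ` cball 0 M \<subseteq> cball 0 M"
    proof clarsimp
      fix A :: "(real \<times> real) \<Rightarrow>\<^sub>C real" assume A: "norm A \<le> M"
      show "norm (Bcontfun (F A)) \<le> M"
        by (rule norm_bound) (simp add: appF[OF A] bF[OF A])
    qed
    show "(0::real) \<le> 1 / 2" "(1 / 2::real) < 1" by auto
    fix A B :: "(real \<times> real) \<Rightarrow>\<^sub>C real" assume "A \<in> cball 0 M" "B \<in> cball 0 M"
    then have A: "norm A \<le> M" and B: "norm B \<le> M" by auto
    show "dist (Bcontfun (F A)) (Bcontfun (F B)) \<le> 1 / 2 * dist A B"
    proof (rule dist_bound)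
      fix p :: "real \<times> real"
      let ?k = "fst p" and ?s = "cl (snd p)"
      have s: "?s \<in> {0..S}" by (rule cl)
      have "F A p - F B p = (duhamel S (\<beta> A) ?k ?s - duhamel S (\<beta> B) ?k ?s) / wt ?k ?s"
        by (simp add: F_def diff_divide_distrib [symmetric])
      also have "\<dots> = duhamel S (\<lambda>k s. \<beta> A k s - \<beta> B k s) ?k ?s / wt ?k ?s"
        by (subst duhamel_diff) (use c\<beta>' A B in auto)
      finally have eq: "F A p - F B p = duhamel S (\<lambda>k s. \<beta> A k s - \<beta> B k s) ?k ?s / wt ?k ?s" .
      have "\<bar>duhamel S (\<lambda>k s. \<beta> A k s - \<beta> B k s) ?k ?s\<bar> \<le> C * S * (2 * dist A B * M * q) * wt ?k ?s"
      proof (rule duhamel_bound[OF R C0 _ _ s])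
        show "continuous_on {0..S} (\<lambda>r. \<beta> A ?k r - \<beta> B ?k r)"
          by (intro continuous_intros c\<beta>' A B)
        show "\<bar>\<beta> A ?k r - \<beta> B ?k r\<bar> \<le> 2 * dist A B * M * q * wt ?k r" if "r \<in> {0..S}" for r
          unfolding \<beta>_def q_def
          by (rule conv_square_diff) (use m\<alpha> b\<alpha>[OF A that] b\<alpha>[OF B that] d\<alpha>[OF that] that in auto)
      qed auto
      also have "C * S * (2 * dist A B * M * q) = 2 * dist A B * (C * S * (M * q))" by simp
      also have "\<dots> * wt ?k ?s \<le> 2 * dist A B * (1 / 4) * wt ?k ?s"
        by (intro mult_right_mono mult_left_mono CSM) (auto simp: less_imp_le wt_pos)
      finally have "\<bar>F A p - F B p\<bar> \<le> 1 / 2 * dist A B"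
        unfolding eq abs_divide using wt_pos[of ?k ?s] by (simp add: pos_divide_le_eq)
      then show "dist (apply_bcontfun (Bcontfun (F A)) p) (apply_bcontfun (Bcontfun (F B)) p) \<le> 1 / 2 * dist A B"
        by (simp add: appF A B dist_real_def)
    qed
  qed
  then obtain A where A: "norm A \<le> M" "Bcontfun (F A) = A" by auto
  have ev: "\<alpha> A (- k) s = \<alpha> A k s" for k s by (simp add: \<alpha>_def)
  show ?thesis
  proof (rule that[of C M \<epsilon> "\<alpha> A"])
    fix k s assume s: "s \<in> {0..S}"
    have ev\<beta>: "\<beta> A (- k) r = \<beta> A k r" for k r
      unfolding \<beta>_def by (rule conv_minus_even) (rule ev)+
    have "\<alpha> A k s = wt k s * F A (\<bar>k\<bar>, s)"
      using appF[OF A(1)] by (simp add: \<alpha>_def cl(2)[OF s] A(2))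
    also have "\<dots> = \<epsilon> * (green \<bar>k\<bar> s / (1 + k\<^sup>2)) + duhamel S (\<beta> A) \<bar>k\<bar> s"
    proof -
      have "wt \<bar>k\<bar> s = wt k s" by (simp add: wt_def)
      then show ?thesis using wt_pos[of k s] by (simp add: F_def cl(2)[OF s])
    qed
    \<comment> \<open>The equation has been obtained at \<open>\<bar>k\<bar>\<close>; evenness of
      \<open>green\<close> and of the convolution carries it to \<open>k\<close>.\<close>
    also have "\<dots> = \<epsilon> * (green k s / (1 + k\<^sup>2)) + duhamel S (\<beta> A) k s"
      by (cases "k \<ge> 0") (simp_all add: duhamel_def ev\<beta>)
    finally show "\<alpha> A k s = \<epsilon> * (green k s / (1 + k\<^sup>2))
        + duhamel S (\<lambda>k s. conv (\<lambda>k. \<alpha> A k s) (\<lambda>k. \<alpha> A k s) k) k s"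
      by (simp add: \<beta>_def [abs_def])
  qed (use C0 M \<epsilon> R CSM[unfolded q_def] c\<alpha> ev b\<alpha>[OF A(1)] in auto)
qed

section \<open>Difference quotients of the fixed point\<close>

lemma wt_shift:
  assumes "\<bar>y - x\<bar> \<le> 1" "0 \<le> s" "s \<le> S"
  shows "wt y s \<le> 4 * exp S * wt x s"
proof -
  have "s * \<bar>x\<bar> \<le> s * (\<bar>y\<bar> + 1)" using assms by (intro mult_left_mono) auto
  then have "exp (- (s * \<bar>y\<bar>)) \<le> exp S * exp (- (s * \<bar>x\<bar>))"
    using assms by (simp add: algebra_simps flip: exp_add)
  from mult_mono[OF this inverse_quadratic_shift[OF assms(1)]] show ?thesis
    using one_plus_square_pos[of y] by (simp add: wt_def mult_ac)
qed

text \<open>The constant deteriorates as \<open>h\<close> tends to 0. Its role is to give the later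
  absorption argument a finite quantity to start from.\<close>

lemma dq_pow_crude:
  assumes f: "\<And>s k. s \<in> {0..S} \<Longrightarrow> \<bar>f s k\<bar> \<le> M * wt k s" and "h > 0" "h \<le> 1" "M \<ge> 0"
  shows "\<exists>K\<ge>0. \<forall>s\<in>{0..S}. \<forall>k. \<bar>(dq h ^^ m) (f s) k\<bar> \<le> K * wt k s"
proof (induction m)
  case 0
  then show ?case using f \<open>M \<ge> 0\<close> by auto
next
  case (Suc m)
  then obtain K where K: "K \<ge> 0" "\<And>s k. s \<in> {0..S} \<Longrightarrow> \<bar>(dq h ^^ m) (f s) k\<bar> \<le> K * wt k s" by blast
  let ?K = "(K * (4 * exp S) + K) / h"
  have "\<bar>(dq h ^^ Suc m) (f s) k\<bar> \<le> ?K * wt k s" if s: "s \<in> {0..S}" for s k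
  proof -
    have "\<bar>(dq h ^^ m) (f s) (k + h)\<bar> \<le> K * (4 * exp S * wt k s)"
      using mult_left_mono[OF wt_shift[of "k + h" k s S] K(1)] K(2)[OF s, of "k + h"] assms s by auto
    then have "\<bar>(dq h ^^ m) (f s) (k + h) - (dq h ^^ m) (f s) k\<bar> \<le> (K * (4 * exp S) + K) * wt k s"
      using K(2)[OF s, of k] by (simp add: algebra_simps)
    then show ?thesis
      using \<open>h > 0\<close> by (simp add: dq_def [of h "(dq h ^^ m) (f s)"] abs_mult inverse_eq_divide divide_right_mono)
  qed
  moreover have "?K \<ge> 0" using K(1) \<open>h > 0\<close> by (intro divide_nonneg_pos add_nonneg_nonneg mult_nonneg_nonneg) auto
  ultimately show ?case by blast
qed

lemma dq_pow_measurable: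
  "f \<in> borel_measurable borel \<Longrightarrow> (dq h ^^ m) (f::real \<Rightarrow> real) \<in> borel_measurable borel"
  by (induction m) (simp_all add: dq_def)

text \<open>Convolution commutes with translations, so all quotients may be put on the first factor
  while the second keeps its bound \<open>M\<close>. The crude bound supplies the integrability that
  lets the integrals be subtracted.\<close>

lemma dq_pow_conv:
  assumes f [measurable]: "f \<in> borel_measurable borel" and g [measurable]: "g \<in> borel_measurable borel"
    and bf: "\<And>l. \<bar>f l\<bar> \<le> M * wt l s" and bg: "\<And>l. \<bar>g l\<bar> \<le> M * wt l s" and s: "s \<ge> 0"
    and h: "0 < h" "h \<le> 1"
  shows "(dq h ^^ m) (conv f g) = conv ((dq h ^^ m) f) g"
proof (induction m)
  case (Suc m)
  have M: "M \<ge> 0" using bf[of 0] wt_pos[of 0 s]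
    by (metis abs_ge_zero dual_order.trans not_less zero_le_mult_iff)
  obtain K where K: "\<And>k. \<bar>(dq h ^^ m) f k\<bar> \<le> K * wt k s"
  proof -
    \<comment> \<open>The crude bound is about families in time; the single function
      \<open>f\<close> is extended by 0 to the other times.\<close>
    obtain K where K: "\<forall>s'\<in>{0..s}. \<forall>k. \<bar>(dq h ^^ m) (if s' = s then f else (\<lambda>_. 0)) k\<bar> \<le> K * wt k s'"
    proof -
      have "\<bar>(if s' = s then f else (\<lambda>_. 0)) k\<bar> \<le> M * wt k s'" for s' k
        using bf[of k] M less_imp_le[OF wt_pos[of k s']] by simp
      from dq_pow_crude[where S = s and f = "\<lambda>s'. if s' = s then f else (\<lambda>_. 0)" and m = m, OF this h M]
      show ?thesis using that by blast
    qed
    show ?thesis using that[of K] bspec[OF K, of s] s by simp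
  qed
  have m [measurable]: "(dq h ^^ m) f \<in> borel_measurable borel" by (rule dq_pow_measurable) fact
  have int: "integrable lborel (\<lambda>l. (dq h ^^ m) f (k - l) * g l)" for k
    by (rule conv_bound(1)[OF _ _ K bg s]) auto
  show ?case
  proof
    fix k
    have "(dq h ^^ Suc m) (conv f g) k = (conv ((dq h ^^ m) f) g (k + h) - conv ((dq h ^^ m) f) g k) /\<^sub>R h"
      by (simp only: dq_pow_Suc Suc)
    also have "\<dots> = (LINT l|lborel. ((dq h ^^ m) f (k + h - l) * g l - (dq h ^^ m) f (k - l) * g l) /\<^sub>R h)"
      unfolding conv_def by (simp add: Bochner_Integration.integral_diff[OF int int] del: Bochner_Integration.integral_diff)
    also have "\<dots> = conv ((dq h ^^ Suc m) f) g k"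
      unfolding conv_def by (intro Bochner_Integration.integral_cong) (simp_all add: dq_def algebra_simps)
    finally show "(dq h ^^ Suc m) (conv f g) k = conv ((dq h ^^ Suc m) f) g k" .
  qed
qed simp

lemma dq_pow_integral:
  fixes F :: "real \<Rightarrow> real \<Rightarrow> real"
  assumes "\<And>k. continuous_on {0..S} (\<lambda>r. F k r)"
  shows "continuous_on {0..S} (\<lambda>r. (dq h ^^ m) (\<lambda>k. F k r) k)"
    and "(dq h ^^ m) (\<lambda>k. integral {0..S} (F k)) k = integral {0..S} (\<lambda>r. (dq h ^^ m) (\<lambda>k. F k r) k)"
proof (induction m arbitrary: k)
  case (Suc m)
  {
    case 1
    show ?case unfolding dq_pow_Suc by (intro continuous_on_scaleR continuous_on_const continuous_on_diff Suc(1))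
  next
    case 2
    have "(dq h ^^ Suc m) (\<lambda>k. integral {0..S} (F k)) k =
      (integral {0..S} (\<lambda>r. (dq h ^^ m) (\<lambda>k. F k r) (k + h)) - integral {0..S} (\<lambda>r. (dq h ^^ m) (\<lambda>k. F k r) k)) /\<^sub>R h"
      by (simp only: dq_pow_Suc Suc(2))
    also have "\<dots> = integral {0..S} (\<lambda>r. ((dq h ^^ m) (\<lambda>k. F k r) (k + h) - (dq h ^^ m) (\<lambda>k. F k r) k) /\<^sub>R h)"
      by (subst Henstock_Kurzweil_Integration.integral_diff [symmetric])
         (intro integrable_continuous_real Suc(1), intro integrable_continuous_real Suc(1), simp add: Henstock_Kurzweil_Integration.integral_cmul)
    finally show ?case unfolding dq_pow_Suc .
  }
qed (use assms in auto)

text \<open>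
  Since \<open>dq h ^^ m\<close> commutes with convolution in one factor only, the coefficient of the top-order
  term in the equation for \<open>(dq h ^^ m) a\<close> is the small constant \<open>C S M (4 quad_mass)\<close>, independently
  of \<open>m\<close>, and can be absorbed.
\<close>

lemma symbol_bound_profile:
  fixes a :: "real \<Rightarrow> real \<Rightarrow> real"
  assumes S: "S > 0" and C: "C \<ge> 0" and M: "M > 0" and \<epsilon>: "\<epsilon> > 0"
    and R: "\<And>k \<tau>. \<bar>\<tau>\<bar> \<le> S \<Longrightarrow> \<bar>green k \<tau>\<bar> \<le> C * exp (- (\<bar>k\<bar> * \<bar>\<tau>\<bar>))"
    and CSM: "C * S * (M * (4 * quad_mass)) \<le> 1 / 4"
    and ca: "continuous_on (UNIV \<times> {0..S}) (\<lambda>(k, s). a k s)"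
    and ba: "\<And>k s. s \<in> {0..S} \<Longrightarrow> \<bar>a k s\<bar> \<le> M * wt k s"
    and eq: "\<And>k s. s \<in> {0..S} \<Longrightarrow> a k s = \<epsilon> * (green k s / (1 + k\<^sup>2))
        + duhamel S (\<lambda>k s. conv (\<lambda>k. a k s) (\<lambda>k. a k s) k) k s"
  shows "symbol_bound {0..S} (\<lambda>s k. wt k s) (\<lambda>s k. a k s)"
    and "symbol_bound {0..S} (\<lambda>s k. wt k s) (\<lambda>s k. conv (\<lambda>k. a k s) (\<lambda>k. a k s) k)"
proof -
  define q where "q = 4 * quad_mass"
  have q: "q \<ge> 0" using quad_mass_nonneg by (simp add: q_def)
  define b where "b s = conv (\<lambda>k. a k s) (\<lambda>k. a k s)" for s
  have ma: "(\<lambda>k. a k s) \<in> borel_measurable borel" if "s \<in> {0..S}" for s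
  proof -
    have "continuous_on UNIV (\<lambda>k. a k s)"
      using continuous_on_compose2[OF ca, of UNIV "\<lambda>k. (k, s)"] that
      by (auto simp: continuous_intros image_subset_iff)
    then show ?thesis by (rule borel_measurable_continuous_onI)
  qed
  have cb: "continuous_on (UNIV \<times> {0..S}) (\<lambda>(k, s). b s k)"
    unfolding b_def by (rule continuous_on_conv[where A = M and B = M]) (use ca ba in auto)
  have cb': "continuous_on {0..S} (\<lambda>s. b s k)" for k
    using continuous_on_compose2[OF cb, of "{0..S}" "\<lambda>s. (k, s)"] by (auto simp: continuous_intros)
  have dqb: "(dq h ^^ m) (b s) = conv ((dq h ^^ m) (\<lambda>k. a k s)) (\<lambda>k. a k s)"
    if "s \<in> {0..S}" "0 < h" "h \<le> 1" for h s m
    unfolding b_def by (rule dq_pow_conv) (use ma ba that in auto)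
  have bdqb: "\<bar>(dq h ^^ m) (b s) k\<bar> \<le> N * M * q * wt k s"
    if "s \<in> {0..S}" "0 < h" "h \<le> 1" "\<And>k. \<bar>(dq h ^^ m) (\<lambda>k. a k s) k\<bar> \<le> N * wt k s" for h s m N k
    unfolding dqb[OF that(1-3)] q_def
    by (rule conv_bound(2)) (use ma ba that dq_pow_measurable in auto)
  obtain F where F: "\<And>m::nat. F m \<ge> 0"
    "\<And>m p h x. p \<in> {-S..S} \<Longrightarrow> 0 < h \<Longrightarrow> h \<le> 1 \<Longrightarrow>
       \<bar>(dq h ^^ m) (\<lambda>k. green k p) x\<bar> \<le> F m * exp (- (\<bar>x\<bar> * \<bar>p\<bar>))"
    by (rule symbol_boundE[OF symbol_bound_green[of S]]) (use S in auto)
  have uH: "symbol_bound {-S..S} (\<lambda>\<tau> k. exp (- (\<bar>k\<bar> * \<bar>\<tau>\<bar>)) * (1 / (1 + k\<^sup>2))) (\<lambda>\<tau> k. green k \<tau> * (1 / (1 + k\<^sup>2)))"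
    by (rule symbol_bound_mult[OF symbol_bound_green symbol_bound_inverse_quadratic, where K = 4])
       (use S inverse_quadratic_shift one_plus_square_pos in \<open>auto simp: less_imp_le\<close>)
  obtain H where H: "\<And>m::nat. H m \<ge> 0"
    "\<And>m p h x. p \<in> {-S..S} \<Longrightarrow> 0 < h \<Longrightarrow> h \<le> 1 \<Longrightarrow>
       \<bar>(dq h ^^ m) (\<lambda>k. green k p * (1 / (1 + k\<^sup>2))) x\<bar> \<le> H m * (exp (- (\<bar>x\<bar> * \<bar>p\<bar>)) * (1 / (1 + x\<^sup>2)))"
    by (rule symbol_boundE[OF uH]) (use one_plus_square_pos in \<open>auto simp: less_imp_le\<close>)
  have "\<exists>D\<ge>0. \<forall>s\<in>{0..S}. \<forall>h\<in>{0<..1}. \<forall>k. \<bar>(dq h ^^ m) (\<lambda>k. a k s) k\<bar> \<le> D * wt k s" for m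
  proof (induction m rule: less_induct)
    case (less m)
    define P where "P i D \<longleftrightarrow> D \<ge> 0 \<and> (\<forall>s\<in>{0..S}. \<forall>h\<in>{0<..1}. \<forall>k. \<bar>(dq h ^^ i) (\<lambda>k. a k s) k\<bar> \<le> D * wt k s)"
      for i D
    have "\<forall>i. \<exists>D\<ge>0. i < m \<longrightarrow> P i D"
    proof
      fix i
      show "\<exists>D\<ge>0. i < m \<longrightarrow> P i D"
        using less[of i] unfolding P_def by (cases "i < m") auto
    qed
    then obtain D where "\<forall>i. D i \<ge> 0 \<and> (i < m \<longrightarrow> P i (D i))"
      using choice[of "\<lambda>i D. D \<ge> 0 \<and> (i < m \<longrightarrow> P i D)"] by blast
    then have D: "\<And>i. D i \<ge> 0" "\<And>i s h k. i < m \<Longrightarrow> s \<in> {0..S} \<Longrightarrow> 0 < h \<Longrightarrow> h \<le> 1 \<Longrightarrow>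
        \<bar>(dq h ^^ i) (\<lambda>k. a k s) k\<bar> \<le> D i * wt k s"
      by (simp_all add: P_def)
    define L where "L = 4 * exp S"
    have L: "L \<ge> 0" by (simp add: L_def)
    \<comment> \<open>Collects the Leibniz terms with \<open>j \<ge> 1\<close>; they contain only
      quotients of \<open>a\<close> of order below \<open>m\<close>, which the induction hypothesis
      controls.\<close>
    define E where "E = (\<Sum>j\<in>{1..m}. of_nat (m choose j) * (F j * (D (m - j) * M * q * L ^ j)))"
    have E: "E \<ge> 0" unfolding E_def
      by (intro sum_nonneg mult_nonneg_nonneg F D q zero_le_power L) (use M in auto)
    define E' where "E' = \<epsilon> * H m + S * E"
    have E': "E' \<ge> 0" unfolding E'_def using \<epsilon> H S E by simp
    \<comment> \<open>A bound \<open>N\<close> at order \<open>m\<close> improves to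
      \<open>E' + N / 4\<close>. Only the Leibniz term with all quotients on \<open>b\<close>
      involves \<open>N\<close>, and time integration gives it the factor
      \<open>C S M q \<le> 1 / 4\<close>.\<close>
    have step: "\<bar>(dq h ^^ m) (\<lambda>k. a k s) k\<bar> \<le> (E' + N / 4) * wt k s"
      if h: "0 < h" "h \<le> 1" and s: "s \<in> {0..S}" and N: "N \<ge> 0"
        "\<And>s k. s \<in> {0..S} \<Longrightarrow> \<bar>(dq h ^^ m) (\<lambda>k. a k s) k\<bar> \<le> N * wt k s" for h s N k
    proof -
      have "(\<lambda>k. a k s) = (\<lambda>k. \<epsilon> * (green k s * (1 / (1 + k\<^sup>2))) + integral {0..S} (\<lambda>r. green k (s - r) * b r k))"
        using eq[OF s] by (simp add: duhamel_def b_def)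
      then have "(dq h ^^ m) (\<lambda>k. a k s) k = (dq h ^^ m) (\<lambda>k. \<epsilon> * (green k s * (1 / (1 + k\<^sup>2)))) k
         + (dq h ^^ m) (\<lambda>k. integral {0..S} (\<lambda>r. green k (s - r) * b r k)) k"
        by (simp only: dq_pow_add)
      also have "(dq h ^^ m) (\<lambda>k. \<epsilon> * (green k s * (1 / (1 + k\<^sup>2)))) k = \<epsilon> * (dq h ^^ m) (\<lambda>k. green k s * (1 / (1 + k\<^sup>2))) k"
        using dq_pow_linear[OF bounded_linear_mult_right[of \<epsilon>], where h = h and m = m and f = "\<lambda>k. green k s * (1 / (1 + k\<^sup>2))"]
        by simp
      also have "(dq h ^^ m) (\<lambda>k. integral {0..S} (\<lambda>r. green k (s - r) * b r k)) k =
          integral {0..S} (\<lambda>r. (dq h ^^ m) (\<lambda>k. green k (s - r) * b r k) k)"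
        by (rule dq_pow_integral(2)) (rule continuous_on_green_mult[OF cb'])
      finally have eq': "(dq h ^^ m) (\<lambda>k. a k s) k = \<epsilon> * (dq h ^^ m) (\<lambda>k. green k s * (1 / (1 + k\<^sup>2))) k
         + integral {0..S} (\<lambda>r. (dq h ^^ m) (\<lambda>k. green k (s - r) * b r k) k)" .
      have "\<bar>(dq h ^^ m) (\<lambda>k. green k s * (1 / (1 + k\<^sup>2))) k\<bar> \<le> H m * wt k s"
        using H(2)[of s h m k] h s by (simp add: wt_def mult.commute)
      from mult_left_mono[OF this, of \<epsilon>]
      have 1: "\<bar>\<epsilon> * (dq h ^^ m) (\<lambda>k. green k s * (1 / (1 + k\<^sup>2))) k\<bar> \<le> \<epsilon> * H m * wt k s"
        using \<epsilon> by (simp only: abs_mult abs_of_pos mult.assoc)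
      have in_int: "\<bar>(dq h ^^ m) (\<lambda>k. green k (s - r) * b r k) k\<bar> \<le> (C * (N * M * q) + E) * wt k s"
        if r: "r \<in> {0..S}" for r
      proof -
        let ?t = "\<lambda>j. of_nat (m choose j) * ((dq h ^^ j) (\<lambda>k. green k (s - r)) k * (dq h ^^ (m - j)) (b r) (k + of_nat j * h))"
        have sr: "s - r \<in> {-S..S}" using s r by auto
        have wk: "exp (- (\<bar>k\<bar> * \<bar>s - r\<bar>)) * wt k r \<le> wt k s"
          by (rule wt_kernel) (use r in auto)
        have t0: "\<bar>?t 0\<bar> \<le> C * (N * M * q) * wt k s"
        proof -
          have "\<bar>?t 0\<bar> \<le> (C * exp (- (\<bar>k\<bar> * \<bar>s - r\<bar>))) * (N * M * q * wt k r)"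
          proof -
            have "\<bar>s - r\<bar> \<le> S" using sr by auto
            from mult_mono[OF R[OF this, of k] bdqb[OF r h N(2)[OF r], of k]] show ?thesis
              using C by (simp add: abs_mult)
          qed
          also have "\<dots> = C * (N * M * q) * (exp (- (\<bar>k\<bar> * \<bar>s - r\<bar>)) * wt k r)" by simp
          also have "\<dots> \<le> C * (N * M * q) * wt k s"
            using C N(1) M q by (intro mult_left_mono wk mult_nonneg_nonneg) auto
          finally show ?thesis .
        qed
        have tj: "\<bar>?t j\<bar> \<le> of_nat (m choose j) * (F j * (D (m - j) * M * q * L ^ j)) * wt k s" if j: "j \<in> {1..m}" for j
        proof -
          have "\<bar>(dq h ^^ (m - j)) (b r) (k + of_nat j * h)\<bar> \<le> D (m - j) * M * q * wt (k + of_nat j * h) r"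
            by (rule bdqb[OF r h]) (use D(2)[of "m - j" r h] r h j in auto)
          also have "\<dots> \<le> D (m - j) * M * q * (L ^ j * wt k r)"
          proof (intro mult_left_mono shift_iterate)
            show "wt y r \<le> L * wt x r" if "\<bar>y - x\<bar> \<le> 1" for x y
              unfolding L_def by (rule wt_shift) (use that r in auto)
          qed (use h L D M q in auto)
          finally have 2: "\<bar>(dq h ^^ (m - j)) (b r) (k + of_nat j * h)\<bar> \<le> D (m - j) * M * q * (L ^ j * wt k r)" .
          have "\<bar>?t j\<bar> \<le> of_nat (m choose j) * ((F j * exp (- (\<bar>k\<bar> * \<bar>s - r\<bar>))) * (D (m - j) * M * q * (L ^ j * wt k r)))"
            unfolding abs_mult[of "of_nat _"] abs_mult[of "(dq h ^^ j) _ _"]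
            using F(2)[OF sr h, of j k] F(1)[of j] 2 by (intro mult_mono mult_nonneg_nonneg) auto
          also have "\<dots> = of_nat (m choose j) * (F j * (D (m - j) * M * q * L ^ j)) * (exp (- (\<bar>k\<bar> * \<bar>s - r\<bar>)) * wt k r)"
            by simp
          also have "\<dots> \<le> of_nat (m choose j) * (F j * (D (m - j) * M * q * L ^ j)) * wt k s"
            using F D M q L by (intro mult_left_mono wk mult_nonneg_nonneg) auto
          finally show ?thesis .
        qed
        have "(dq h ^^ m) (\<lambda>k. green k (s - r) * b r k) k = (\<Sum>j\<le>m. ?t j)"
          by (rule dq_pow_mult)
        also have "\<dots> = ?t 0 + (\<Sum>j\<in>{1..m}. ?t j)"
        proof -
          have "{..m} = insert 0 {1..m}" by auto
          then show ?thesis by (simp only:) (subst sum.insert, auto)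
        qed
        finally have sum_eq: "(dq h ^^ m) (\<lambda>k. green k (s - r) * b r k) k = ?t 0 + (\<Sum>j\<in>{1..m}. ?t j)" .
        have "\<bar>?t 0 + (\<Sum>j\<in>{1..m}. ?t j)\<bar> \<le> C * (N * M * q) * wt k s + (\<Sum>j\<in>{1..m}. of_nat (m choose j) * (F j * (D (m - j) * M * q * L ^ j)) * wt k s)"
          by (rule order_trans[OF abs_triangle_ineq add_mono[OF t0 order_trans[OF sum_abs sum_mono[OF tj]]]])
        also have "\<dots> = (C * (N * M * q) + E) * wt k s"
          by (simp only: E_def distrib_right sum_distrib_right)
        finally show ?thesis by (simp only: sum_eq)
      qed
      have "norm (integral {0..S} (\<lambda>r. (dq h ^^ m) (\<lambda>k. green k (s - r) * b r k) k)) \<le> (C * (N * M * q) + E) * wt k s * (S - 0)"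
        by (rule integral_bound) (use S in_int dq_pow_integral(1)[OF continuous_on_green_mult[OF cb']] in auto)
      also have "\<dots> = (N * (C * S * (M * q)) + S * E) * wt k s" by (simp add: algebra_simps)
      also have "\<dots> \<le> (N * (1 / 4) + S * E) * wt k s"
        using N(1) CSM wt_pos[of k s] by (intro mult_right_mono add_right_mono mult_left_mono) (auto simp: q_def)
      finally have 2: "\<bar>integral {0..S} (\<lambda>r. (dq h ^^ m) (\<lambda>k. green k (s - r) * b r k) k)\<bar> \<le> (N * (1 / 4) + S * E) * wt k s"
        by simp
      show ?thesis
        unfolding eq' using order_trans[OF abs_triangle_ineq add_mono[OF 1 2]]
        by (simp add: E'_def algebra_simps)
    qed
    have "\<bar>(dq h ^^ m) (\<lambda>k. a k s) k\<bar> \<le> (4 / 3 * E') * wt k s"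
      if h: "0 < h" "h \<le> 1" and s: "s \<in> {0..S}" for h s k
    proof -
      obtain K where K: "K \<ge> 0" "\<forall>s\<in>{0..S}. \<forall>k. \<bar>(dq h ^^ m) (\<lambda>k. a k s) k\<bar> \<le> K * wt k s"
        using dq_pow_crude[of S "\<lambda>s k. a k s" M h m] ba h M by auto
      \<comment> \<open>Iterating the improvement from the crude \<open>K\<close> leads to
        \<open>4 / 3 E'\<close>, the solution of \<open>N = E' + N / 4\<close>. The dependence on
        \<open>h\<close>, which enters through \<open>K\<close>, disappears in the limit.\<close>
      have "\<forall>s\<in>{0..S}. \<forall>k. \<bar>(dq h ^^ m) (\<lambda>k. a k s) k\<bar> \<le> (4 / 3 * E' + K / 4 ^ n) * wt k s" for n
      proof (induction n)
        case 0
        show ?case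
        proof (intro ballI allI)
          fix s k assume "s \<in> {0..S}"
          then have "\<bar>(dq h ^^ m) (\<lambda>k. a k s) k\<bar> \<le> K * wt k s" using K(2) by blast
          also have "\<dots> \<le> (4 / 3 * E' + K / 4 ^ 0) * wt k s"
            using E' by (intro mult_right_mono) (auto simp: less_imp_le wt_pos)
          finally show "\<bar>(dq h ^^ m) (\<lambda>k. a k s) k\<bar> \<le> (4 / 3 * E' + K / 4 ^ 0) * wt k s" .
        qed
      next
        case (Suc n)
        show ?case
        proof (intro ballI allI)
          fix s k assume s: "s \<in> {0..S}"
          have "\<bar>(dq h ^^ m) (\<lambda>k. a k s) k\<bar> \<le> (E' + (4 / 3 * E' + K / 4 ^ n) / 4) * wt k s"
            by (rule step[OF h s]) (use Suc E' K in auto)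
          then show "\<bar>(dq h ^^ m) (\<lambda>k. a k s) k\<bar> \<le> (4 / 3 * E' + K / 4 ^ Suc n) * wt k s"
            by (simp add: field_simps)
        qed
      qed
      then have le: "\<bar>(dq h ^^ m) (\<lambda>k. a k s) k\<bar> \<le> (4 / 3 * E' + K * (1 / 4) ^ n) * wt k s" for n
        using s by (simp add: power_one_over)
      have "(\<lambda>n. (4 / 3 * E' + K * (1 / 4) ^ n) * wt k s) \<longlonglongrightarrow> (4 / 3 * E' + K * 0) * wt k s"
        by (intro tendsto_intros LIMSEQ_power_zero) auto
      then show ?thesis using le by (intro LIMSEQ_le_const) auto
    qed
    then show ?case using E' by (intro exI[of _ "4 / 3 * E'"]) auto
  qed
  then have "\<forall>m. \<exists>D. \<forall>s\<in>{0..S}. \<forall>h\<in>{0<..1}. \<forall>k. \<bar>(dq h ^^ m) (\<lambda>k. a k s) k\<bar> \<le> D * wt k s"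
    by blast
  from choice[OF this] obtain D where
    "\<forall>m. \<forall>s\<in>{0..S}. \<forall>h\<in>{0<..1}. \<forall>k. \<bar>(dq h ^^ m) (\<lambda>k. a k s) k\<bar> \<le> D m * wt k s" by blast
  then have D: "\<bar>(dq h ^^ m) (\<lambda>k. a k s) k\<bar> \<le> D m * wt k s" if "s \<in> {0..S}" "0 < h" "h \<le> 1" for m s h k
    using that by simp
  show "symbol_bound {0..S} (\<lambda>s k. wt k s) (\<lambda>s k. a k s)"
    unfolding symbol_bound_def
  proof
    fix m
    show "\<exists>C. \<forall>s\<in>{0..S}. \<forall>h\<in>{0<..1}. \<forall>k. \<bar>(dq h ^^ m) (\<lambda>k. a k s) k\<bar> \<le> C * wt k s"
      by (rule exI[of _ "D m"]) (use D in auto)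
  qed
  show "symbol_bound {0..S} (\<lambda>s k. wt k s) (\<lambda>s k. conv (\<lambda>k. a k s) (\<lambda>k. a k s) k)"
    unfolding symbol_bound_def
  proof (intro allI exI ballI)
    fix m s k and h :: real assume "s \<in> {0..S}" "h \<in> {0<..1}"
    then show "\<bar>(dq h ^^ m) (conv (\<lambda>k. a k s) (\<lambda>k. a k s)) k\<bar> \<le> (D m * M * q) * wt k s"
      using bdqb[of s h m "D m" k] D[of s h m] by (auto simp: b_def)
  qed
qed

section \<open>Cosine transforms\<close>

text \<open>The addition formulas separate \<open>s\<close> from \<open>r\<close>, and the modulus
  splits the integral at \<open>r = s\<close>; what remains are \<open>p\<close> and
  \<open>q\<close> at \<open>s\<close> and at \<open>S\<close>. On differentiating, the boundary
  terms cancel in \<open>P1\<close>, and in the second derivative they combine to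
  \<open>(Ch W s)\<^sup>2 - W (Sh W s)\<^sup>2 = 1\<close>.\<close>

lemma duhamel_ode:
  assumes g: "continuous_on {0..S} (g k)" and "S > 0"
  obtains P1 where "\<And>s. s \<in> {0<..<S} \<Longrightarrow> (duhamel S g k has_real_derivative P1 s) (at s)"
    "\<And>s. s \<in> {0<..<S} \<Longrightarrow> (P1 has_real_derivative (k ^ 4 - k\<^sup>2) * duhamel S g k s - k\<^sup>2 * g k s) (at s)"
proof -
  define W where "W = k ^ 4 - k\<^sup>2"
  define c where "c = rgint W / (2 * hgauss_lim)"
  define p where "p s = integral {0..s} (\<lambda>r. Ch W r * g k r)" for s
  define q where "q s = integral {0..s} (\<lambda>r. Sh W r * g k r)" for s
  define P where "P s = k\<^sup>2 * (c * (Ch W s * p S - W * Sh W s * q S)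
     - (1 / 2) * (Sh W s * (2 * p s - p S) - Ch W s * (2 * q s - q S)))" for s
  define P1 where "P1 s = k\<^sup>2 * (c * (W * Sh W s * p S - W * Ch W s * q S)
     - (1 / 2) * (Ch W s * (2 * p s - p S) - W * Sh W s * (2 * q s - q S)))" for s
  have cCh: "continuous_on A (Ch W)" and cSh: "continuous_on A (Sh W)" for A
    by (auto intro!: continuous_at_imp_continuous_on DERIV_isCont DERIV_Ch DERIV_Sh)
  have cp: "continuous_on {0..S} (\<lambda>r. Ch W r * g k r)" and cq: "continuous_on {0..S} (\<lambda>r. Sh W r * g k r)"
    by (intro continuous_on_mult cCh cSh g)+
  have duhamel_eq: "duhamel S g k s = P s" if s: "s \<in> {0..S}" for s
  proof -
    have i: "(\<lambda>r. Ch W r * g k r) integrable_on {u..v}" "(\<lambda>r. Sh W r * g k r) integrable_on {u..v}"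
      if "{u..v} \<subseteq> {0..S}" for u v
      by (rule integrable_continuous_real[OF continuous_on_subset[OF cp that]],
          rule integrable_continuous_real[OF continuous_on_subset[OF cq that]])
    have ip: "((\<lambda>r. Ch W r * g k r) has_integral p s) {0..s}" "((\<lambda>r. Sh W r * g k r) has_integral q s) {0..s}"
      unfolding p_def q_def using s by (auto intro!: integrable_integral i)
    have iq: "((\<lambda>r. Ch W r * g k r) has_integral (p S - p s)) {s..S}" "((\<lambda>r. Sh W r * g k r) has_integral (q S - q s)) {s..S}"
    proof -
      have "p S - p s = integral {s..S} (\<lambda>r. Ch W r * g k r)" "q S - q s = integral {s..S} (\<lambda>r. Sh W r * g k r)"
        using Henstock_Kurzweil_Integration.integral_combine[of 0 s S "\<lambda>r. Ch W r * g k r"]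
          Henstock_Kurzweil_Integration.integral_combine[of 0 s S "\<lambda>r. Sh W r * g k r"] s i[of 0 S]
        by (simp_all add: p_def q_def)
      then show "((\<lambda>r. Ch W r * g k r) has_integral (p S - p s)) {s..S}" "((\<lambda>r. Sh W r * g k r) has_integral (q S - q s)) {s..S}"
        using integrable_integral[OF i(1)[of s S]] integrable_integral[OF i(2)[of s S]] s by auto
    qed
    have 1: "((\<lambda>r. green k (s - r) * g k r) has_integral
        (k\<^sup>2 * (c * Ch W s - Sh W s / 2) * p s + k\<^sup>2 * (Ch W s / 2 - c * W * Sh W s) * q s)) {0..s}"
    proof (rule has_integral_eq[OF _ has_integral_add[OF has_integral_mult_right[OF ip(1)] has_integral_mult_right[OF ip(2)]]])
      fix r assume "r \<in> {0..s}"
      then have "\<bar>s - r\<bar> = s - r" by simp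
      then show "k\<^sup>2 * (c * Ch W s - Sh W s / 2) * (Ch W r * g k r) + k\<^sup>2 * (Ch W s / 2 - c * W * Sh W s) * (Sh W r * g k r)
          = green k (s - r) * g k r"
        unfolding green_def W_def [symmetric] c_def [symmetric]
        by (simp only: Ch_diff Sh_diff) (simp add: algebra_simps diff_divide_distrib add_divide_distrib)
    qed
    have 2: "((\<lambda>r. green k (s - r) * g k r) has_integral
        (k\<^sup>2 * (c * Ch W s + Sh W s / 2) * (p S - p s) + k\<^sup>2 * (- Ch W s / 2 - c * W * Sh W s) * (q S - q s))) {s..S}"
    proof (rule has_integral_eq[OF _ has_integral_add[OF has_integral_mult_right[OF iq(1)] has_integral_mult_right[OF iq(2)]]])
      fix r assume "r \<in> {s..S}"
      then have "\<bar>s - r\<bar> = r - s" by simp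
      then show "k\<^sup>2 * (c * Ch W s + Sh W s / 2) * (Ch W r * g k r) + k\<^sup>2 * (- Ch W s / 2 - c * W * Sh W s) * (Sh W r * g k r)
          = green k (s - r) * g k r"
        unfolding green_def W_def [symmetric] c_def [symmetric]
        by (simp only: Ch_diff Sh_diff) (simp add: algebra_simps diff_divide_distrib add_divide_distrib)
    qed
    have "((\<lambda>r. green k (s - r) * g k r) has_integral P s) {0..S}"
    proof -
      have eq: "k\<^sup>2 * (c * Ch W s - Sh W s / 2) * p s + k\<^sup>2 * (Ch W s / 2 - c * W * Sh W s) * q s
        + (k\<^sup>2 * (c * Ch W s + Sh W s / 2) * (p S - p s) + k\<^sup>2 * (- Ch W s / 2 - c * W * Sh W s) * (q S - q s)) = P s"
        unfolding P_def by (simp add: algebra_simps diff_divide_distrib add_divide_distrib)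
      show ?thesis
        using has_integral_combine[OF _ _ 1 2] s unfolding eq by simp
    qed
    then show ?thesis unfolding duhamel_def by (rule integral_unique)
  qed
  have dp: "(p has_real_derivative Ch W s * g k s) (at s)" if "s \<in> {0<..<S}" for s
    using integral_has_real_derivative[OF cp, of s] that at_within_interior[of s "{0..S}"]
    by (simp add: p_def [abs_def])
  have dq: "(q has_real_derivative Sh W s * g k s) (at s)" if "s \<in> {0<..<S}" for s
    using integral_has_real_derivative[OF cq, of s] that at_within_interior[of s "{0..S}"]
    by (simp add: q_def [abs_def])
  have dP: "(P has_real_derivative P1 s) (at s)" if "s \<in> {0<..<S}" for s
    unfolding P_def [abs_def] P1_def
    by (auto intro!: derivative_eq_intros dp[OF that] dq[OF that] simp: algebra_simps)
  have dP1: "(P1 has_real_derivative W * P s - k\<^sup>2 * g k s) (at s)" if "s \<in> {0<..<S}" for s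
  proof -
    have "(P1 has_real_derivative W * P s - k\<^sup>2 * g k s * ((Ch W s)\<^sup>2 - W * (Sh W s)\<^sup>2)) (at s)"
      unfolding P_def P1_def [abs_def]
      by (auto intro!: derivative_eq_intros dp[OF that] dq[OF that] simp: algebra_simps power2_eq_square)
    then show ?thesis by (simp add: Ch_Sh_square)
  qed
  show ?thesis
  proof (rule that[of P1])
    fix s assume s: "s \<in> {0<..<S}"
    show "(duhamel S g k has_real_derivative P1 s) (at s)"
      by (rule has_field_derivative_transform_within_open[OF dP[OF s], of "{0<..<S}"]) (use s duhamel_eq in auto)
    show "(P1 has_real_derivative (k ^ 4 - k\<^sup>2) * duhamel S g k s - k\<^sup>2 * g k s) (at s)"
      using dP1[OF s] duhamel_eq[of s] s by (simp add: W_def)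
  qed
qed

lemma green_ode:
  obtains R1 where "\<And>s. s > 0 \<Longrightarrow> (green k has_real_derivative R1 s) (at s)"
    "\<And>s. s > 0 \<Longrightarrow> (R1 has_real_derivative (k ^ 4 - k\<^sup>2) * green k s) (at s)"
proof -
  define W where "W = k ^ 4 - k\<^sup>2"
  define c where "c = rgint W / (2 * hgauss_lim)"
  define P where "P s = k\<^sup>2 * (c * Ch W s - Sh W s / 2)" for s
  define P1 where "P1 s = k\<^sup>2 * (c * (W * Sh W s) - Ch W s / 2)" for s
  have eq: "green k s = P s" if "s > 0" for s using that by (simp add: green_def P_def W_def c_def)
  have dP: "(P has_real_derivative P1 s) (at s)" for s
    unfolding P_def [abs_def] P1_def by (auto intro!: derivative_eq_intros simp: algebra_simps)
  have dP1: "(P1 has_real_derivative W * P s) (at s)" for s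
    unfolding P_def P1_def [abs_def] by (auto intro!: derivative_eq_intros simp: algebra_simps)
  show ?thesis
  proof (rule that[of P1])
    fix s :: real assume s: "s > 0"
    show "(green k has_real_derivative P1 s) (at s)"
      by (rule has_field_derivative_transform_within_open[OF dP, of "{0<..}"]) (use s eq in auto)
    show "(P1 has_real_derivative (k ^ 4 - k\<^sup>2) * green k s) (at s)"
      using dP1[of s] eq[OF s] by (simp add: W_def)
  qed
qed

text \<open>Dominated convergence of difference quotients. Measurability of \<open>f' y0\<close> is
  a conclusion, as a limit of measurable quotients, because the time derivative of the profile will
  be known only separately for each \<open>k\<close>.\<close>

lemma DERIV_LINT:
  fixes f f' :: "real \<Rightarrow> real \<Rightarrow> real"
  assumes "e > 0"
    and int: "\<And>y. y \<in> ball y0 e \<Longrightarrow> integrable lborel (f y)"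
    and der: "\<And>y k. y \<in> ball y0 e \<Longrightarrow> ((\<lambda>y. f y k) has_real_derivative f' y k) (at y)"
    and bd: "\<And>y k. y \<in> ball y0 e \<Longrightarrow> \<bar>f' y k\<bar> \<le> D k" and D: "integrable lborel D"
  shows "((\<lambda>y. LINT k|lborel. f y k) has_real_derivative (LINT k|lborel. f' y0 k)) (at y0)"
    and "f' y0 \<in> borel_measurable lborel"
proof -
  let ?B = "ball y0 e"
  have y0: "y0 \<in> ?B" using \<open>e > 0\<close> by simp
  have lim: "(\<lambda>n. (f (X n) k - f y0 k) / (X n - y0)) \<longlonglongrightarrow> f' y0 k"
    if X: "\<forall>n. X n \<in> ?B - {y0}" "X \<longlonglongrightarrow> y0" for X k
  proof -
    have "((\<lambda>y. (f y k - f y0 k) / (y - y0)) \<longlongrightarrow> f' y0 k) (at y0)"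
      using der[OF y0, of k] by (simp add: has_field_derivative_iff)
    then show ?thesis
      using X unfolding tendsto_at_iff_sequentially by (auto simp: o_def)
  qed
  have meas: "(\<lambda>k. (f y k - f y0 k) / (y - y0)) \<in> borel_measurable lborel" if "y \<in> ?B" for y
    using int[OF that] int[OF y0] by measurable
  show m: "f' y0 \<in> borel_measurable lborel"
  proof (rule borel_measurable_LIMSEQ_real)
    \<comment> \<open>The offset 2 keeps every point strictly inside the open ball.\<close>
    let ?X = "\<lambda>n. y0 + e / real (n + 2)"
    have "(\<lambda>n. e / real (n + 2)) \<longlonglongrightarrow> 0"
      by (rule LIMSEQ_ignore_initial_segment[OF lim_const_over_n])
    from tendsto_add[OF tendsto_const[of y0] this] have X: "?X \<longlonglongrightarrow> y0" by simp
    have X': "?X n \<in> ?B - {y0}" for n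
    proof -
      have "e / real (n + 2) < e / 1" using \<open>e > 0\<close> by (intro divide_strict_left_mono) auto
      then show ?thesis using \<open>e > 0\<close> by (simp add: dist_norm)
    qed
    show "(\<lambda>n. (f (?X n) k - f y0 k) / (?X n - y0)) \<longlonglongrightarrow> f' y0 k" for k
      by (rule lim) (use X X' in auto)
    show "(\<lambda>k. (f (?X n) k - f y0 k) / (?X n - y0)) \<in> borel_measurable lborel" for n
      by (rule meas) (use X' in auto)
  qed
  have "((\<lambda>y. ((LINT k|lborel. f y k) - (LINT k|lborel. f y0 k)) / (y - y0)) \<longlongrightarrow> (LINT k|lborel. f' y0 k)) (at y0 within ?B)"
    unfolding tendsto_at_iff_sequentially
  proof (intro allI impI)
    fix X assume X: "\<forall>n. X n \<in> ?B - {y0}" "X \<longlonglongrightarrow> y0"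
    have "(\<lambda>n. LINT k|lborel. (f (X n) k - f y0 k) / (X n - y0)) \<longlonglongrightarrow> (LINT k|lborel. f' y0 k)"
    proof (rule integral_dominated_convergence[where w = D])
      show "(\<lambda>k. (f (X n) k - f y0 k) / (X n - y0)) \<in> borel_measurable lborel" for n
        by (rule meas) (use X in auto)
      show "AE k in lborel. (\<lambda>n. (f (X n) k - f y0 k) / (X n - y0)) \<longlonglongrightarrow> f' y0 k"
        by (rule AE_I2) (rule lim[OF X])
      show "AE k in lborel. norm ((f (X n) k - f y0 k) / (X n - y0)) \<le> D k" for n
      proof (rule AE_I2)
        fix k
        have "norm (f (X n) k - f y0 k) \<le> D k * norm (X n - y0)"
        proof (rule field_differentiable_bound[where f = "\<lambda>y. f y k" and f' = "\<lambda>y. f' y k" and S = ?B])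
          fix z assume "z \<in> ?B"
          then show "((\<lambda>y. f y k) has_real_derivative f' z k) (at z within ?B)"
            by (rule has_field_derivative_at_within[OF der])
        next
          show "norm (f' z k) \<le> D k" if "z \<in> ?B" for z using bd[OF that, of k] by simp
          show "X n \<in> ?B" using X(1) by blast
        qed (fact y0 convex_ball)+
        moreover have "X n \<noteq> y0" using X(1) by blast
        ultimately show "norm ((f (X n) k - f y0 k) / (X n - y0)) \<le> D k"
          by (simp add: norm_divide pos_divide_le_eq)
      qed
      show "f' y0 \<in> borel_measurable lborel" "integrable lborel D" by (fact m D)+
    qed
    moreover have "(LINT k|lborel. (f (X n) k - f y0 k) / (X n - y0))
       = ((LINT k|lborel. f (X n) k) - (LINT k|lborel. f y0 k)) / (X n - y0)" for n
    proof -
      have XB: "X n \<in> ?B" using X by blast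
      show ?thesis
        unfolding integral_divide_zero Bochner_Integration.integral_diff[OF int[OF XB] int[OF y0]] ..
    qed
    ultimately show "((\<lambda>y. ((LINT k|lborel. f y k) - (LINT k|lborel. f y0 k)) / (y - y0)) \<circ> X) \<longlonglongrightarrow> (LINT k|lborel. f' y0 k)"
      by (simp only: o_def)
  qed
  then show "((\<lambda>y. LINT k|lborel. f y k) has_real_derivative (LINT k|lborel. f' y0 k)) (at y0)"
    using at_within_open[OF y0 open_ball] by (simp add: has_field_derivative_iff)
qed

section \<open>Cosine transforms of rapidly decreasing families\<close>

definition rapid :: "real set \<Rightarrow> (real \<Rightarrow> real \<Rightarrow> real) \<Rightarrow> bool" where
  "rapid T g \<longleftrightarrow> (\<forall>s\<in>T. (\<lambda>k. g k s) \<in> borel_measurable borel) \<and>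
     (\<forall>n. \<exists>C. \<forall>s\<in>T. \<forall>k. (1 + \<bar>k\<bar>) ^ n * \<bar>g k s\<bar> \<le> C * (1 / (1 + k\<^sup>2)))"

text \<open>Differentiating \<open>cos (k x)\<close> in \<open>x\<close> multiplies by
  \<open>k\<close> and advances the phase by \<open>pi / 2\<close>. The index \<open>i\<close> is
  thus the order of the \<open>x\<close>-derivative, and one formula covers the cosine and sine
  cases.\<close>

definition cos_transform :: "nat \<Rightarrow> (real \<Rightarrow> real \<Rightarrow> real) \<Rightarrow> real \<Rightarrow> real \<Rightarrow> real" where
  "cos_transform i g x s = (LINT k|lborel. k ^ i * cos (k * x + of_nat i * (pi / 2)) * g k s)"

lemma cos_transform_dominated:
  assumes "rapid T g"
  obtains C where "\<And>s k x. s \<in> T \<Longrightarrow> \<bar>k ^ i * cos (k * x + \<theta>) * g k s\<bar> \<le> C * (1 / (1 + k\<^sup>2))"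
proof -
  obtain C where C: "\<And>s k. s \<in> T \<Longrightarrow> (1 + \<bar>k\<bar>) ^ i * \<bar>g k s\<bar> \<le> C * (1 / (1 + k\<^sup>2))"
    using assms unfolding rapid_def by blast
  show ?thesis
  proof (rule that[of C])
    fix s k x assume s: "s \<in> T"
    have "\<bar>k ^ i * cos (k * x + \<theta>) * g k s\<bar> \<le> (1 + \<bar>k\<bar>) ^ i * 1 * \<bar>g k s\<bar>"
      unfolding abs_mult power_abs by (intro mult_mono power_mono) auto
    also have "\<dots> \<le> C * (1 / (1 + k\<^sup>2))" using C[OF s, of k] by simp
    finally show "\<bar>k ^ i * cos (k * x + \<theta>) * g k s\<bar> \<le> C * (1 / (1 + k\<^sup>2))" .
  qed
qed

lemma cos_transform_integrable:
  assumes "rapid T g" "s \<in> T"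
  shows "integrable lborel (\<lambda>k. k ^ i * cos (k * x + \<theta>) * g k s)"
proof -
  obtain C where C: "\<And>s k x. s \<in> T \<Longrightarrow> \<bar>k ^ i * cos (k * x + \<theta>) * g k s\<bar> \<le> C * (1 / (1 + k\<^sup>2))"
    using cos_transform_dominated[OF assms(1)] by blast
  have [measurable]: "(\<lambda>k. g k s) \<in> borel_measurable borel" using assms by (simp add: rapid_def)
  show ?thesis
    by (rule Bochner_Integration.integrable_bound[OF integrable_mult_right[OF integrable_inverse_quadratic, of C]])
       (measurable, rule AE_I2, unfold real_norm_def, rule order_trans[OF C[OF assms(2)] abs_ge_self])
qed

lemma cos_transform_continuous:
  assumes g: "rapid T g" and cont: "\<And>k. continuous_on T (g k)"
  shows "continuous_on (UNIV \<times> T) (\<lambda>(x, s). cos_transform i g x s)"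
proof -
  obtain C where C: "\<And>s k x. s \<in> T \<Longrightarrow> \<bar>k ^ i * cos (k * x + of_nat i * (pi / 2)) * g k s\<bar> \<le> C * (1 / (1 + k\<^sup>2))"
    using cos_transform_dominated[OF g] by blast
  have "continuous_on (UNIV \<times> T) (\<lambda>p. LINT k|lborel. k ^ i * cos (k * fst p + of_nat i * (pi / 2)) * g k (snd p))"
  proof (rule continuous_on_LINT)
    show "continuous_on (UNIV \<times> T) (\<lambda>p. k ^ i * cos (k * fst p + of_nat i * (pi / 2)) * g k (snd p))" for k
      by (intro continuous_intros continuous_on_compose2[OF cont]) auto
    show "(\<lambda>k. k ^ i * cos (k * fst p + of_nat i * (pi / 2)) * g k (snd p)) \<in> borel_measurable lborel"
      if "p \<in> UNIV \<times> T" for p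
      using cos_transform_integrable[OF g, of "snd p"] that by (auto dest: borel_measurable_integrable)
    show "integrable lborel (\<lambda>k. C * (1 / (1 + k\<^sup>2)))"
      by (intro integrable_mult_right integrable_inverse_quadratic)
  qed (use C in auto)
  then show ?thesis by (simp add: cos_transform_def case_prod_unfold)
qed

lemma cos_transform_DERIV_x:
  assumes g: "rapid T g" and s: "s \<in> T"
  shows "((\<lambda>y. cos_transform i g y s) has_real_derivative cos_transform (Suc i) g x s) (at x)"
proof -
  obtain C where C: "\<And>s k x. s \<in> T \<Longrightarrow> \<bar>k ^ Suc i * cos (k * x + of_nat (Suc i) * (pi / 2)) * g k s\<bar> \<le> C * (1 / (1 + k\<^sup>2))"
    using cos_transform_dominated[OF g] by blast
  show ?thesis
    unfolding cos_transform_def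
  proof (rule DERIV_LINT(1)[where e = 1 and D = "\<lambda>k. C * (1 / (1 + k\<^sup>2))"])
    show "integrable lborel (\<lambda>k. k ^ i * cos (k * y + of_nat i * (pi / 2)) * g k s)" for y
      by (rule cos_transform_integrable[OF g s])
    fix y k :: real
    have "cos (k * y + of_nat (Suc i) * (pi / 2)) = - sin (k * y + of_nat i * (pi / 2))"
      using cos_add[of "k * y + of_nat i * (pi / 2)" "pi / 2"] by (simp add: algebra_simps add_divide_distrib)
    then show "((\<lambda>y. k ^ i * cos (k * y + of_nat i * (pi / 2)) * g k s) has_real_derivative
        k ^ Suc i * cos (k * y + of_nat (Suc i) * (pi / 2)) * g k s) (at y)"
      by (auto intro!: derivative_eq_intros)
    show "integrable lborel (\<lambda>k. C * (1 / (1 + k\<^sup>2)))"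
      by (intro integrable_mult_right integrable_inverse_quadratic)
  qed (use C[OF s] in auto)
qed

lemma cos_transform_DERIV_s:
  assumes g: "rapid T g" and g1: "\<And>n. \<exists>C. \<forall>s\<in>T. \<forall>k. (1 + \<bar>k\<bar>) ^ n * \<bar>g1 k s\<bar> \<le> C * (1 / (1 + k\<^sup>2))"
    and "open T" and s: "s \<in> T"
    and der: "\<And>k s. s \<in> T \<Longrightarrow> (g k has_real_derivative g1 k s) (at s)"
  shows "(cos_transform i g x has_real_derivative cos_transform i g1 x s) (at s)"
    and "(\<lambda>k. g1 k s) \<in> borel_measurable borel"
proof -
  obtain e where e: "e > 0" "ball s e \<subseteq> T" using \<open>open T\<close> s openE by blast
  have *: "((\<lambda>s. LINT k|lborel. k ^ i * cos (k * x + \<theta>) * g k s) has_real_derivative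
        (LINT k|lborel. k ^ i * cos (k * x + \<theta>) * g1 k s)) (at s) \<and>
      (\<lambda>k. k ^ i * cos (k * x + \<theta>) * g1 k s) \<in> borel_measurable lborel" for i x \<theta>
  proof -
    obtain C where C: "\<And>s k. s \<in> T \<Longrightarrow> (1 + \<bar>k\<bar>) ^ i * \<bar>g1 k s\<bar> \<le> C * (1 / (1 + k\<^sup>2))"
      using g1[of i] by blast
    have bd: "\<bar>k ^ i * cos (k * x + \<theta>) * g1 k y\<bar> \<le> C * (1 / (1 + k\<^sup>2))" if "y \<in> ball s e" for y k
    proof -
      have "\<bar>k ^ i * cos (k * x + \<theta>) * g1 k y\<bar> \<le> (1 + \<bar>k\<bar>) ^ i * 1 * \<bar>g1 k y\<bar>"
        unfolding abs_mult power_abs by (intro mult_mono power_mono) auto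
      also have "\<dots> \<le> C * (1 / (1 + k\<^sup>2))" using C[of y k] that e by auto
      finally show ?thesis .
    qed
    have int: "integrable lborel (\<lambda>k. k ^ i * cos (k * x + \<theta>) * g k y)" if "y \<in> ball s e" for y
      by (rule cos_transform_integrable[OF g]) (use that e in auto)
    have der': "((\<lambda>y. k ^ i * cos (k * x + \<theta>) * g k y) has_real_derivative k ^ i * cos (k * x + \<theta>) * g1 k y) (at y)"
      if "y \<in> ball s e" for y k
      using der[of y k] that e by (intro DERIV_cmult) auto
    show ?thesis
      using DERIV_LINT[OF e(1) int der' bd integrable_mult_right[OF integrable_inverse_quadratic, of C]] by blast
  qed
  show "(cos_transform i g x has_real_derivative cos_transform i g1 x s) (at s)"
    unfolding cos_transform_def using * by blast
  \<comment> \<open>At order, point and phase 0 the factor \<open>k ^ i cos (k x + \<theta>)\<close>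
    is 1, which leaves \<open>g1\<close> alone.\<close>
  show "(\<lambda>k. g1 k s) \<in> borel_measurable borel"
    using *[of 0 0 0] by simp
qed

section \<open>Decay in frequency and in space\<close>

lemma power_exp_bound:
  assumes "\<eta> > 0"
  obtains C where "C \<ge> 0" "\<And>x::real. x \<ge> 0 \<Longrightarrow> (1 + x) ^ m * exp (- (\<eta> * x)) \<le> C"
proof -
  have pe: "y ^ m / fact m \<le> exp y" if "y \<ge> 0" for y :: real
  proof -
    have "(\<Sum>n\<in>{m}. inverse (fact n) * y ^ n) \<le> (\<Sum>n. inverse (fact n) * y ^ n)"
      by (rule sum_le_suminf[OF summable_exp]) (use that in auto)
    then show ?thesis by (simp add: exp_def divide_inverse mult.commute)
  qed
  show ?thesis
  proof (rule that[of "fact m * exp \<eta> / \<eta> ^ m"])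
    fix x :: real assume "x \<ge> 0"
    then have "(\<eta> * (1 + x)) ^ m / fact m \<le> exp (\<eta> * (1 + x))" using assms by (intro pe) auto
    then have "(1 + x) ^ m \<le> fact m * exp (\<eta> * (1 + x)) / \<eta> ^ m"
      using assms unfolding power_mult_distrib by (simp add: pos_le_divide_eq pos_divide_le_eq mult_ac)
    then have "(1 + x) ^ m * exp (- (\<eta> * x)) \<le> fact m * exp (\<eta> * (1 + x)) / \<eta> ^ m * exp (- (\<eta> * x))"
      by (intro mult_right_mono) auto
    also have "\<dots> = fact m * exp \<eta> / \<eta> ^ m"
      by (simp add: distrib_left exp_add exp_minus)
    finally show "(1 + x) ^ m * exp (- (\<eta> * x)) \<le> fact m * exp \<eta> / \<eta> ^ m" .
  qed (use assms in auto)
qed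

lemma wt_power_bound:
  assumes "\<eta> > 0"
  obtains C where "C \<ge> 0" "\<And>s k. s \<ge> \<eta> \<Longrightarrow> (1 + \<bar>k\<bar>) ^ n * wt k s \<le> C * (1 / (1 + k\<^sup>2))"
proof -
  obtain C where C: "C \<ge> 0" "\<And>x. x \<ge> 0 \<Longrightarrow> (1 + x) ^ n * exp (- (\<eta> * x)) \<le> C"
    using power_exp_bound[OF assms] by blast
  show ?thesis
  proof (rule that[OF C(1)])
    fix s k assume "s \<ge> \<eta>"
    then have "exp (- (s * \<bar>k\<bar>)) \<le> exp (- (\<eta> * \<bar>k\<bar>))" by (simp add: mult_right_mono)
    then have "(1 + \<bar>k\<bar>) ^ n * exp (- (s * \<bar>k\<bar>)) \<le> (1 + \<bar>k\<bar>) ^ n * exp (- (\<eta> * \<bar>k\<bar>))"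
      by (intro mult_left_mono) auto
    also have "\<dots> \<le> C" by (rule C) simp
    finally have "(1 + \<bar>k\<bar>) ^ n * exp (- (s * \<bar>k\<bar>)) * (1 / (1 + k\<^sup>2)) \<le> C * (1 / (1 + k\<^sup>2))"
      using one_plus_square_pos[of k] by (intro mult_right_mono) auto
    then show "(1 + \<bar>k\<bar>) ^ n * wt k s \<le> C * (1 / (1 + k\<^sup>2))"
      by (simp add: wt_def)
  qed
qed

lemma poly_wt_decay:
  assumes "\<eta> > 0"
    and bd: "\<And>s k. s \<in> T \<Longrightarrow> \<bar>g k s\<bar> \<le> B * (1 + \<bar>k\<bar>) ^ j * wt k \<eta>"
  shows "\<exists>C. \<forall>s\<in>T. \<forall>k. (1 + \<bar>k\<bar>) ^ n * \<bar>g k s\<bar> \<le> C * (1 / (1 + k\<^sup>2))"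
proof -
  obtain C where C: "C \<ge> 0" "\<And>s k. s \<ge> \<eta> \<Longrightarrow> (1 + \<bar>k\<bar>) ^ (n + j) * wt k s \<le> C * (1 / (1 + k\<^sup>2))"
    using wt_power_bound[OF assms(1)] by blast
  show ?thesis
  proof (intro exI[of _ "\<bar>B\<bar> * C"] ballI allI)
    fix s k assume s: "s \<in> T"
    have "(1 + \<bar>k\<bar>) ^ n * \<bar>g k s\<bar> \<le> (1 + \<bar>k\<bar>) ^ n * (\<bar>B\<bar> * (1 + \<bar>k\<bar>) ^ j * wt k \<eta>)"
      using less_imp_le[OF wt_pos[of k \<eta>]]
      by (intro mult_left_mono order_trans[OF bd[OF s]] mult_right_mono) auto
    also have "\<dots> = \<bar>B\<bar> * ((1 + \<bar>k\<bar>) ^ (n + j) * wt k \<eta>)" by (simp add: power_add)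
    also have "\<dots> \<le> \<bar>B\<bar> * (C * (1 / (1 + k\<^sup>2)))" by (intro mult_left_mono C) auto
    finally show "(1 + \<bar>k\<bar>) ^ n * \<bar>g k s\<bar> \<le> \<bar>B\<bar> * C * (1 / (1 + k\<^sup>2))" by (simp add: mult.assoc)
  qed
qed

lemma wt_antimono: "r \<le> s \<Longrightarrow> wt k s \<le> wt k r"
  unfolding wt_def using one_plus_square_pos[of k] by (intro divide_right_mono) (auto intro: mult_right_mono)

lemma exp_difference_quotient_tendsto:
  "(\<lambda>n. (exp (c * of_real (1 / real (Suc n))) - 1) / of_real (1 / real (Suc n))) \<longlonglongrightarrow> (c::complex)"
proof -
  have "((\<lambda>h. exp (c * h)) has_field_derivative c) (at 0)"
    by (auto intro!: derivative_eq_intros)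
  then have lim: "((\<lambda>h. (exp (c * h) - 1) / h) \<longlongrightarrow> c) (at 0)"
    by (simp add: has_field_derivative_iff)
  have "(\<lambda>n. complex_of_real (1 / real (Suc n))) \<longlonglongrightarrow> of_real 0"
    by (intro tendsto_of_real LIMSEQ_Suc[OF lim_1_over_n])
  then have "((\<lambda>h. (exp (c * h) - 1) / h) \<circ> (\<lambda>n. complex_of_real (1 / real (Suc n)))) \<longlonglongrightarrow> c"
    by (intro lim[unfolded tendsto_at_iff_sequentially, rule_format]) (auto simp del: of_nat_Suc)
  then show ?thesis by (simp only: o_def)
qed

lemma LINT_exp_dq:
  fixes u :: "real \<Rightarrow> real"
  assumes "integrable lborel u" "h > 0"
  shows "(LINT k|lborel. exp (\<i> * of_real (k * x)) * of_real (dq h u k))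
     = (exp (- \<i> * of_real (h * x)) - 1) / of_real h * (LINT k|lborel. exp (\<i> * of_real (k * x)) * of_real (u k))"
proof -
  have int: "integrable lborel (\<lambda>k. exp (\<i> * of_real (k * x + y)) * complex_of_real (v k))"
    if "integrable lborel v" for v y
  proof (rule Bochner_Integration.integrable_bound[OF that])
    have [measurable]: "v \<in> borel_measurable borel" using that by simp
    show "(\<lambda>k. exp (\<i> * of_real (k * x + y)) * complex_of_real (v k)) \<in> borel_measurable lborel"
    proof -
      have [measurable]: "(\<lambda>k. exp (\<i> * of_real (k * x + y))) \<in> borel_measurable borel"
        by (intro borel_measurable_continuous_onI continuous_intros)
      show ?thesis by measurable
    qed
  qed (auto simp: norm_mult)
  have iu: "integrable lborel (\<lambda>k. u (h + 1 * k))"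
    using lborel_integrable_real_affine[OF assms(1), of 1 h] by simp
  let ?I = "LINT k|lborel. exp (\<i> * of_real (k * x)) * of_real (u k)"
  have "(LINT k|lborel. exp (\<i> * of_real (k * x)) * of_real (u (h + 1 * k))) =
      (LINT k|lborel. exp (- \<i> * of_real (h * x)) * (exp (\<i> * of_real ((h + 1 * k) * x)) * of_real (u (h + 1 * k))))"
    by (intro Bochner_Integration.integral_cong) (auto simp: algebra_simps simp flip: exp_add)
  also have "\<dots> = exp (- \<i> * of_real (h * x)) * (LINT k|lborel. (exp (\<i> * of_real ((h + 1 * k) * x)) * of_real (u (h + 1 * k))))"
    by (rule integral_mult_right_zero)
  also have "(LINT k|lborel. (exp (\<i> * of_real ((h + 1 * k) * x)) * of_real (u (h + 1 * k)))) = ?I"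
    using lborel_integral_real_affine[of 1 "\<lambda>k. exp (\<i> * of_real (k * x)) * complex_of_real (u k)" h] by simp
  finally have sh: "(LINT k|lborel. exp (\<i> * of_real (k * x)) * of_real (u (h + 1 * k))) = exp (- \<i> * of_real (h * x)) * ?I" .
  have "(LINT k|lborel. exp (\<i> * of_real (k * x)) * of_real (dq h u k)) =
     (LINT k|lborel. (exp (\<i> * of_real (k * x)) * of_real (u (h + 1 * k)) - exp (\<i> * of_real (k * x)) * of_real (u k)) / of_real h)"
    using \<open>h > 0\<close> by (intro Bochner_Integration.integral_cong) (auto simp: dq_def divide_inverse algebra_simps)
  also have "\<dots> = (exp (- \<i> * of_real (h * x)) * ?I - ?I) / of_real h"
    unfolding sh [symmetric] integral_divide_zero
    using int[OF iu, of 0] int[OF assms(1), of 0] by simp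
  finally show ?thesis by (simp add: field_simps)
qed

text \<open>The symbol of the \<open>i\<close>-th derivative is \<open>k ^ i g\<close>, and its
  weight \<open>(1 + \<bar>k\<bar>) ^ i wt k s\<close> has a common integrable majorant as long as
  \<open>s \<ge> \<eta> > 0\<close>. The bounds on the quotients do not depend on \<open>h\<close>,
  so \<open>h\<close> may tend to 0 in the multiplier.\<close>

lemma cos_transform_decay:
  assumes us: "symbol_bound T (\<lambda>s k. wt k s) (\<lambda>s k. g k s)"
    and T: "T \<subseteq> {\<eta>..S}" and \<eta>: "\<eta> > 0"
    and meas: "\<And>s. s \<in> T \<Longrightarrow> (\<lambda>k. g k s) \<in> borel_measurable borel"
  obtains C where "\<And>s x. s \<in> T \<Longrightarrow> \<bar>x\<bar> ^ m * \<bar>cos_transform i g x s\<bar> \<le> C"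
proof -
  define f where "f s k = k ^ i * g k s" for s k
  have "symbol_bound T (\<lambda>s k. (1 + \<bar>k\<bar>) ^ i * wt k s) f"
    unfolding f_def
    by (rule symbol_bound_mult[OF symbol_bound_power us, where K = "4 * exp S"])
       (use T \<eta> less_imp_le[OF wt_pos] in \<open>auto intro!: wt_shift\<close>)
  then obtain D where D: "\<And>m::nat. D m \<ge> 0" "\<And>m s h k. s \<in> T \<Longrightarrow> 0 < h \<Longrightarrow> h \<le> 1 \<Longrightarrow>
      \<bar>(dq h ^^ m) (f s) k\<bar> \<le> D m * ((1 + \<bar>k\<bar>) ^ i * wt k s)"
    using symbol_boundE[of T "\<lambda>s k. (1 + \<bar>k\<bar>) ^ i * wt k s" f] less_imp_le[OF wt_pos] by (auto simp: mult_nonneg_nonneg)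
  obtain E where E: "E \<ge> 0" "\<And>s k. s \<ge> \<eta> \<Longrightarrow> (1 + \<bar>k\<bar>) ^ i * wt k s \<le> E * (1 / (1 + k\<^sup>2))"
    using wt_power_bound[OF \<eta>] by blast
  have bd: "\<bar>(dq h ^^ m) (f s) k\<bar> \<le> D m * E * (1 / (1 + k\<^sup>2))" if "s \<in> T" "0 < h" "h \<le> 1" for m s h k
    using order_trans[OF D(2)[OF that] mult_left_mono[OF E(2) D(1)]] that(1) T by (auto simp: mult.assoc)
  have mf: "f s \<in> borel_measurable borel" if "s \<in> T" for s
    using meas[OF that] unfolding f_def by simp
  have int: "integrable lborel ((dq h ^^ m) (f s))" if "s \<in> T" "0 < h" "h \<le> 1" for h m s
  proof (rule Bochner_Integration.integrable_bound[OF integrable_mult_right[OF integrable_inverse_quadratic, of "D m * E"]])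
    show "(dq h ^^ m) (f s) \<in> borel_measurable lborel"
      using dq_pow_measurable[OF mf[OF that(1)]] by simp
    show "AE k in lborel. norm ((dq h ^^ m) (f s) k) \<le> norm (D m * E * (1 / (1 + k\<^sup>2)))"
      by (rule AE_I2) (unfold real_norm_def, rule order_trans[OF bd[OF that] abs_ge_self])
  qed
  define G where "G s x = (LINT k|lborel. exp (\<i> * of_real (k * x)) * complex_of_real (f s k))" for s x
  have Gm: "((exp (- \<i> * of_real (h * x)) - 1) / of_real h) ^ m * G s x =
      (LINT k|lborel. exp (\<i> * of_real (k * x)) * of_real ((dq h ^^ m) (f s) k))"
    if "s \<in> T" "0 < h" "h \<le> 1" for s h x m
  proof (induction m)
    case (Suc m)
    then show ?case
      using LINT_exp_dq[OF int[OF that, of m] that(2), of x] by (simp add: mult.assoc)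
  qed (simp add: G_def)
  have Gb: "norm ((exp (- \<i> * of_real (h * x)) - 1) / of_real h) ^ m * norm (G s x) \<le> D m * E * quad_mass"
    if "s \<in> T" "0 < h" "h \<le> 1" for s h x
  proof -
    have "norm (((exp (- \<i> * of_real (h * x)) - 1) / of_real h) ^ m * G s x) \<le>
        (LINT k|lborel. norm (exp (\<i> * of_real (k * x)) * complex_of_real ((dq h ^^ m) (f s) k)))"
      unfolding Gm[OF that] by (rule integral_norm_bound)
    also have "\<dots> = (LINT k|lborel. \<bar>(dq h ^^ m) (f s) k\<bar>)" by (simp add: norm_mult)
    also have "\<dots> \<le> (LINT k|lborel. D m * E * (1 / (1 + k\<^sup>2)))"
      by (rule integral_mono[OF Bochner_Integration.integrable_abs[OF int[OF that]]
            integrable_mult_right[OF integrable_inverse_quadratic] bd[OF that]])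
    also have "\<dots> = D m * E * quad_mass" unfolding quad_mass_def by (rule integral_mult_right_zero)
    finally show ?thesis by (simp only: norm_mult norm_power)
  qed
  show ?thesis
  proof (rule that[of "D m * E * quad_mass"])
    fix s x assume s: "s \<in> T"
    have "(\<lambda>n. norm ((exp (- \<i> * of_real x * of_real (1 / real (Suc n))) - 1) / of_real (1 / real (Suc n))) ^ m * norm (G s x))
       \<longlonglongrightarrow> norm (- \<i> * of_real x) ^ m * norm (G s x)"
      by (intro tendsto_intros exp_difference_quotient_tendsto)
    moreover have "norm ((exp (- \<i> * of_real x * of_real (1 / real (Suc n))) - 1) / of_real (1 / real (Suc n))) ^ m * norm (G s x)
        \<le> D m * E * quad_mass" for n
    proof -
      have "complex_of_real (1 / real (Suc n) * x) = of_real x * of_real (1 / real (Suc n))" by simp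
      then show ?thesis
        using Gb[OF s, of "1 / real (Suc n)" x] by (simp add: mult.assoc del: of_real_divide of_real_mult of_nat_Suc)
    qed
    ultimately have 1: "norm (- \<i> * of_real x) ^ m * norm (G s x) \<le> D m * E * quad_mass"
      by (intro LIMSEQ_le_const2) auto
    have fi: "integrable lborel (\<lambda>k. exp (\<i> * of_real (of_nat i * (pi / 2))) * (exp (\<i> * of_real (k * x)) * complex_of_real (f s k)))"
    proof (rule Bochner_Integration.integrable_bound[OF int[OF s, of 1 0]])
      have [measurable]: "f s \<in> borel_measurable borel" by (rule mf[OF s])
      have [measurable]: "(\<lambda>k. exp (\<i> * of_real (k * x))) \<in> borel_measurable borel"
        by (intro borel_measurable_continuous_onI continuous_intros)
      show "(\<lambda>k. exp (\<i> * of_real (of_nat i * (pi / 2))) * (exp (\<i> * of_real (k * x)) * complex_of_real (f s k))) \<in> borel_measurable lborel"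
        by measurable
    qed (auto simp: norm_mult)
    have "cos_transform i g x s = (LINT k|lborel. Re (exp (\<i> * of_real (of_nat i * (pi / 2))) * (exp (\<i> * of_real (k * x)) * complex_of_real (f s k))))"
      unfolding cos_transform_def
    proof (rule Bochner_Integration.integral_cong)
      fix k
      have "exp (\<i> * of_real (of_nat i * (pi / 2))) * (exp (\<i> * of_real (k * x)) * complex_of_real (f s k))
        = cis (k * x + of_nat i * (pi / 2)) * complex_of_real (f s k)"
        by (simp add: cis_conv_exp algebra_simps flip: exp_add)
      then show "k ^ i * cos (k * x + of_nat i * (pi / 2)) * g k s =
          Re (exp (\<i> * of_real (of_nat i * (pi / 2))) * (exp (\<i> * of_real (k * x)) * complex_of_real (f s k)))"
        by (simp only: f_def) simp
    qed simp
    also have "\<dots> = Re (LINT k|lborel. exp (\<i> * of_real (of_nat i * (pi / 2))) * (exp (\<i> * of_real (k * x)) * complex_of_real (f s k)))"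
      by (rule integral_Re[OF fi])
    also have "\<dots> = Re (exp (\<i> * of_real (of_nat i * (pi / 2))) * G s x)"
      unfolding G_def by (simp only: integral_mult_right_zero)
    finally have "\<bar>cos_transform i g x s\<bar> \<le> norm (exp (\<i> * of_real (of_nat i * (pi / 2))) * G s x)"
      using abs_Re_le_cmod by metis
    also have "\<dots> = norm (G s x)" by (simp add: norm_mult)
    finally have "\<bar>x\<bar> ^ m * \<bar>cos_transform i g x s\<bar> \<le> \<bar>x\<bar> ^ m * norm (G s x)" by (intro mult_left_mono) auto
    also have "\<dots> \<le> D m * E * quad_mass" using 1 by (simp add: norm_mult)
    finally show "\<bar>x\<bar> ^ m * \<bar>cos_transform i g x s\<bar> \<le> D m * E * quad_mass" .
  qed
qed

text \<open>Raising the order by 4 advances the phase by \<open>2 pi\<close>, raising it by 2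
  advances it by \<open>pi\<close>; so \<open>k ^ 4\<close> acts as the fourth and
  \<open>- k\<^sup>2\<close> as the second \<open>x\<close>-derivative.\<close>

lemma cos_transform_symbol:
  assumes a: "rapid T a" and b: "rapid T b" and s: "s \<in> T"
  shows "cos_transform i (\<lambda>k s. (k ^ 4 - k\<^sup>2) * a k s - k\<^sup>2 * b k s) x s = cos_transform (i + 4) a x s + cos_transform (i + 2) a x s + cos_transform (i + 2) b x s"
proof -
  note ia = cos_transform_integrable[OF a s] and ib = cos_transform_integrable[OF b s]
  have "cos_transform i (\<lambda>k s. (k ^ 4 - k\<^sup>2) * a k s - k\<^sup>2 * b k s) x s =
    (LINT k|lborel. (k ^ (i + 4) * cos (k * x + of_nat (i + 4) * (pi / 2)) * a k s
       + k ^ (i + 2) * cos (k * x + of_nat (i + 2) * (pi / 2)) * a k s)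
       + k ^ (i + 2) * cos (k * x + of_nat (i + 2) * (pi / 2)) * b k s)"
    unfolding cos_transform_def
  proof (rule Bochner_Integration.integral_cong)
    fix k
    let ?\<theta> = "k * x + of_nat i * (pi / 2)"
    have e4: "cos (k * x + of_nat (i + 4) * (pi / 2)) = cos ?\<theta>"
      using cos_periodic[of ?\<theta>] by (simp add: algebra_simps)
    have e2: "cos (k * x + of_nat (i + 2) * (pi / 2)) = - cos ?\<theta>"
      using cos_periodic_pi[of ?\<theta>] by (simp add: algebra_simps)
    show "k ^ i * cos ?\<theta> * ((k ^ 4 - k\<^sup>2) * a k s - k\<^sup>2 * b k s) =
       k ^ (i + 4) * cos (k * x + of_nat (i + 4) * (pi / 2)) * a k s
       + k ^ (i + 2) * cos (k * x + of_nat (i + 2) * (pi / 2)) * a k s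
       + k ^ (i + 2) * cos (k * x + of_nat (i + 2) * (pi / 2)) * b k s"
      unfolding e2 e4 by (simp add: power_add power2_eq_square algebra_simps)
  qed simp
  also have "\<dots> = cos_transform (i + 4) a x s + cos_transform (i + 2) a x s + cos_transform (i + 2) b x s"
    unfolding cos_transform_def
    by (subst Bochner_Integration.integral_add[OF Bochner_Integration.integrable_add[OF ia ia] ib],
        subst Bochner_Integration.integral_add[OF ia ia]) simp
  finally show ?thesis .
qed

text \<open>Fubini and the addition theorem for the cosine; the product of the two sine integrals
  drops out because \<open>f\<close> is even.\<close>

lemma LINT_cos_conv:
  fixes f :: "real \<Rightarrow> real"
  assumes int: "integrable lborel f" and even: "\<And>k. f (- k) = f k"
  shows "(LINT k|lborel. cos (k * x) * conv f f k) = (LINT k|lborel. cos (k * x) * f k)\<^sup>2"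
proof -
  have m [measurable]: "f \<in> borel_measurable borel" using int by simp
  have shift: "integrable lborel (\<lambda>k. f (k - l))" for l
    using lborel_integrable_real_affine[OF int, of 1 "- l"] by simp
  have bdd: "integrable lborel (\<lambda>k. p k * f k)" if [measurable]: "p \<in> borel_measurable borel" and "\<And>k. \<bar>p k\<bar> \<le> 1" for p
    by (rule Bochner_Integration.integrable_bound[OF int]) (use that(2) in \<open>auto intro!: AE_I2 mult_left_le_one_le simp: abs_mult\<close>)
  have 1: "integrable (lborel \<Otimes>\<^sub>M lborel) (\<lambda>(l, k). f (k - l) * f l)"
  proof (rule lborel_pair.Fubini_integrable)
    show "(\<lambda>(l, k). f (k - l) * f l) \<in> borel_measurable (lborel \<Otimes>\<^sub>M lborel)" by measurable
    have "(LINT k|lborel. norm (f (k - l) * f l)) = (LINT k|lborel. \<bar>f k\<bar>) * \<bar>f l\<bar>" for l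
    proof -
      have "(LINT k|lborel. \<bar>f (k - l)\<bar>) = (LINT k|lborel. \<bar>f k\<bar>)"
        using lborel_integral_real_affine[of 1 "\<lambda>k. \<bar>f k\<bar>" "- l"] by simp
      then show ?thesis by (simp add: abs_mult)
    qed
    then show "integrable lborel (\<lambda>l. LINT k|lborel. norm (case (l, k) of (l, k) \<Rightarrow> f (k - l) * f l))"
      using int by simp
    show "AE l in lborel. integrable lborel (\<lambda>k. case (l, k) of (l, k) \<Rightarrow> f (k - l) * f l)"
      using shift by simp
  qed
  have 2: "integrable (lborel \<Otimes>\<^sub>M lborel) (\<lambda>(l, k). cos (k * x) * (f (k - l) * f l))"
  proof (rule Bochner_Integration.integrable_bound[OF 1])
    show "(\<lambda>(l, k). cos (k * x) * (f (k - l) * f l)) \<in> borel_measurable (lborel \<Otimes>\<^sub>M lborel)" by measurable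
  qed (auto intro!: AE_I2 mult_left_le_one_le simp: abs_mult)
  have sin0: "(LINT k|lborel. sin (k * x) * f k) = 0"
    using lborel_integral_real_affine[of "-1" "\<lambda>k. sin (k * x) * f k" 0] by (simp add: even)
  have inner: "(LINT k|lborel. cos (k * x) * (f (k - l) * f l)) = (LINT k|lborel. cos (k * x) * f k) * (cos (l * x) * f l)" for l
  proof -
    have "(LINT k|lborel. cos (k * x) * (f (k - l) * f l)) = (LINT k|lborel. cos ((l + 1 * k) * x) * (f (l + 1 * k - l) * f l))"
      using lborel_integral_real_affine[of 1 "\<lambda>k. cos (k * x) * (f (k - l) * f l)" l] by simp
    also have "\<dots> = (LINT k|lborel. (cos (k * x) * f k) * (cos (l * x) * f l) - (sin (k * x) * f k) * (sin (l * x) * f l))"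
      by (intro Bochner_Integration.integral_cong) (auto simp: distrib_right cos_add algebra_simps)
    also have "\<dots> = (LINT k|lborel. cos (k * x) * f k) * (cos (l * x) * f l) - (LINT k|lborel. sin (k * x) * f k) * (sin (l * x) * f l)"
      by (subst Bochner_Integration.integral_diff) (auto intro!: integrable_mult_left bdd)
    finally show ?thesis by (simp add: sin0)
  qed
  have "(LINT k|lborel. cos (k * x) * conv f f k) = (LINT k|lborel. (LINT l|lborel. cos (k * x) * (f (k - l) * f l)))"
    by (simp add: conv_def)
  also have "\<dots> = (LINT l|lborel. (LINT k|lborel. cos (k * x) * (f (k - l) * f l)))"
    using lborel_pair.Fubini_integral[of "\<lambda>l k. cos (k * x) * (f (k - l) * f l)"] 2 by simp
  also have "\<dots> = (LINT k|lborel. cos (k * x) * f k)\<^sup>2"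
    unfolding inner by (simp add: power2_eq_square)
  finally show ?thesis .
qed

section \<open>Second differences at a kink\<close>

lemma sin_ge_half:
  assumes "0 \<le> z" "z \<le> (1::real)"
  shows "z / 2 \<le> sin z"
proof -
  have "sin 0 - 0 / 2 \<le> sin z - z / 2"
  proof (rule DERIV_nonneg_imp_nondecreasing[where f = "\<lambda>z. sin z - z / 2"])
    fix y assume y: "0 \<le> y" "y \<le> z"
    have "\<bar>sin (y / 2)\<bar> \<le> 1 / 2" using abs_sin_x_le_abs_x[of "y / 2"] y assms by simp
    then have "(sin (y / 2))\<^sup>2 \<le> (1 / 2)\<^sup>2" by (metis abs_ge_zero power2_abs power_mono)
    then have "cos y - 1 / 2 \<ge> 0"
      using cos_double_sin[of "y / 2"] by (simp add: power2_eq_square)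
    moreover have "((\<lambda>z. sin z - z / 2) has_real_derivative cos y - 1 / 2) (at y)"
      by (auto intro!: derivative_eq_intros)
    ultimately show "\<exists>D. ((\<lambda>z. sin z - z / 2) has_real_derivative D) (at y) \<and> 0 \<le> D" by blast
  qed (use assms in auto)
  then show ?thesis by simp
qed

lemma one_minus_cos_bounds:
  shows "2 * (1 - cos y) \<le> (y::real)\<^sup>2" and "\<bar>y\<bar> \<le> 1 \<Longrightarrow> y\<^sup>2 / 4 \<le> 2 * (1 - cos y)"
proof -
  have c: "2 * (1 - cos y) = (2 * sin (y / 2))\<^sup>2"
    using cos_double_sin[of "y / 2"] by (simp add: power_mult_distrib)
  have "\<bar>2 * sin (y / 2)\<bar> \<le> \<bar>y\<bar>" using abs_sin_x_le_abs_x[of "y / 2"] by (simp add: abs_mult)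
  then show "2 * (1 - cos y) \<le> y\<^sup>2" unfolding c by (simp add: abs_le_square_iff)
  assume "\<bar>y\<bar> \<le> 1"
  have "\<bar>y\<bar> / 2 / 2 \<le> sin (\<bar>y\<bar> / 2)" by (rule sin_ge_half) (use \<open>\<bar>y\<bar> \<le> 1\<close> in auto)
  then have "(\<bar>y\<bar> / 2)\<^sup>2 \<le> (2 * sin (\<bar>y\<bar> / 2))\<^sup>2" by (intro power_mono) auto
  also have "(2 * sin (\<bar>y\<bar> / 2))\<^sup>2 = (2 * sin (y / 2))\<^sup>2"
    by (cases "y \<ge> 0") (simp_all add: power_mult_distrib)
  finally show "y\<^sup>2 / 4 \<le> 2 * (1 - cos y)" unfolding c by (simp add: power_divide)
qed

text \<open>
  A tail of order \<open>1 / k\<^sup>2\<close> makes the transform have a kink at the origin.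
\<close>

lemma second_difference_unbounded:
  fixes f :: "real \<Rightarrow> real"
  assumes [measurable]: "f \<in> borel_measurable borel"
    and bd: "\<And>k. \<bar>f k\<bar> \<le> M * (1 / (1 + k\<^sup>2))" and "c > 0" "K \<ge> 1" "M \<ge> 0"
    and low: "\<And>k. \<bar>k\<bar> \<ge> K \<Longrightarrow> f k \<ge> c * (1 / (1 + k\<^sup>2))" and "h0 > 0" "C \<ge> 0"
  shows "\<exists>h. 0 < h \<and> h < h0 \<and>
    \<bar>(LINT k|lborel. cos (k * h) * f k) + (LINT k|lborel. cos (k * (- h)) * f k) - 2 * (LINT k|lborel. cos (k * 0) * f k)\<bar> > C * h\<^sup>2"
proof -
  \<comment> \<open>Chosen so that \<open>c / 8 (L - K) = C + K\<^sup>2 M quad_mass\<close>. Once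
    \<open>1 / h \<ge> L + 1\<close>, the gain on \<open>{K..1 / h}\<close> minus the loss at low
    frequencies exceeds \<open>C h\<^sup>2\<close>.\<close>
  define L where "L = K + 8 * (C + K\<^sup>2 * M * quad_mass) / c"
  have L: "L \<ge> K" unfolding L_def using \<open>c > 0\<close> \<open>C \<ge> 0\<close> \<open>M \<ge> 0\<close> quad_mass_nonneg by simp
  define h where "h = min (h0 / 2) (1 / (L + 1))"
  have h: "h > 0" "h < h0" "h \<le> 1 / (L + 1)"
    using \<open>h0 > 0\<close> L \<open>K \<ge> 1\<close> unfolding h_def by auto
  have Lh: "L + 1 \<le> 1 / h"
    using h L \<open>K \<ge> 1\<close> by (simp add: pos_le_divide_eq mult.commute)
  have int: "integrable lborel (\<lambda>k. cos (k * y) * f k)" for y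
  proof (rule Bochner_Integration.integrable_bound[OF integrable_mult_right[OF integrable_inverse_quadratic, of M]])
    show "AE k in lborel. norm (cos (k * y) * f k) \<le> norm (M * (1 / (1 + k\<^sup>2)))"
    proof (rule AE_I2)
      fix k
      have "norm (cos (k * y) * f k) \<le> 1 * \<bar>f k\<bar>"
        unfolding real_norm_def abs_mult by (intro mult_right_mono) auto
      also have "\<dots> \<le> \<bar>M * (1 / (1 + k\<^sup>2))\<bar>" using order_trans[OF bd abs_ge_self] by simp
      finally show "norm (cos (k * y) * f k) \<le> norm (M * (1 / (1 + k\<^sup>2)))" by simp
    qed
  qed measurable
  \<comment> \<open>A minorant of \<open>2 (1 - cos (k h)) f k\<close>. On \<open>{K..1 / h}\<close>
    one has \<open>2 (1 - cos (k h)) \<ge> (k h)\<^sup>2 / 4\<close> and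
    \<open>f k \<ge> c / (2 k\<^sup>2)\<close>, hence the constant height
    \<open>c h\<^sup>2 / 8\<close>; the interval has length about \<open>1 / h\<close>, so the gain
    is of order \<open>h\<close>. For \<open>\<bar>k\<bar> < K\<close> the sign of \<open>f\<close>
    is unknown, at a cost of \<open>K\<^sup>2 h\<^sup>2\<close> times its majorant.\<close>
  define g where "g k = - (K\<^sup>2 * M * h\<^sup>2) * (1 / (1 + k\<^sup>2)) + c / 8 * h\<^sup>2 * indicator {K..1 / h} k" for k :: real
  have ind: "integrable lborel (indicator {K..1 / h} :: real \<Rightarrow> real)"
    by (intro integrable_real_indicator) (auto simp: emeasure_lborel_Icc_eq)
  have ig: "integrable lborel g"
    unfolding g_def by (intro Bochner_Integration.integrable_add integrable_mult_right integrable_inverse_quadratic ind)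
  have "(LINT k|lborel. g k) = - (K\<^sup>2 * M * h\<^sup>2) * quad_mass + c / 8 * h\<^sup>2 * (1 / h - K)"
  proof -
    have "(LINT k|lborel. g k) = (LINT k|lborel. - (K\<^sup>2 * M * h\<^sup>2) * (1 / (1 + k\<^sup>2))) + (LINT k|lborel. c / 8 * h\<^sup>2 * indicator {K..1 / h} k)"
      unfolding g_def by (intro Bochner_Integration.integral_add integrable_mult_right integrable_inverse_quadratic ind)
    also have "(LINT k|lborel. c / 8 * h\<^sup>2 * indicator {K..1 / h} k) = c / 8 * h\<^sup>2 * (1 / h - K)"
      using Lh L by (subst integral_mult_right_zero) simp
    finally show ?thesis unfolding integral_mult_right_zero quad_mass_def .
  qed
  also have "\<dots> > C * h\<^sup>2"
  proof -
    have "c / 8 * (1 / h - K) \<ge> c / 8 * (L + 1 - K)" using Lh \<open>c > 0\<close> by (intro mult_left_mono) auto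
    also have "c / 8 * (L + 1 - K) = C + K\<^sup>2 * M * quad_mass + c / 8"
      using \<open>c > 0\<close> by (simp add: L_def field_simps)
    finally have "c / 8 * (1 / h - K) - K\<^sup>2 * M * quad_mass > C" using \<open>c > 0\<close> by linarith
    then have "h\<^sup>2 * (c / 8 * (1 / h - K) - K\<^sup>2 * M * quad_mass) > h\<^sup>2 * C"
      using h by (intro mult_strict_left_mono) auto
    then show ?thesis by (simp add: algebra_simps)
  qed
  finally have 1: "C * h\<^sup>2 < (LINT k|lborel. g k)" .
  have g_le: "g k \<le> 2 * (1 - cos (k * h)) * f k" for k
  proof (cases "\<bar>k\<bar> \<ge> K")
    case True
    then have fk: "f k \<ge> c * (1 / (1 + k\<^sup>2))" by (rule low)
    have k2: "k\<^sup>2 \<ge> 1" using True \<open>K \<ge> 1\<close> power_mono[of 1 "\<bar>k\<bar>" 2] by simp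
    have neg: "- (K\<^sup>2 * M * h\<^sup>2) * (1 / (1 + k\<^sup>2)) \<le> 0"
      using \<open>M \<ge> 0\<close> one_plus_square_pos[of k] by (simp add: mult_nonneg_nonneg)
    have f0: "f k \<ge> 0" using fk \<open>c > 0\<close> one_plus_square_pos[of k] by (smt (verit) divide_nonneg_pos mult_nonneg_nonneg)
    show ?thesis
    proof (cases "k \<in> {K..1 / h}")
      case kin: True
      then have kh: "\<bar>k * h\<bar> \<le> 1" using h \<open>K \<ge> 1\<close> by (simp add: abs_mult pos_le_divide_eq)
      have "c / (2 * k\<^sup>2) \<le> c * (1 / (1 + k\<^sup>2))"
        using k2 \<open>c > 0\<close> by (simp add: frac_le)
      then have "(k * h)\<^sup>2 / 4 * (c / (2 * k\<^sup>2)) \<le> 2 * (1 - cos (k * h)) * f k"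
        using one_minus_cos_bounds(2)[OF kh] fk \<open>c > 0\<close> f0 by (intro mult_mono) auto
      moreover have "(k * h)\<^sup>2 / 4 * (c / (2 * k\<^sup>2)) = c / 8 * h\<^sup>2"
        using k2 by (auto simp: power_mult_distrib field_simps)
      moreover have "g k = - (K\<^sup>2 * M * h\<^sup>2) * (1 / (1 + k\<^sup>2)) + c / 8 * h\<^sup>2"
        using kin by (simp add: g_def)
      ultimately show ?thesis using neg by linarith
    next
      case False
      have "0 \<le> 2 * (1 - cos (k * h)) * f k" using f0 by (intro mult_nonneg_nonneg) auto
      then show ?thesis using False neg by (simp add: g_def)
    qed
  next
    case False
    then have "k\<^sup>2 \<le> K\<^sup>2" by (simp add: abs_le_square_iff[symmetric])
    then have "(k * h)\<^sup>2 \<le> K\<^sup>2 * h\<^sup>2" by (simp add: power_mult_distrib mult_right_mono)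
    then have "2 * (1 - cos (k * h)) \<le> K\<^sup>2 * h\<^sup>2" using one_minus_cos_bounds(1)[of "k * h"] by linarith
    then have "\<bar>2 * (1 - cos (k * h)) * f k\<bar> \<le> (K\<^sup>2 * h\<^sup>2) * (M * (1 / (1 + k\<^sup>2)))"
      unfolding abs_mult[of "2 * (1 - cos (k * h))"] by (intro mult_mono bd) auto
    moreover have "indicator {K..1 / h} k = (0::real)" using False \<open>K \<ge> 1\<close> by (auto simp: indicator_def)
    ultimately show ?thesis by (simp add: g_def mult_ac abs_le_iff)
  qed
  have le: "g k \<le> 2 * (cos (k * 0) * f k) - 2 * (cos (k * h) * f k)" for k
    using g_le[of k] by (simp add: algebra_simps)
  have "(LINT k|lborel. g k) \<le> (LINT k|lborel. 2 * (cos (k * 0) * f k) - 2 * (cos (k * h) * f k))"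
    by (rule integral_mono[OF ig _ le]) (intro Bochner_Integration.integrable_diff integrable_mult_right int)
  also have "\<dots> = 2 * (LINT k|lborel. cos (k * 0) * f k) - 2 * (LINT k|lborel. cos (k * h) * f k)"
    using Bochner_Integration.integral_diff[OF integrable_mult_right[OF int[of 0], of 2] integrable_mult_right[OF int[of h], of 2]]
    by (simp only: integral_mult_right_zero)
  also have "\<dots> = 2 * (LINT k|lborel. cos (k * 0) * f k) - (LINT k|lborel. cos (k * h) * f k) - (LINT k|lborel. cos (k * (- h)) * f k)"
    by simp
  finally show ?thesis using 1 h by (intro exI[of _ h]) auto
qed

section \<open>The solution in reversed time\<close>

lemma symbol_bound_subset: "symbol_bound P \<phi> f \<Longrightarrow> Q \<subseteq> P \<Longrightarrow> symbol_bound Q \<phi> f"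
  unfolding symbol_bound_def by (meson subsetD)

text \<open>By the mean value theorem \<open>f1\<close> is at most \<open>2 A / \<eta>\<close> in
  modulus somewhere in the interval, and from there to \<open>s\<close> it changes by at most
  \<open>\<eta> B\<close>. Time derivatives are thus bounded through the function and its second
  derivative, which the equation provides.\<close>

lemma first_derivative_bound:
  fixes f f1 f2 :: "real \<Rightarrow> real"
  assumes "\<eta> > 0"
    and d1: "\<And>r. s - \<eta> \<le> r \<Longrightarrow> r \<le> s \<Longrightarrow> (f has_real_derivative f1 r) (at r)"
    and d2: "\<And>r. s - \<eta> \<le> r \<Longrightarrow> r \<le> s \<Longrightarrow> (f1 has_real_derivative f2 r) (at r)"
    and bf: "\<And>r. s - \<eta> \<le> r \<Longrightarrow> r \<le> s \<Longrightarrow> \<bar>f r\<bar> \<le> A"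
    and bf2: "\<And>r. s - \<eta> \<le> r \<Longrightarrow> r \<le> s \<Longrightarrow> \<bar>f2 r\<bar> \<le> B"
  shows "\<bar>f1 s\<bar> \<le> 2 * A / \<eta> + \<eta> * B"
proof -
  obtain z where z: "s - \<eta> < z" "z < s" "f s - f (s - \<eta>) = (s - (s - \<eta>)) * f1 z"
    using MVT2[of "s - \<eta>" s f f1] d1 \<open>\<eta> > 0\<close> by auto
  obtain y where y: "z < y" "y < s" "f1 s - f1 z = (s - z) * f2 y"
    using MVT2[of z s f1 f2] d2 z by auto
  have "\<eta> * \<bar>f1 z\<bar> = \<bar>f s - f (s - \<eta>)\<bar>" using z \<open>\<eta> > 0\<close> by (simp add: abs_mult)
  also have "\<dots> \<le> 2 * A" using bf[of s] bf[of "s - \<eta>"] \<open>\<eta> > 0\<close> by linarith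
  finally have 1: "\<bar>f1 z\<bar> \<le> 2 * A / \<eta>" using \<open>\<eta> > 0\<close> by (simp add: pos_le_divide_eq mult.commute)
  have "\<bar>f1 s - f1 z\<bar> = (s - z) * \<bar>f2 y\<bar>" using y z by (simp add: abs_mult)
  also have "\<dots> \<le> \<eta> * B" using y z bf2[of y] by (intro mult_mono) auto
  finally show ?thesis using 1 by linarith
qed

text \<open>At \<open>s = 0\<close> the kernel is dominated by a multiple of
  \<open>exp (- \<bar>k\<bar> r)\<close>, and integrating in \<open>r\<close> gains
  \<open>1 / \<bar>k\<bar>\<close>. This gain makes the nonlinear term negligible against the linear
  one at high frequencies.\<close>

lemma duhamel_0_bound:
  assumes R: "\<And>\<tau>. \<bar>\<tau>\<bar> \<le> S \<Longrightarrow> \<bar>green k \<tau>\<bar> \<le> C * exp (- (\<bar>k\<bar> * \<bar>\<tau>\<bar>))" and "C \<ge> 0"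
    and g: "continuous_on {0..S} (g k)" "\<And>r. r \<in> {0..S} \<Longrightarrow> \<bar>g k r\<bar> \<le> B * wt k r"
    and "k \<noteq> 0" "S > 0" "B \<ge> 0"
  shows "\<bar>duhamel S g k 0\<bar> \<le> C * B / \<bar>k\<bar> * (1 / (1 + k\<^sup>2))"
proof -
  define D where "D = C * B * (1 / (1 + k\<^sup>2))"
  have D: "D \<ge> 0" unfolding D_def using \<open>C \<ge> 0\<close> \<open>B \<ge> 0\<close> one_plus_square_pos[of k] by simp
  have hi: "((\<lambda>r. exp (- (\<bar>k\<bar> * r))) has_integral (- exp (- (\<bar>k\<bar> * S)) / \<bar>k\<bar> - - exp (- (\<bar>k\<bar> * 0)) / \<bar>k\<bar>)) {0..S}"
  proof -
    have "((\<lambda>r. exp (- (c * r))) has_integral (- exp (- (c * S)) / c - - exp (- (c * 0)) / c)) {0..S}" if "c > 0" for c :: real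
      using that \<open>S > 0\<close>
      by (intro fundamental_theorem_of_calculus)
         (auto intro!: derivative_eq_intros simp flip: has_real_derivative_iff_has_vector_derivative)
    from this[of "\<bar>k\<bar>"] show ?thesis using \<open>k \<noteq> 0\<close> by simp
  qed
  have bd: "norm (green k (0 - r) * g k r) \<le> D * exp (- (\<bar>k\<bar> * r))" if r: "r \<in> {0..S}" for r
  proof -
    have "norm (green k (0 - r) * g k r) \<le> (C * exp (- (\<bar>k\<bar> * \<bar>0 - r\<bar>))) * (B * wt k r)"
      unfolding real_norm_def abs_mult using r \<open>C \<ge> 0\<close> by (intro mult_mono R g) auto
    also have "\<dots> \<le> (C * exp (- (\<bar>k\<bar> * \<bar>0 - r\<bar>))) * (B * (1 / (1 + k\<^sup>2)))"
      using r \<open>C \<ge> 0\<close> \<open>B \<ge> 0\<close> by (intro mult_left_mono wt_le) auto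
    finally show ?thesis using r by (simp add: D_def mult_ac)
  qed
  have "norm (duhamel S g k 0) \<le> integral {0..S} (\<lambda>r. D * exp (- (\<bar>k\<bar> * r)))"
    unfolding duhamel_def
    by (rule integral_norm_bound_integral[OF integrable_continuous_real[OF continuous_on_green_mult[where s = 0 and g = g and k = k, OF g(1)]] _ bd])
       (intro integrable_continuous_real continuous_intros)
  also have "\<dots> = D * (- exp (- (\<bar>k\<bar> * S)) / \<bar>k\<bar> - - exp (- (\<bar>k\<bar> * 0)) / \<bar>k\<bar>)"
    by (rule integral_unique[OF has_integral_mult_right[OF hi]])
  also have "\<dots> \<le> D * (1 / \<bar>k\<bar>)"
    using D by (intro mult_left_mono) (auto simp: field_simps)
  finally show ?thesis by (simp add: D_def mult.commute)
qed

text \<open>The interface to the blow-up argument, free of the frequency variable: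
  \<open>U i\<close>, \<open>V i\<close> and \<open>B i\<close> are the \<open>i\<close>-th
  \<open>x\<close>-derivatives of the solution, of its derivative in \<open>s\<close> and of its
  square. Decay is uniform only for \<open>s \<ge> \<eta>\<close>; at \<open>s = 0\<close> what is
  recorded is a pointwise limit of \<open>U 0\<close>.\<close>

lemma exists_transformed_solution:
  assumes S: "S > 0"
  obtains U V B :: "nat \<Rightarrow> real \<Rightarrow> real \<Rightarrow> real" and u\<^sub>0 :: "real \<Rightarrow> real" where
    "\<And>i. continuous_on (UNIV \<times> {0<..<S}) (\<lambda>(x, s). U i x s)"
    "\<And>i. continuous_on (UNIV \<times> {0<..<S}) (\<lambda>(x, s). V i x s)"
    "\<And>i x s. s \<in> {0<..<S} \<Longrightarrow> ((\<lambda>y. U i y s) has_real_derivative U (Suc i) x s) (at x)"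
    "\<And>i x s. s \<in> {0<..<S} \<Longrightarrow> ((\<lambda>y. V i y s) has_real_derivative V (Suc i) x s) (at x)"
    "\<And>i x s. s \<in> {0<..<S} \<Longrightarrow> ((\<lambda>y. B i y s) has_real_derivative B (Suc i) x s) (at x)"
    "\<And>i x s. s \<in> {0<..<S} \<Longrightarrow> (U i x has_real_derivative V i x s) (at s)"
    "\<And>i x s. s \<in> {0<..<S} \<Longrightarrow> (V i x has_real_derivative U (i + 4) x s + U (i + 2) x s + B (i + 2) x s) (at s)"
    "\<And>x s. s \<in> {0<..<S} \<Longrightarrow> B 0 x s = (U 0 x s)\<^sup>2"
    "\<And>i m \<eta>. \<eta> > 0 \<Longrightarrow> \<exists>C. \<forall>s\<in>{\<eta>..S}. \<forall>x. \<bar>x\<bar> ^ m * \<bar>U i x s\<bar> \<le> C"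
    "\<And>i m \<eta>. \<eta> > 0 \<Longrightarrow> \<exists>C. \<forall>s\<in>{\<eta>..S}. \<forall>x. \<bar>x\<bar> ^ m * \<bar>B i x s\<bar> \<le> C"
    "\<And>x. (U 0 x \<longlongrightarrow> u\<^sub>0 x) (at_right 0)"
    "\<And>C h0. C \<ge> 0 \<Longrightarrow> h0 > 0 \<Longrightarrow> \<exists>h. 0 < h \<and> h < h0 \<and> \<bar>u\<^sub>0 h + u\<^sub>0 (- h) - 2 * u\<^sub>0 0\<bar> > C * h\<^sup>2"
proof -
  obtain a :: "real \<Rightarrow> real \<Rightarrow> real" and \<epsilon> M C where
    C: "C \<ge> 0" and M: "M > 0" and \<epsilon>: "\<epsilon> > 0" and
    R: "\<And>k \<tau>. \<bar>\<tau>\<bar> \<le> S \<Longrightarrow> \<bar>green k \<tau>\<bar> \<le> C * exp (- (\<bar>k\<bar> * \<bar>\<tau>\<bar>))" and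
    CSM: "C * S * (M * (4 * quad_mass)) \<le> 1 / 4" and
    ca: "continuous_on (UNIV \<times> {0..S}) (\<lambda>(k, s). a k s)" and
    ev: "\<And>k s. a (- k) s = a k s" and
    ba: "\<And>k s. s \<in> {0..S} \<Longrightarrow> \<bar>a k s\<bar> \<le> M * wt k s" and
    eq: "\<And>k s. s \<in> {0..S} \<Longrightarrow> a k s = \<epsilon> * (green k s / (1 + k\<^sup>2))
        + duhamel S (\<lambda>k s. conv (\<lambda>k. a k s) (\<lambda>k. a k s) k) k s"
  proof (rule exists_profile[OF S], goal_cases)
    case (1 a \<epsilon> M C)
    show ?case by (rule that) (fact 1)+
  qed
  define q where "q = 4 * quad_mass"
  have q: "q \<ge> 0" using quad_mass_nonneg by (simp add: q_def)
  define b where "b k s = conv (\<lambda>k. a k s) (\<lambda>k. a k s) k" for k s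
  note usa = symbol_bound_profile(1)[OF S C M \<epsilon> R CSM ca ba eq]
  note usb = symbol_bound_profile(2)[OF S C M \<epsilon> R CSM ca ba eq, folded b_def]
  have ca_k: "continuous_on UNIV (\<lambda>k. a k s)" if "s \<in> {0..S}" for s
    using continuous_on_compose2[OF ca, of UNIV "\<lambda>k. (k, s)"] that
    by (auto simp: continuous_intros image_subset_iff)
  have ca_s: "continuous_on {0..S} (a k)" for k
    using continuous_on_compose2[OF ca, of "{0..S}" "\<lambda>s. (k, s)"] by (auto simp: continuous_intros)
  have cb: "continuous_on (UNIV \<times> {0..S}) (\<lambda>(k, s). b k s)"
    unfolding b_def by (rule continuous_on_conv[where A = M and B = M]) (use ca ba in auto)
  have cb_k: "continuous_on UNIV (\<lambda>k. b k s)" if "s \<in> {0..S}" for s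
    using continuous_on_compose2[OF cb, of UNIV "\<lambda>k. (k, s)"] that
    by (auto simp: continuous_intros image_subset_iff)
  have cb_s: "continuous_on {0..S} (b k)" for k
    using continuous_on_compose2[OF cb, of "{0..S}" "\<lambda>s. (k, s)"] by (auto simp: continuous_intros)
  have ma: "(\<lambda>k. a k s) \<in> borel_measurable borel" and mb: "(\<lambda>k. b k s) \<in> borel_measurable borel" if "s \<in> {0..S}" for s
    using ca_k[OF that] cb_k[OF that] by (auto intro: borel_measurable_continuous_onI)
  have bb: "\<bar>b k s\<bar> \<le> M * M * q * wt k s" if "s \<in> {0..S}" for k s
    unfolding b_def q_def by (rule conv_bound(2)) (use ma ba that in auto)
  have "\<exists>P1. \<forall>s\<in>{0<..<S}. (a k has_real_derivative P1 s) (at s) \<and>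
      (P1 has_real_derivative (k ^ 4 - k\<^sup>2) * a k s - k\<^sup>2 * b k s) (at s)" for k
  proof -
    obtain Q where Q: "\<And>s. s \<in> {0<..<S} \<Longrightarrow> (duhamel S b k has_real_derivative Q s) (at s)"
      "\<And>s. s \<in> {0<..<S} \<Longrightarrow> (Q has_real_derivative (k ^ 4 - k\<^sup>2) * duhamel S b k s - k\<^sup>2 * b k s) (at s)"
      using duhamel_ode[of S b k, OF cb_s S] by blast
    obtain R1 where R1: "\<And>s. s > 0 \<Longrightarrow> (green k has_real_derivative R1 s) (at s)"
      "\<And>s. s > 0 \<Longrightarrow> (R1 has_real_derivative (k ^ 4 - k\<^sup>2) * green k s) (at s)"
      using green_ode[of k] by blast
    have eq': "a k s = \<epsilon> / (1 + k\<^sup>2) * green k s + duhamel S b k s" if "s \<in> {0<..<S}" for s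
      using eq[of s k] that by (simp add: b_def [abs_def])
    show ?thesis
    proof (intro exI[of _ "\<lambda>s. \<epsilon> / (1 + k\<^sup>2) * R1 s + Q s"] ballI conjI)
      fix s assume s: "s \<in> {0<..<S}"
      then have "s > 0" by simp
      show "(a k has_real_derivative \<epsilon> / (1 + k\<^sup>2) * R1 s + Q s) (at s)"
        by (rule has_field_derivative_transform_within_open[OF DERIV_add[OF DERIV_cmult[OF R1(1)[OF \<open>s > 0\<close>]] Q(1)[OF s]], of "{0<..<S}"])
           (use s eq' in auto)
      show "((\<lambda>s. \<epsilon> / (1 + k\<^sup>2) * R1 s + Q s) has_real_derivative (k ^ 4 - k\<^sup>2) * a k s - k\<^sup>2 * b k s) (at s)"
        by (rule DERIV_cong[OF DERIV_add[OF DERIV_cmult[OF R1(2)[OF \<open>s > 0\<close>]] Q(2)[OF s]]])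
           (simp add: eq'[OF s] algebra_simps diff_divide_distrib)
    qed
  qed
  then obtain a1 where a1: "\<And>k s. s \<in> {0<..<S} \<Longrightarrow> (a k has_real_derivative a1 k s) (at s)"
    and a2: "\<And>k s. s \<in> {0<..<S} \<Longrightarrow> (a1 k has_real_derivative (k ^ 4 - k\<^sup>2) * a k s - k\<^sup>2 * b k s) (at s)"
    by metis
  define c2 where "c2 k s = (k ^ 4 - k\<^sup>2) * a k s - k\<^sup>2 * b k s" for k s
  have bc2: "\<bar>c2 k s\<bar> \<le> (2 * M + M * M * q) * (1 + \<bar>k\<bar>) ^ 4 * wt k s" if "s \<in> {0..S}" for k s
  proof -
    have k4: "k ^ 4 \<le> (1 + \<bar>k\<bar>) ^ 4" using power_mono[of "\<bar>k\<bar>" "1 + \<bar>k\<bar>" 4] by simp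
    have "k\<^sup>2 \<le> (1 + \<bar>k\<bar>)\<^sup>2" using power_mono[of "\<bar>k\<bar>" "1 + \<bar>k\<bar>" 2] by simp
    also have "\<dots> \<le> (1 + \<bar>k\<bar>) ^ 4" by (rule power_increasing) auto
    finally have k2: "k\<^sup>2 \<le> (1 + \<bar>k\<bar>) ^ 4" .
    have "\<bar>k ^ 4 - k\<^sup>2\<bar> \<le> 2 * (1 + \<bar>k\<bar>) ^ 4"
      using k4 k2 abs_triangle_ineq4[of "k ^ 4" "k\<^sup>2"] by simp
    then have 1: "\<bar>(k ^ 4 - k\<^sup>2) * a k s\<bar> \<le> (2 * (1 + \<bar>k\<bar>) ^ 4) * (M * wt k s)"
      unfolding abs_mult by (intro mult_mono ba[OF that]) auto
    have 2: "\<bar>k\<^sup>2 * b k s\<bar> \<le> (1 + \<bar>k\<bar>) ^ 4 * (M * M * q * wt k s)"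
      unfolding abs_mult using k2 by (intro mult_mono bb[OF that]) auto
    have "\<bar>c2 k s\<bar> \<le> (2 * (1 + \<bar>k\<bar>) ^ 4) * (M * wt k s) + (1 + \<bar>k\<bar>) ^ 4 * (M * M * q * wt k s)"
      unfolding c2_def using 1 2 by linarith
    then show ?thesis by (simp add: algebra_simps)
  qed
  define B2 where "B2 = 2 * M + M * M * q"
  have B2: "B2 \<ge> 0" using M q by (simp add: B2_def)
  \<comment> \<open>The interpolation looks back over \<open>{s - \<eta>..s}\<close>; with
    \<open>s > 2 \<eta>\<close> this stays at times at least \<open>\<eta>\<close>, where
    \<open>wt k \<eta>\<close> dominates the weight.\<close>
  have ba1: "\<bar>a1 k s\<bar> \<le> (2 * M / \<eta> + \<eta> * B2) * (1 + \<bar>k\<bar>) ^ 4 * wt k \<eta>"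
    if "\<eta> > 0" "s \<in> {2 * \<eta><..<S}" for k s \<eta>
  proof -
    have "\<bar>a1 k s\<bar> \<le> 2 * (M * wt k \<eta>) / \<eta> + \<eta> * (B2 * (1 + \<bar>k\<bar>) ^ 4 * wt k \<eta>)"
    proof (rule first_derivative_bound[where f = "a k" and ?f1.0 = "a1 k" and ?f2.0 = "c2 k", OF \<open>\<eta> > 0\<close>])
      fix r assume r: "s - \<eta> \<le> r" "r \<le> s"
      then have r': "r \<in> {0<..<S}" "r \<in> {0..S}" "\<eta> \<le> r" using that by auto
      show "(a k has_real_derivative a1 k r) (at r)" by (rule a1[OF r'(1)])
      show "(a1 k has_real_derivative c2 k r) (at r)" unfolding c2_def by (rule a2[OF r'(1)])
      show "\<bar>a k r\<bar> \<le> M * wt k \<eta>"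
        using ba[OF r'(2), of k] mult_left_mono[OF wt_antimono[OF r'(3), of k], of M] M by linarith
      have "B2 * (1 + \<bar>k\<bar>) ^ 4 * wt k r \<le> B2 * (1 + \<bar>k\<bar>) ^ 4 * wt k \<eta>"
        using B2 by (intro mult_left_mono wt_antimono r') auto
      then show "\<bar>c2 k r\<bar> \<le> B2 * (1 + \<bar>k\<bar>) ^ 4 * wt k \<eta>"
        using bc2[OF r'(2), of k] by (simp add: B2_def)
    qed
    also have "2 * (M * wt k \<eta>) / \<eta> \<le> 2 * M / \<eta> * (1 + \<bar>k\<bar>) ^ 4 * wt k \<eta>"
    proof -
      have "1 \<le> (1 + \<bar>k\<bar>) ^ 4" by (rule one_le_power) simp
      then have "2 * M / \<eta> * 1 * wt k \<eta> \<le> 2 * M / \<eta> * (1 + \<bar>k\<bar>) ^ 4 * wt k \<eta>"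
        using M that less_imp_le[OF wt_pos[of k \<eta>]] by (intro mult_right_mono mult_left_mono) auto
      then show ?thesis by simp
    qed
    finally show ?thesis by (simp add: algebra_simps)
  qed
  \<comment> \<open>Time windows away from 0: their openness serves differentiation in
    \<open>s\<close>, the gap serves decay in \<open>k\<close>. Each \<open>s\<close> lies in the
    window of \<open>s / 4\<close>, so they exhaust \<open>{0<..<S}\<close>.\<close>
  define P where "P \<eta> = {2 * \<eta><..<S}" for \<eta>
  have PS: "s \<in> {0<..<S}" "s \<in> {0..S}" "\<eta> \<le> s" if "s \<in> P \<eta>" "\<eta> > 0" for s \<eta>
    using that by (auto simp: P_def)
  have oP: "open (P \<eta>)" for \<eta> by (simp add: P_def)
  have inP: "s \<in> P (s / 4)" "s / 4 > 0" if "s \<in> {0<..<S}" for s using that by (auto simp: P_def)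
  have dec: "\<exists>C. \<forall>s\<in>P \<eta>. \<forall>k. (1 + \<bar>k\<bar>) ^ n * \<bar>g k s\<bar> \<le> C * (1 / (1 + k\<^sup>2))"
    if "\<eta> > 0" and g: "\<And>k s. s \<in> {0..S} \<Longrightarrow> \<bar>g k s\<bar> \<le> D * (1 + \<bar>k\<bar>) ^ j * wt k s" and "D \<ge> 0" for n \<eta> g D j
  proof (rule poly_wt_decay[OF \<open>\<eta> > 0\<close>])
    fix s k assume "s \<in> P \<eta>"
    note s = PS[OF this \<open>\<eta> > 0\<close>]
    have "D * (1 + \<bar>k\<bar>) ^ j * wt k s \<le> D * (1 + \<bar>k\<bar>) ^ j * wt k \<eta>"
      using \<open>D \<ge> 0\<close> by (intro mult_left_mono wt_antimono s) auto
    then show "\<bar>g k s\<bar> \<le> D * (1 + \<bar>k\<bar>) ^ j * wt k \<eta>" using g[OF s(2), of k] by linarith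
  qed
  have ra: "rapid (P \<eta>) a" if "\<eta> > 0" for \<eta>
    unfolding rapid_def using ma PS that dec[where g = a and D = M and j = 0, OF that] ba M by auto
  have rb: "rapid (P \<eta>) b" if "\<eta> > 0" for \<eta>
    unfolding rapid_def using mb PS that dec[where g = b and D = "M * M * q" and j = 0, OF that] bb M q by auto
  have da1: "\<exists>C. \<forall>s\<in>P \<eta>. \<forall>k. (1 + \<bar>k\<bar>) ^ n * \<bar>a1 k s\<bar> \<le> C * (1 / (1 + k\<^sup>2))" if "\<eta> > 0" for n \<eta>
    by (rule poly_wt_decay[OF that]) (use ba1[OF that] in \<open>auto simp: P_def\<close>)
  have dc2: "\<exists>C. \<forall>s\<in>P \<eta>. \<forall>k. (1 + \<bar>k\<bar>) ^ n * \<bar>c2 k s\<bar> \<le> C * (1 / (1 + k\<^sup>2))" if "\<eta> > 0" for n \<eta>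
    by (rule dec[OF that bc2[folded B2_def] B2])
  have Us: "(cos_transform i a x has_real_derivative cos_transform i a1 x s) (at s)" if "s \<in> {0<..<S}" for i x s
    by (rule cos_transform_DERIV_s(1)[OF ra[OF inP(2)[OF that]] da1[OF inP(2)[OF that]] oP inP(1)[OF that]])
       (rule a1[OF PS(1)[OF _ inP(2)[OF that]]])
  have ma1: "(\<lambda>k. a1 k s) \<in> borel_measurable borel" if "s \<in> {0<..<S}" for s
    by (rule cos_transform_DERIV_s(2)[OF ra[OF inP(2)[OF that]] da1[OF inP(2)[OF that]] oP inP(1)[OF that]])
       (rule a1[OF PS(1)[OF _ inP(2)[OF that]]])
  have ra1: "rapid (P \<eta>) a1" if "\<eta> > 0" for \<eta>
    unfolding rapid_def using ma1 PS that da1[OF that] by auto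
  have Vs: "(cos_transform i a1 x has_real_derivative cos_transform (i + 4) a x s + cos_transform (i + 2) a x s + cos_transform (i + 2) b x s) (at s)"
    if s: "s \<in> {0<..<S}" for i x s
  proof -
    have "(cos_transform i a1 x has_real_derivative cos_transform i c2 x s) (at s)"
      by (rule cos_transform_DERIV_s(1)[OF ra1[OF inP(2)[OF s]] dc2[OF inP(2)[OF s]] oP inP(1)[OF s]])
         (unfold c2_def, rule a2[OF PS(1)[OF _ inP(2)[OF s]]])
    then show ?thesis
      unfolding c2_def [abs_def] cos_transform_symbol[OF ra[OF inP(2)[OF s]] rb[OF inP(2)[OF s]] inP(1)[OF s]] .
  qed
  have cont: "continuous_on (UNIV \<times> {0<..<S}) (\<lambda>(x, s). cos_transform i g x s)"
    if r: "\<And>\<eta>. \<eta> > 0 \<Longrightarrow> rapid (P \<eta>) g" and c: "\<And>k s. s \<in> {0<..<S} \<Longrightarrow> isCont (g k) s" for i g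
  proof -
    have un: "UNIV \<times> {0<..<S} = (\<Union>\<eta>\<in>{0<..}. (UNIV :: real set) \<times> P \<eta>)"
    proof (intro set_eqI iffI)
      fix z :: "real \<times> real" assume "z \<in> UNIV \<times> {0<..<S}"
      then have "snd z \<in> {0<..<S}" by (simp add: mem_Times_iff)
      from inP[OF this] show "z \<in> (\<Union>\<eta>\<in>{0<..}. UNIV \<times> P \<eta>)"
        by (intro UN_I[of "snd z / 4"]) (simp_all add: mem_Times_iff)
    next
      fix z :: "real \<times> real" assume "z \<in> (\<Union>\<eta>\<in>{0<..}. UNIV \<times> P \<eta>)"
      then obtain \<eta> where "\<eta> > 0" "snd z \<in> P \<eta>" by (auto simp: mem_Times_iff)
      from PS(1)[OF this(2,1)] show "z \<in> UNIV \<times> {0<..<S}" by (simp add: mem_Times_iff)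
    qed
    have "continuous_on (UNIV \<times> P \<eta>) (\<lambda>(x, s). cos_transform i g x s)" if "\<eta> > 0" for \<eta>
      by (rule cos_transform_continuous[OF r[OF that]]) (rule continuous_at_imp_continuous_on, rule ballI, rule c, rule PS(1)[OF _ that])
    then show ?thesis
      unfolding un by (intro continuous_on_open_UN ballI open_Times oP open_UNIV) simp
  qed
  have decay: "\<exists>C. \<forall>s\<in>{\<eta>..S}. \<forall>x. \<bar>x\<bar> ^ m * \<bar>cos_transform i g x s\<bar> \<le> C"
    if us: "symbol_bound {0..S} (\<lambda>s k. wt k s) (\<lambda>s k. g k s)" and pos: "\<eta> > 0" and mg: "\<And>s. s \<in> {0..S} \<Longrightarrow> (\<lambda>k. g k s) \<in> borel_measurable borel"
    for i m \<eta> g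
  proof -
    have "symbol_bound {\<eta>..S} (\<lambda>s k. wt k s) (\<lambda>s k. g k s)" by (rule symbol_bound_subset[OF us]) (use pos in auto)
    then obtain C where "\<And>s x. s \<in> {\<eta>..S} \<Longrightarrow> \<bar>x\<bar> ^ m * \<bar>cos_transform i g x s\<bar> \<le> C"
      by (rule cos_transform_decay[where \<eta> = \<eta> and S = S]) (use pos mg in auto)
    then show ?thesis by blast
  qed
  define f where "f k = a k 0" for k
  define u\<^sub>0 where "u\<^sub>0 x = (LINT k|lborel. cos (k * x) * f k)" for x
  have bf: "\<bar>f k\<bar> \<le> M * (1 / (1 + k\<^sup>2))" for k
    using ba[of 0 k] S by (simp add: f_def wt_def)
  have lim: "(cos_transform 0 a x \<longlongrightarrow> u\<^sub>0 x) (at_right 0)" for x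
  proof -
    \<comment> \<open>Without \<open>x\<close>-derivatives the majorant
      \<open>M / (1 + k\<^sup>2)\<close> is valid down to \<open>s = 0\<close>, so the transform is
      continuous there.\<close>
    have "continuous_on {0..S} (\<lambda>s. LINT k|lborel. cos (k * x) * a k s)"
    proof (rule continuous_on_LINT)
      show "continuous_on {0..S} (\<lambda>s. cos (k * x) * a k s)" for k
        by (intro continuous_intros ca_s)
      show "(\<lambda>k. cos (k * x) * a k s) \<in> borel_measurable lborel" if "s \<in> {0..S}" for s
        using ma[OF that] by measurable
      show "integrable lborel (\<lambda>k. M * (1 / (1 + k\<^sup>2)))"
        by (intro integrable_mult_right integrable_inverse_quadratic)
      fix s k assume s: "s \<in> {0..S}"
      have "\<bar>cos (k * x) * a k s\<bar> \<le> 1 * \<bar>a k s\<bar>" unfolding abs_mult by (intro mult_right_mono) auto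
      also have "\<dots> \<le> M * (1 / (1 + k\<^sup>2))"
        using ba[OF s, of k] mult_left_mono[OF wt_le[of s k], of M] s M by auto
      finally show "\<bar>cos (k * x) * a k s\<bar> \<le> M * (1 / (1 + k\<^sup>2))" .
    qed
    then have "((\<lambda>s. LINT k|lborel. cos (k * x) * a k s) \<longlongrightarrow> u\<^sub>0 x) (at 0 within {0..S})"
      using S unfolding continuous_on_def u\<^sub>0_def f_def by auto
    then show ?thesis using S by (simp add: at_within_Icc_at_right cos_transform_def [abs_def])
  qed
  have sq: "cos_transform 0 b x s = (cos_transform 0 a x s)\<^sup>2" if s: "s \<in> {0<..<S}" for x s
  proof -
    have "integrable lborel (\<lambda>k. a k s)"
      using cos_transform_integrable[OF ra[OF inP(2)[OF s]] inP(1)[OF s], of 0 0 0] by simp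
    from LINT_cos_conv[OF this ev, of x] show ?thesis by (simp add: cos_transform_def b_def)
  qed
  define c0 where "c0 = exp (-1) / (2 * hgauss_lim)"
  have c0: "c0 > 0" unfolding c0_def using hgauss_lim_pos by simp
  \<comment> \<open>From this frequency on the nonlinear term is at most half of the lower bound
    \<open>\<epsilon> c0 / (1 + k\<^sup>2)\<close> for the linear one.\<close>
  define K where "K = max 1 (2 * (C * (M * M * q)) / (\<epsilon> * c0))"
  have K1: "K \<ge> 1" by (simp add: K_def)
  have low: "f k \<ge> \<epsilon> * c0 / 2 * (1 / (1 + k\<^sup>2))" if k: "\<bar>k\<bar> \<ge> K" for k
  proof -
    have k1: "\<bar>k\<bar> \<ge> 1" using k by (simp add: K_def)
    have i0: "1 / (1 + k\<^sup>2) \<ge> 0" using one_plus_square_pos[of k] by simp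
    have "\<epsilon> * c0 * (1 / (1 + k\<^sup>2)) \<le> \<epsilon> * green k 0 * (1 / (1 + k\<^sup>2))"
      using green_0_ge[OF k1] \<epsilon> i0 by (intro mult_right_mono mult_left_mono) (auto simp: c0_def)
    moreover have "\<bar>duhamel S b k 0\<bar> \<le> C * (M * M * q) / \<bar>k\<bar> * (1 / (1 + k\<^sup>2))"
      by (rule duhamel_0_bound[OF R C cb_s bb]) (use k1 S M q in auto)
    moreover have "C * (M * M * q) / \<bar>k\<bar> * (1 / (1 + k\<^sup>2)) \<le> \<epsilon> * c0 / 2 * (1 / (1 + k\<^sup>2))"
    proof (rule mult_right_mono[OF _ i0])
      have "2 * (C * (M * M * q)) / (\<epsilon> * c0) \<le> \<bar>k\<bar>" using k by (simp add: K_def)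
      then have "2 * (C * (M * M * q)) \<le> \<bar>k\<bar> * (\<epsilon> * c0)" using \<epsilon> c0 by (simp add: pos_divide_le_eq)
      moreover have "\<bar>k\<bar> > 0" using k1 by linarith
      ultimately show "C * (M * M * q) / \<bar>k\<bar> \<le> \<epsilon> * c0 / 2" by (simp add: pos_divide_le_eq mult_ac)
    qed
    moreover have "f k = \<epsilon> * green k 0 * (1 / (1 + k\<^sup>2)) + duhamel S b k 0"
      using eq[of 0 k] S by (simp add: f_def b_def [abs_def])
    moreover have "\<epsilon> * c0 * (1 / (1 + k\<^sup>2)) = 2 * (\<epsilon> * c0 / 2 * (1 / (1 + k\<^sup>2)))"
    proof -
      have "x * y = 2 * (x / 2 * y)" for x y :: real by simp
      then show ?thesis .
    qed
    ultimately show ?thesis by linarith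
  qed
  show ?thesis
  proof (rule that[of "\<lambda>i. cos_transform i a" "\<lambda>i. cos_transform i a1" "\<lambda>i. cos_transform i b" u\<^sub>0])
    show "continuous_on (UNIV \<times> {0<..<S}) (\<lambda>(x, s). cos_transform i a x s)" for i
      by (rule cont) (use ra a1 in \<open>auto intro: DERIV_isCont\<close>)
    show "continuous_on (UNIV \<times> {0<..<S}) (\<lambda>(x, s). cos_transform i a1 x s)" for i
      by (rule cont) (use ra1 a2 in \<open>auto intro: DERIV_isCont\<close>)
    show "\<exists>h. 0 < h \<and> h < h0 \<and> \<bar>u\<^sub>0 h + u\<^sub>0 (- h) - 2 * u\<^sub>0 0\<bar> > C' * h\<^sup>2" if "C' \<ge> 0" "h0 > 0" for C' h0
      unfolding u\<^sub>0_def
      by (rule second_difference_unbounded[OF _ bf _ _ _ low])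
         (use ma[of 0] S M \<epsilon> c0 K1 that in \<open>auto simp: f_def [abs_def]\<close>)
    show "((\<lambda>y. cos_transform i a y s) has_real_derivative cos_transform (Suc i) a x s) (at x)" if "s \<in> {0<..<S}" for i x s
      by (rule cos_transform_DERIV_x[OF ra[OF inP(2)[OF that]] inP(1)[OF that]])
    show "((\<lambda>y. cos_transform i a1 y s) has_real_derivative cos_transform (Suc i) a1 x s) (at x)" if "s \<in> {0<..<S}" for i x s
      by (rule cos_transform_DERIV_x[OF ra1[OF inP(2)[OF that]] inP(1)[OF that]])
    show "((\<lambda>y. cos_transform i b y s) has_real_derivative cos_transform (Suc i) b x s) (at x)" if "s \<in> {0<..<S}" for i x s
      by (rule cos_transform_DERIV_x[OF rb[OF inP(2)[OF that]] inP(1)[OF that]])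
    show "\<exists>C. \<forall>s\<in>{\<eta>..S}. \<forall>x. \<bar>x\<bar> ^ m * \<bar>cos_transform i a x s\<bar> \<le> C" if "\<eta> > 0" for i m \<eta>
      by (rule decay[OF usa that ma])
    show "\<exists>C. \<forall>s\<in>{\<eta>..S}. \<forall>x. \<bar>x\<bar> ^ m * \<bar>cos_transform i b x s\<bar> \<le> C" if "\<eta> > 0" for i m \<eta>
      by (rule decay[OF usb that mb])
  qed (fact Us Vs sq lim)+
qed

section \<open>Smoothness and blow-up\<close>

lemma at_within_atLeast_not_bot:
  assumes "0 \<le> (t::real)"
  shows "at t within {0..} \<noteq> bot"
proof -
  have "at_right t \<le> at t within {0..}" using assms by (intro at_le) auto
  then show ?thesis by (metis bot.extremum_uniqueI trivial_limit_at_right_real)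
qed

lemma has_vector_derivative_strip_cong:
  fixes f g :: "real \<Rightarrow> real"
  assumes "0 \<le> t" "t < T" and eq: "\<And>s. 0 \<le> s \<Longrightarrow> s < T \<Longrightarrow> f s = g s"
    and f: "(f has_vector_derivative D) (at t within {0..})"
  shows "(g has_vector_derivative D) (at t within {0..})"
  using f unfolding has_vector_derivative_def
  by (rule has_derivative_transform_within[where d = "T - t"]) (use assms in \<open>auto simp: dist_real_def\<close>)

lemma has_vector_derivative_strip_iff:
  fixes f g :: "real \<Rightarrow> real"
  assumes "0 \<le> t" "t < T" and "\<And>s. 0 \<le> s \<Longrightarrow> s < T \<Longrightarrow> f s = g s"
  shows "(f has_vector_derivative D) (at t within {0..}) \<longleftrightarrow> (g has_vector_derivative D) (at t within {0..})"
  using has_vector_derivative_strip_cong[of t T f g] has_vector_derivative_strip_cong[of t T g f] assms by metis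

lemma Dt_cong:
  assumes "\<And>x t. t \<in> {0..<T} \<Longrightarrow> u x t = v x t" and "t \<in> {0..<T}"
  shows "Dt u x t = Dt v x t"
  unfolding Dt_def vector_derivative_def
  using has_vector_derivative_strip_iff[of t T "\<lambda>s. u x s" "\<lambda>s. v x s"] assms by simp

lemma Dx_cong:
  assumes "\<And>x t. t \<in> {0..<T} \<Longrightarrow> u x t = v x t" and "t \<in> {0..<T}"
  shows "Dx u x t = Dx v x t"
  unfolding Dx_def using assms by simp

text \<open>Formulas for \<open>Dx\<close> and \<open>Dt\<close> hold only for \<open>t\<close> in
  \<open>{0..<T}\<close>, while both operators produce total functions. Smoothness must therefore
  pass between functions that agree on the strip.\<close>

lemma Ck_on_cong:
  assumes "\<And>x t. t \<in> {0..<T} \<Longrightarrow> u x t = v x t" and "Ck_on T k u"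
  shows "Ck_on T k v"
  using assms
proof (induction k arbitrary: u v)
  have cont: "continuous_on (UNIV \<times> {0..<T}) (\<lambda>(x, t). v x t)"
    if "\<And>x t. t \<in> {0..<T} \<Longrightarrow> u x t = v x t" "continuous_on (UNIV \<times> {0..<T}) (\<lambda>(x, t). u x t)" for u v
    using that(2) by (rule continuous_on_eq) (use that(1) in auto)
  {
    case 0
    then show ?case using cont[of u v] by simp
  next
    case (Suc k)
    have "(\<lambda>s. v x s) differentiable (at t within {0..})"
      if "t \<in> {0..<T}" "(\<lambda>s. u x s) differentiable (at t within {0..})" for x t
    proof -
      from that(2) have "((\<lambda>s. u x s) has_vector_derivative vector_derivative (u x) (at t within {0..})) (at t within {0..})"
        by (simp add: vector_derivative_works)
      then have "((\<lambda>s. v x s) has_vector_derivative vector_derivative (u x) (at t within {0..})) (at t within {0..})"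
        by (rule has_vector_derivative_strip_cong[rotated 3, where T = T]) (use that Suc.prems(1) in auto)
      then show ?thesis by (rule differentiableI_vector)
    qed
    moreover have "(\<lambda>y. v y t) = (\<lambda>y. u y t)" if "t \<in> {0..<T}" for t
      using Suc.prems(1)[OF that] by simp
    moreover have "Ck_on T k (Dx v)" "Ck_on T k (Dt v)"
      by (rule Suc.IH[of "Dx u"] Suc.IH[of "Dt u"]; use Suc.prems Dx_cong[of T u v] Dt_cong[of T u v] in auto)+
    ultimately show ?case using Suc.prems cont[of u v] by simp
  }
qed

text \<open>The second time derivative contains derivatives of \<open>u\<^sup>2\<close>, so mixed
  derivatives of the solution are in general not single functions \<open>U i\<close> or
  \<open>V i\<close> but polynomials in them. An algebra closed under both derivatives turns
  smoothness into one induction on the order.\<close>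

inductive_set function_algebra :: "(real \<Rightarrow> real \<Rightarrow> real) set \<Rightarrow> (real \<Rightarrow> real \<Rightarrow> real) set" for G where
  gen: "g \<in> G \<Longrightarrow> g \<in> function_algebra G"
| add: "p \<in> function_algebra G \<Longrightarrow> q \<in> function_algebra G \<Longrightarrow> (\<lambda>x t. p x t + q x t) \<in> function_algebra G"
| mult: "p \<in> function_algebra G \<Longrightarrow> q \<in> function_algebra G \<Longrightarrow> (\<lambda>x t. p x t * q x t) \<in> function_algebra G"

text \<open>\<open>f\<close>, \<open>z\<close> and \<open>F\<close> abstract from which variable
  moves and which is frozen, so that the sum and product rules are carried out once for
  \<open>x\<close> and \<open>t\<close>.\<close>

lemma function_algebra_deriv:
  assumes gen: "\<And>g. g \<in> G \<Longrightarrow> \<exists>q\<in>function_algebra G. \<forall>x. \<forall>t\<in>I. (f g x t has_real_derivative q x t) (F x t)"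
    and f_add: "\<And>p q x t. f (\<lambda>x t. p x t + q x t) x t = (\<lambda>y. f p x t y + f q x t y)"
    and f_mult: "\<And>p q x t. f (\<lambda>x t. p x t * q x t) x t = (\<lambda>y. f p x t y * f q x t y)"
    and F: "\<And>x t. F x t = at (z x t) within Z" and val: "\<And>p x t. f p x t (z x t) = p x t"
    and "p \<in> function_algebra G"
  shows "\<exists>q\<in>function_algebra G. \<forall>x. \<forall>t\<in>I. (f p x t has_real_derivative q x t) (F x t)"
  using assms(6)
proof induction
  case (add p q)
  then obtain p' q' where "p' \<in> function_algebra G" "q' \<in> function_algebra G"
    "\<And>x t. t \<in> I \<Longrightarrow> (f p x t has_real_derivative p' x t) (F x t)"
    "\<And>x t. t \<in> I \<Longrightarrow> (f q x t has_real_derivative q' x t) (F x t)" by blast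
  then show ?case
    unfolding f_add F
    by (intro bexI[of _ "\<lambda>x t. p' x t + q' x t"] function_algebra.add) (auto intro!: DERIV_add)
next
  case (mult p q)
  then obtain p' q' where *: "p' \<in> function_algebra G" "q' \<in> function_algebra G"
    "\<And>x t. t \<in> I \<Longrightarrow> (f p x t has_real_derivative p' x t) (F x t)"
    "\<And>x t. t \<in> I \<Longrightarrow> (f q x t has_real_derivative q' x t) (F x t)" by blast
  show ?case
  proof (intro bexI[of _ "\<lambda>x t. p' x t * q x t + q' x t * p x t"] allI ballI)
    show "(\<lambda>x t. p' x t * q x t + q' x t * p x t) \<in> function_algebra G"
      by (intro function_algebra.add function_algebra.mult * mult)
    fix x t assume "t \<in> I"
    from DERIV_mult'[OF *(3,4)[OF this, unfolded F]]
    show "(f (\<lambda>x t. p x t * q x t) x t has_real_derivative p' x t * q x t + q' x t * p x t) (F x t)"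
      unfolding f_mult F val by (simp add: algebra_simps)
  qed
qed (rule gen)

lemma function_algebra_Ck_on:
  assumes cont: "\<And>g. g \<in> G \<Longrightarrow> continuous_on (UNIV \<times> {0..<T}) (\<lambda>(x, t). g x t)"
    and dx: "\<And>p. p \<in> function_algebra G \<Longrightarrow>
      \<exists>q\<in>function_algebra G. \<forall>x. \<forall>t\<in>{0..<T}. ((\<lambda>y. p y t) has_real_derivative q x t) (at x)"
    and dt: "\<And>p. p \<in> function_algebra G \<Longrightarrow>
      \<exists>q\<in>function_algebra G. \<forall>x. \<forall>t\<in>{0..<T}. ((\<lambda>s. p x s) has_real_derivative q x t) (at t within {0..})"
    and p: "p \<in> function_algebra G"
  shows "Ck_on T k p"
  using p
proof (induction k arbitrary: p)
  have cont': "continuous_on (UNIV \<times> {0..<T}) (\<lambda>(x, t). p x t)" if "p \<in> function_algebra G" for p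
    using that
    by induction (use cont in \<open>auto simp: case_prod_unfold intro!: continuous_intros\<close>)
  {
    case 0
    then show ?case using cont' by simp
  next
    case (Suc k)
    obtain px where px: "px \<in> function_algebra G"
      "\<And>x t. t \<in> {0..<T} \<Longrightarrow> ((\<lambda>y. p y t) has_real_derivative px x t) (at x)" using dx[OF Suc.prems] by blast
    obtain pt where pt: "pt \<in> function_algebra G"
      "\<And>x t. t \<in> {0..<T} \<Longrightarrow> ((\<lambda>s. p x s) has_real_derivative pt x t) (at t within {0..})" using dt[OF Suc.prems] by blast
    have Dx: "px x t = Dx p x t" if "t \<in> {0..<T}" for x t
      using px(2)[OF that, of x] by (simp add: Dx_def DERIV_imp_deriv)
    have Dt: "pt x t = Dt p x t" if "t \<in> {0..<T}" for x t
    proof -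
      have "at t within {0..} \<noteq> bot" using that by (intro at_within_atLeast_not_bot) simp
      then show ?thesis
        using pt(2)[OF that, of x] vector_derivative_within
        unfolding Dt_def has_real_derivative_iff_has_vector_derivative by metis
    qed
    have "Ck_on T k (Dx p)" by (rule Ck_on_cong[OF Dx Suc.IH[OF px(1)]])
    moreover have "Ck_on T k (Dt p)" by (rule Ck_on_cong[OF Dt Suc.IH[OF pt(1)]])
    ultimately show ?case
      using cont'[OF Suc.prems] px(2) pt(2) unfolding Ck_on.simps real_differentiable_def by blast
  }
qed

section \<open>Schwartz data and second differences of smooth functions\<close>

lemma schwartzI:
  fixes F :: "nat \<Rightarrow> real \<Rightarrow> real"
  assumes der: "\<And>i x. (F i has_real_derivative F (Suc i) x) (at x)"
    and dec: "\<And>i m. \<exists>C. \<forall>x. \<bar>x\<bar> ^ m * \<bar>F i x\<bar> \<le> C"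
  shows "schwartz (F 0)"
proof -
  have "deriv (F i) = F (Suc i)" for i using der[of i] by (auto intro!: DERIV_imp_deriv)
  then have pow: "(deriv ^^ n) (F 0) = F n" for n by (induction n) auto
  show ?thesis
    unfolding schwartz_def pow
  proof (intro conjI allI)
    show "F n differentiable (at x)" for n x using der[of n x] by (auto simp: real_differentiable_def)
    show "bounded (range (\<lambda>x. x ^ m * F n x))" for m n
      using dec[of m n] unfolding bounded_iff by (auto simp: abs_mult power_abs)
  qed
qed

lemma power_one_plus_le:
  assumes "x \<ge> (0::real)"
  shows "(1 + x) ^ n \<le> 2 ^ n * (1 + x ^ n)"
proof -
  have "(1 + x) ^ n \<le> (2 * max 1 x) ^ n" using assms by (intro power_mono) auto
  also have "\<dots> = 2 ^ n * (max 1 x) ^ n" by (rule power_mult_distrib)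
  also have "(max 1 x) ^ n \<le> 1 + x ^ n" using assms by (cases "x \<le> 1") (auto simp: max_def)
  finally show ?thesis by simp
qed

text \<open>Differentiability of \<open>deriv g\<close> at 0 gives \<open>\<bar>deriv g y - deriv g
  0\<bar> \<le> (\<bar>L\<bar> + 1) \<bar>y\<bar>\<close> nearby, and the mean value theorem is
  applied to \<open>g y + g (- y) - 2 g 0\<close>. This is the property that the limit profile
  violates.\<close>

lemma second_difference_bounded:
  fixes g :: "real \<Rightarrow> real"
  assumes g: "\<And>x. g differentiable (at x)" and g': "(deriv g) differentiable (at 0)"
  shows "\<exists>C\<ge>0. \<exists>h0>0. \<forall>h. 0 < h \<longrightarrow> h < h0 \<longrightarrow> \<bar>g h + g (- h) - 2 * g 0\<bar> \<le> C * h\<^sup>2"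
proof -
  have dg: "(g has_real_derivative deriv g x) (at x)" for x
    using g[of x] by (simp add: real_differentiable_def) (metis DERIV_imp_deriv)
  obtain L where L: "(deriv g has_real_derivative L) (at 0)"
    using g' by (auto simp: real_differentiable_def)
  then have "((\<lambda>y. (deriv g y - deriv g 0) / (y - 0)) \<longlongrightarrow> L) (at 0)"
    by (simp only: has_field_derivative_iff)
  from tendstoD[OF this, of 1] obtain h0 where h0: "h0 > 0"
    "\<And>y. y \<noteq> 0 \<Longrightarrow> \<bar>y\<bar> < h0 \<Longrightarrow> \<bar>(deriv g y - deriv g 0) / y - L\<bar> < 1"
    unfolding eventually_at by (auto simp: dist_real_def)
  have lip: "\<bar>deriv g y - deriv g 0\<bar> \<le> (\<bar>L\<bar> + 1) * \<bar>y\<bar>" if "y \<noteq> 0" "\<bar>y\<bar> < h0" for y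
  proof -
    have "\<bar>(deriv g y - deriv g 0) / y\<bar> \<le> \<bar>L\<bar> + 1" using h0(2)[OF that] by linarith
    then show ?thesis using that by (simp add: pos_divide_le_eq)
  qed
  have "\<bar>g h + g (- h) - 2 * g 0\<bar> \<le> 2 * (\<bar>L\<bar> + 1) * h\<^sup>2" if h: "0 < h" "h < h0" for h
  proof -
    let ?\<phi> = "\<lambda>y. g y + g (- y) - 2 * g 0"
    have "\<exists>z. 0 < z \<and> z < h \<and> ?\<phi> h - ?\<phi> 0 = (h - 0) * (deriv g z - deriv g (- z))"
    proof (rule MVT2[OF h(1)])
      fix y
      have "((\<lambda>y. g (- y)) has_real_derivative deriv g (- y) * (- 1)) (at y)"
        by (rule DERIV_chain2[OF dg]) (auto intro!: derivative_eq_intros)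
      then show "(?\<phi> has_real_derivative deriv g y - deriv g (- y)) (at y)"
        by (auto intro!: derivative_eq_intros dg)
    qed
    then obtain z where z: "0 < z" "z < h" "?\<phi> h = h * (deriv g z - deriv g (- z))" by auto
    have "\<bar>deriv g z - deriv g (- z)\<bar> \<le> \<bar>deriv g z - deriv g 0\<bar> + \<bar>deriv g (- z) - deriv g 0\<bar>" by linarith
    also have "\<dots> \<le> (\<bar>L\<bar> + 1) * \<bar>z\<bar> + (\<bar>L\<bar> + 1) * \<bar>- z\<bar>"
      using z h by (intro add_mono lip) auto
    also have "\<dots> = 2 * (\<bar>L\<bar> + 1) * z" using z by simp
    also have "\<dots> \<le> 2 * (\<bar>L\<bar> + 1) * h" using z by (intro mult_left_mono) auto
    finally have "h * \<bar>deriv g z - deriv g (- z)\<bar> \<le> h * (2 * (\<bar>L\<bar> + 1) * h)" using h by (intro mult_left_mono) auto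
    then show ?thesis
      unfolding z(3) using h by (simp add: abs_mult power2_eq_square mult_ac)
  qed
  moreover have "0 \<le> 2 * (\<bar>L\<bar> + 1)" by simp
  ultimately show ?thesis using h0(1) by blast
qed

theorem theorem2p10:
  fixes T :: real
  assumes "T > 0"
  shows "\<exists>C :: (real \<Rightarrow> real \<Rightarrow> real) set. C \<noteq> {} \<and>
    (\<forall>u\<in>C. (\<exists>u0 u1. schwartz_class_solution T u0 u1 u) \<and> blows_up_at T u)"
proof -
  \<comment> \<open>With \<open>S = T + 1\<close> the initial time \<open>t = 0\<close>, that is
    \<open>s = T\<close>, lies inside \<open>{0<..<S}\<close>, where all derivatives are
    available.\<close>
  define S where "S = T + 1"
  have S: "S > 0" using assms by (simp add: S_def)
  obtain U V B :: "nat \<Rightarrow> real \<Rightarrow> real \<Rightarrow> real" and w :: "real \<Rightarrow> real" where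
    cU: "\<And>i. continuous_on (UNIV \<times> {0<..<S}) (\<lambda>(x, s). U i x s)" and
    cV: "\<And>i. continuous_on (UNIV \<times> {0<..<S}) (\<lambda>(x, s). V i x s)" and
    Ux: "\<And>i x s. s \<in> {0<..<S} \<Longrightarrow> ((\<lambda>y. U i y s) has_real_derivative U (Suc i) x s) (at x)" and
    Vx: "\<And>i x s. s \<in> {0<..<S} \<Longrightarrow> ((\<lambda>y. V i y s) has_real_derivative V (Suc i) x s) (at x)" and
    Bx: "\<And>i x s. s \<in> {0<..<S} \<Longrightarrow> ((\<lambda>y. B i y s) has_real_derivative B (Suc i) x s) (at x)" and
    Us: "\<And>i x s. s \<in> {0<..<S} \<Longrightarrow> (U i x has_real_derivative V i x s) (at s)" and
    Vs: "\<And>i x s. s \<in> {0<..<S} \<Longrightarrow> (V i x has_real_derivative U (i + 4) x s + U (i + 2) x s + B (i + 2) x s) (at s)" and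
    B0: "\<And>x s. s \<in> {0<..<S} \<Longrightarrow> B 0 x s = (U 0 x s)\<^sup>2" and
    decU: "\<And>i m \<eta>. \<eta> > 0 \<Longrightarrow> \<exists>C. \<forall>s\<in>{\<eta>..S}. \<forall>x. \<bar>x\<bar> ^ m * \<bar>U i x s\<bar> \<le> C" and
    decB: "\<And>i m \<eta>. \<eta> > 0 \<Longrightarrow> \<exists>C. \<forall>s\<in>{\<eta>..S}. \<forall>x. \<bar>x\<bar> ^ m * \<bar>B i x s\<bar> \<le> C" and
    lim: "\<And>x. (U 0 x \<longlongrightarrow> w x) (at_right 0)" and
    rough: "\<And>C h0. C \<ge> 0 \<Longrightarrow> h0 > 0 \<Longrightarrow> \<exists>h. 0 < h \<and> h < h0 \<and> \<bar>w h + w (- h) - 2 * w 0\<bar> > C * h\<^sup>2"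
  proof (rule exists_transformed_solution[OF S], goal_cases)
    case (1 U V B w)
    show ?case by (rule that) (fact 1)+
  qed
  define Ut where "Ut i x t = U i x (T - t)" for i x t
  \<comment> \<open>Reversing time changes the sign of the first time derivative; the second, and
    with it the equation, is unaffected.\<close>
  define Vt where "Vt i x t = - V i x (T - t)" for i x t
  define Bt where "Bt i x t = B i x (T - t)" for i x t
  have tS: "T - t \<in> {0<..<S}" if "t \<in> {0..<T}" for t using that by (auto simp: S_def)
  have Utx: "((\<lambda>y. Ut i y t) has_real_derivative Ut (Suc i) x t) (at x)"
    and Btx: "((\<lambda>y. Bt i y t) has_real_derivative Bt (Suc i) x t) (at x)"
    and Vtx: "((\<lambda>y. Vt i y t) has_real_derivative Vt (Suc i) x t) (at x)" if "t \<in> {0..<T}" for i x t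
    unfolding Ut_def Vt_def Bt_def
    by (rule Ux[OF tS[OF that]] Bx[OF tS[OF that]] DERIV_minus[OF Vx[OF tS[OF that]]])+
  have Utt: "(Ut i x has_real_derivative Vt i x t) (at t within {0..})"
    and Vtt: "(Vt i x has_real_derivative Ut (i + 4) x t + Ut (i + 2) x t + Bt (i + 2) x t) (at t within {0..})"
    if "t \<in> {0..<T}" for i x t
  proof -
    have d: "((\<lambda>t. T - t) has_real_derivative - 1) (at t within {0..})" by (auto intro!: derivative_eq_intros)
    show "(Ut i x has_real_derivative Vt i x t) (at t within {0..})"
      using DERIV_chain2[OF Us[OF tS[OF that]] d] by (simp add: Ut_def [abs_def] Vt_def)
    show "(Vt i x has_real_derivative Ut (i + 4) x t + Ut (i + 2) x t + Bt (i + 2) x t) (at t within {0..})"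
      unfolding Ut_def Vt_def [abs_def] Bt_def
      by (rule DERIV_cong[OF DERIV_minus[OF DERIV_chain2[OF Vs[OF tS[OF that]] d]]]) simp
  qed
  \<comment> \<open>The \<open>Bt i\<close> are left out: on the strip \<open>Bt 0\<close> is the
    square of \<open>Ut 0\<close>, and the others arise from it by \<open>x\<close>-derivatives
    within the algebra.\<close>
  define G where "G = range Ut \<union> range Vt"
  have gU: "Ut i \<in> function_algebra G" and gV: "Vt i \<in> function_algebra G" for i
    by (auto simp: G_def intro: function_algebra.gen)
  have dx: "\<exists>q\<in>function_algebra G. \<forall>x. \<forall>t\<in>{0..<T}. ((\<lambda>y. p y t) has_real_derivative q x t) (at x)"
    if "p \<in> function_algebra G" for p
  proof (rule function_algebra_deriv[where f = "\<lambda>p x t y. p y t" and z = "\<lambda>x t. x" and Z = UNIV, OF _ _ _ _ _ that])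
    fix g assume "g \<in> G"
    then consider i where "g = Ut i" | i where "g = Vt i" by (auto simp: G_def)
    then show "\<exists>q\<in>function_algebra G. \<forall>x. \<forall>t\<in>{0..<T}. ((\<lambda>y. g y t) has_real_derivative q x t) (at x)"
      by cases (use Utx Vtx gU gV in blast)+
  qed auto
  have Bt_alg: "\<exists>p\<in>function_algebra G. \<forall>x. \<forall>t\<in>{0..<T}. Bt i x t = p x t" for i
  proof (induction i)
    case 0
    have "Bt 0 x t = Ut 0 x t * Ut 0 x t" if "t \<in> {0..<T}" for x t
      using B0[OF tS[OF that], of x] by (simp add: Bt_def Ut_def power2_eq_square)
    then show ?case by (intro bexI[of _ "\<lambda>x t. Ut 0 x t * Ut 0 x t"] function_algebra.mult gU) auto
  next
    case (Suc i)
    then obtain p where p: "p \<in> function_algebra G" "\<And>x t. t \<in> {0..<T} \<Longrightarrow> Bt i x t = p x t" by blast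
    then obtain q where q: "q \<in> function_algebra G"
      "\<And>x t. t \<in> {0..<T} \<Longrightarrow> ((\<lambda>y. p y t) has_real_derivative q x t) (at x)" using dx by blast
    have "Bt (Suc i) x t = q x t" if "t \<in> {0..<T}" for x t
      using Btx[OF that, of i x] q(2)[OF that, of x] p(2)[OF that] by (simp add: DERIV_unique)
    then show ?case using q(1) by blast
  qed
  have dt: "\<exists>q\<in>function_algebra G. \<forall>x. \<forall>t\<in>{0..<T}. ((\<lambda>s. p x s) has_real_derivative q x t) (at t within {0..})"
    if "p \<in> function_algebra G" for p
  proof (rule function_algebra_deriv[where f = "\<lambda>p x t s. p x s" and z = "\<lambda>x t. t" and Z = "{0..}", OF _ _ _ _ _ that])
    fix g assume "g \<in> G"
    then consider i where "g = Ut i" | i where "g = Vt i" by (auto simp: G_def)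
    then show "\<exists>q\<in>function_algebra G. \<forall>x. \<forall>t\<in>{0..<T}. ((\<lambda>s. g x s) has_real_derivative q x t) (at t within {0..})"
    proof cases
      case 1
      then show ?thesis using Utt gV by blast
    next
      case (2 i)
      obtain p where p: "p \<in> function_algebra G" "\<And>x t. t \<in> {0..<T} \<Longrightarrow> Bt (i + 2) x t = p x t"
        using Bt_alg by blast
      have d: "(Vt i x has_real_derivative (\<lambda>x t. (Ut (i + 4) x t + Ut (i + 2) x t) + p x t) x t) (at t within {0..})"
        if "t \<in> {0..<T}" for x t
        using Vtt[OF that, of i x] p(2)[OF that] by simp
      have "(\<lambda>x t. (Ut (i + 4) x t + Ut (i + 2) x t) + p x t) \<in> function_algebra G"
        by (intro function_algebra.add gU p(1))
      then show ?thesis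
        unfolding 2 by (intro bexI[where x = "\<lambda>x t. (Ut (i + 4) x t + Ut (i + 2) x t) + p x t"] allI ballI d)
    qed
  qed auto
  have cG: "continuous_on (UNIV \<times> {0..<T}) (\<lambda>(x, t). g x t)" if gG: "g \<in> G" for g
  proof -
    have m: "continuous_on (UNIV \<times> {0..<T}) (\<lambda>p::real \<times> real. (fst p, T - snd p))" by (intro continuous_intros)
    have im: "(\<lambda>p::real \<times> real. (fst p, T - snd p)) ` (UNIV \<times> {0..<T}) \<subseteq> UNIV \<times> {0<..<S}"
      using tS by auto
    consider i where "g = Ut i" | i where "g = Vt i" using gG by (auto simp: G_def)
    then show ?thesis
    proof cases
      case (1 i)
      then show ?thesis
        using continuous_on_compose2[OF cU[of i] m im] by (simp add: Ut_def [abs_def] case_prod_unfold)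
    next
      case (2 i)
      then show ?thesis
        using continuous_on_minus[OF continuous_on_compose2[OF cV[of i] m im]]
        by (simp add: Vt_def [abs_def] case_prod_unfold)
    qed
  qed
  define u where "u = Ut 0"
  have smooth: "smooth_on_strip T u"
    unfolding smooth_on_strip_def u_def by (intro allI function_algebra_Ck_on[OF cG dx dt gU])
  have Dx_U: "Dx (Ut i) x t = Ut (Suc i) x t" and Dx_B: "Dx (Bt i) x t = Bt (Suc i) x t" if "t \<in> {0..<T}" for i x t
    unfolding Dx_def by (rule DERIV_imp_deriv[OF Utx[OF that]] DERIV_imp_deriv[OF Btx[OF that]])+
  have Dt_U: "Dt (Ut i) x t = Vt i x t"
    and Dt_V: "Dt (Vt i) x t = Ut (i + 4) x t + Ut (i + 2) x t + Bt (i + 2) x t" if "t \<in> {0..<T}" for i x t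
  proof -
    have nb: "at t within {0..} \<noteq> bot" using that by (intro at_within_atLeast_not_bot) simp
    note vd = vector_derivative_within[OF nb]
    show "Dt (Ut i) x t = Vt i x t" unfolding Dt_def by (rule vd[OF Utt[OF that, unfolded has_real_derivative_iff_has_vector_derivative]])
    show "Dt (Vt i) x t = Ut (i + 4) x t + Ut (i + 2) x t + Bt (i + 2) x t"
      unfolding Dt_def by (rule vd[OF Vtt[OF that, unfolded has_real_derivative_iff_has_vector_derivative]])
  qed
  have Dxu: "(Dx ^^ i) u x t = Ut i x t" if "t \<in> {0..<T}" for i x t
    using that
  proof (induction i arbitrary: x t)
    case (Suc i)
    have "(Dx ^^ Suc i) u x t = Dx ((Dx ^^ i) u) x t" by simp
    also have "\<dots> = Dx (Ut i) x t" by (rule Dx_cong[OF Suc.IH Suc.prems])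
    also have "\<dots> = Ut (Suc i) x t" by (rule Dx_U[OF Suc.prems])
    finally show ?case .
  qed (simp add: u_def)
  have Dxx_sq: "Dx (Dx (\<lambda>y s. (u y s)\<^sup>2)) x t = Bt 2 x t" if "t \<in> {0..<T}" for x t
  proof -
    have "(u y s)\<^sup>2 = Bt 0 y s" if "s \<in> {0..<T}" for y s
      using B0[OF tS[OF that], of y] by (simp add: u_def Bt_def Ut_def)
    then have "Dx (\<lambda>y s. (u y s)\<^sup>2) y s = Bt 1 y s" if "s \<in> {0..<T}" for y s
      using Dx_cong[of T "\<lambda>y s. (u y s)\<^sup>2" "Bt 0" s y] Dx_B[OF that, of 0 y] that by simp
    then have "Dx (Dx (\<lambda>y s. (u y s)\<^sup>2)) x t = Dx (Bt 1) x t" by (rule Dx_cong[OF _ that])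
    then show ?thesis using Dx_B[OF that, of 1 x] by (simp add: numeral_2_eq_2)
  qed
  have Dtu: "Dt u x t = Vt 0 x t" if "t \<in> {0..<T}" for x t
    unfolding u_def by (rule Dt_U[OF that])
  have pde: "Dt (Dt u) x t = Dx (Dx u) x t + Dx (Dx (\<lambda>y s. (u y s)\<^sup>2)) x t + Dx (Dx (Dx (Dx u))) x t"
    if "t \<in> {0..<T}" for x t
  proof -
    have "Dt (Dt u) x t = Dt (Vt 0) x t" by (rule Dt_cong[OF Dtu that])
    also have "\<dots> = Ut 4 x t + Ut 2 x t + Bt 2 x t"
      using Dt_V[OF that, of 0 x] by (simp only: add_0)
    finally show ?thesis
      using Dxu[OF that, of 2 x] Dxu[OF that, of 4 x] Dxx_sq[OF that, of x]
      by (simp add: eval_nat_numeral)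
  qed
  \<comment> \<open>Decay of the initial velocity. It is interpolated on \<open>{T / 2..T}\<close>
    between the decay of \<open>U\<close> and that of the second time derivative, which the equation
    expresses through \<open>U\<close> and \<open>B\<close>.\<close>
  have decVt: "\<exists>C. \<forall>x. \<bar>x\<bar> ^ m * \<bar>Vt i x 0\<bar> \<le> C" for i m
  proof -
    have T2: "T / 2 > 0" using assms by simp
    obtain A where A: "\<And>s x. s \<in> {T / 2..S} \<Longrightarrow> \<bar>x\<bar> ^ m * \<bar>U i x s\<bar> \<le> A" using decU[OF T2] by blast
    obtain A4 where A4: "\<And>s x. s \<in> {T / 2..S} \<Longrightarrow> \<bar>x\<bar> ^ m * \<bar>U (i + 4) x s\<bar> \<le> A4" using decU[OF T2] by blast
    obtain A2 where A2: "\<And>s x. s \<in> {T / 2..S} \<Longrightarrow> \<bar>x\<bar> ^ m * \<bar>U (i + 2) x s\<bar> \<le> A2" using decU[OF T2] by blast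
    obtain B2 where B2: "\<And>s x. s \<in> {T / 2..S} \<Longrightarrow> \<bar>x\<bar> ^ m * \<bar>B (i + 2) x s\<bar> \<le> B2" using decB[OF T2] by blast
    have "\<bar>\<bar>x\<bar> ^ m * V i x T\<bar> \<le> 2 * A / (T / 2) + T / 2 * (A4 + A2 + B2)" for x
    proof (rule first_derivative_bound[where f = "\<lambda>s. \<bar>x\<bar> ^ m * U i x s" and ?f1.0 = "\<lambda>s. \<bar>x\<bar> ^ m * V i x s"
          and ?f2.0 = "\<lambda>s. \<bar>x\<bar> ^ m * (U (i + 4) x s + U (i + 2) x s + B (i + 2) x s)", OF T2])
      fix r assume r: "T - T / 2 \<le> r" "r \<le> T"
      then have r': "r \<in> {0<..<S}" "r \<in> {T / 2..S}" using assms by (auto simp: S_def)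
      show "((\<lambda>s. \<bar>x\<bar> ^ m * U i x s) has_real_derivative \<bar>x\<bar> ^ m * V i x r) (at r)"
        by (rule DERIV_cmult[OF Us[OF r'(1)]])
      show "((\<lambda>s. \<bar>x\<bar> ^ m * V i x s) has_real_derivative
          \<bar>x\<bar> ^ m * (U (i + 4) x r + U (i + 2) x r + B (i + 2) x r)) (at r)"
        by (rule DERIV_cmult[OF Vs[OF r'(1)]])
      show "\<bar>\<bar>x\<bar> ^ m * U i x r\<bar> \<le> A" using A[OF r'(2), of x] by (simp add: abs_mult)
      have "\<bar>\<bar>x\<bar> ^ m * (U (i + 4) x r + U (i + 2) x r + B (i + 2) x r)\<bar>
          \<le> \<bar>x\<bar> ^ m * (\<bar>U (i + 4) x r\<bar> + \<bar>U (i + 2) x r\<bar> + \<bar>B (i + 2) x r\<bar>)"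
      proof -
        have "\<bar>y * (c + d + e)\<bar> \<le> y * (\<bar>c\<bar> + \<bar>d\<bar> + \<bar>e\<bar>)" if "y \<ge> 0" for y c d e :: real
          unfolding abs_mult abs_of_nonneg[OF that] using that by (intro mult_left_mono) linarith+
        then show ?thesis by simp
      qed
      also have "\<dots> \<le> A4 + A2 + B2"
        using A4[OF r'(2), of x] A2[OF r'(2), of x] B2[OF r'(2), of x] by (simp add: distrib_left)
      finally show "\<bar>\<bar>x\<bar> ^ m * (U (i + 4) x r + U (i + 2) x r + B (i + 2) x r)\<bar> \<le> A4 + A2 + B2" .
    qed
    then show ?thesis by (intro exI allI) (simp add: Vt_def abs_mult)
  qed
  have decUt: "\<exists>C. \<forall>t\<in>{0..\<tau>}. \<forall>x. \<bar>x\<bar> ^ m * \<bar>Ut i x t\<bar> \<le> C" if \<tau>: "\<tau> < T" for \<tau> i m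
  proof -
    have "T - \<tau> > 0" using \<tau> by simp
    from decU[OF this] obtain C where C: "\<And>s x. s \<in> {T - \<tau>..S} \<Longrightarrow> \<bar>x\<bar> ^ m * \<bar>U i x s\<bar> \<le> C" by blast
    have "\<bar>x\<bar> ^ m * \<bar>Ut i x t\<bar> \<le> C" if "t \<in> {0..\<tau>}" for t x
      unfolding Ut_def by (rule C) (use that in \<open>auto simp: S_def\<close>)
    then show ?thesis by blast
  qed
  have zero: "0 \<in> {0..<T}" using assms by simp
  have s0: "schwartz (\<lambda>x. Ut 0 x 0)"
    by (rule schwartzI[of "\<lambda>i x. Ut i x 0"]) (use Utx[OF zero] decUt[of 0] assms in auto)
  have s1: "schwartz (\<lambda>x. Vt 0 x 0)"
    by (rule schwartzI[of "\<lambda>i x. Vt i x 0"]) (use Vtx[OF zero] decVt in auto)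
  have bdd: "bdd_above ((\<lambda>(x, t). \<Sum>i=0..N. (1 + \<bar>x\<bar>) ^ N * \<bar>(Dx ^^ i) u x t\<bar>) ` (UNIV \<times> {0..\<tau>}))"
    if \<tau>: "\<tau> \<in> {0..<T}" for N \<tau>
  proof -
    have "\<forall>i. \<exists>C. \<forall>t\<in>{0..\<tau>}. \<forall>x. (1 + \<bar>x\<bar>) ^ N * \<bar>(Dx ^^ i) u x t\<bar> \<le> C"
    proof
      fix i
      have "\<tau> < T" using \<tau> by simp
      obtain C0 where C0: "\<And>t x. t \<in> {0..\<tau>} \<Longrightarrow> \<bar>x\<bar> ^ 0 * \<bar>Ut i x t\<bar> \<le> C0"
        using decUt[OF \<open>\<tau> < T\<close>] by blast
      obtain CN where CN: "\<And>t x. t \<in> {0..\<tau>} \<Longrightarrow> \<bar>x\<bar> ^ N * \<bar>Ut i x t\<bar> \<le> CN"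
        using decUt[OF \<open>\<tau> < T\<close>] by blast
      have "(1 + \<bar>x\<bar>) ^ N * \<bar>(Dx ^^ i) u x t\<bar> \<le> 2 ^ N * (C0 + CN)" if t: "t \<in> {0..\<tau>}" for t x
      proof -
        have "(1 + \<bar>x\<bar>) ^ N * \<bar>(Dx ^^ i) u x t\<bar> = (1 + \<bar>x\<bar>) ^ N * \<bar>Ut i x t\<bar>"
          using Dxu[of t i x] t \<open>\<tau> \<in> {0..<T}\<close> by simp
        also have "\<dots> \<le> 2 ^ N * (1 + \<bar>x\<bar> ^ N) * \<bar>Ut i x t\<bar>"
          by (intro mult_right_mono power_one_plus_le) auto
        also have "\<dots> = 2 ^ N * (\<bar>x\<bar> ^ 0 * \<bar>Ut i x t\<bar> + \<bar>x\<bar> ^ N * \<bar>Ut i x t\<bar>)" by (simp add: algebra_simps)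
        also have "\<dots> \<le> 2 ^ N * (C0 + CN)"
          by (intro mult_left_mono add_mono C0[OF t] CN[OF t]) auto
        finally show ?thesis .
      qed
      then show "\<exists>C. \<forall>t\<in>{0..\<tau>}. \<forall>x. (1 + \<bar>x\<bar>) ^ N * \<bar>(Dx ^^ i) u x t\<bar> \<le> C" by blast
    qed
    from choice[OF this] obtain C where C: "\<And>i t x. t \<in> {0..\<tau>} \<Longrightarrow> (1 + \<bar>x\<bar>) ^ N * \<bar>(Dx ^^ i) u x t\<bar> \<le> C i"
      by blast
    show ?thesis
      by (rule bdd_aboveI[of _ "\<Sum>i=0..N. C i"]) (auto intro!: sum_mono C)
  qed
  have sol: "schwartz_class_solution T (\<lambda>x. Ut 0 x 0) (\<lambda>x. Vt 0 x 0) u"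
    unfolding schwartz_class_solution_def
    using s0 s1 smooth pde Dtu[OF zero] bdd by (simp add: u_def)
  have "blows_up_at T u"
    unfolding blows_up_at_def
  proof
    assume "\<exists>T' v0 v1 v. T < T' \<and> schwartz_class_solution T' v0 v1 v \<and> (\<forall>x. \<forall>t\<in>{0..<T}. v x t = u x t)"
    then obtain T' v0 v1 v where v: "T < T'" "schwartz_class_solution T' v0 v1 v"
      "\<And>x t. t \<in> {0..<T} \<Longrightarrow> v x t = u x t" by blast
    \<comment> \<open>Two orders suffice for the contradiction: continuity identifies
      \<open>v\<close> at time \<open>T\<close> with the limit \<open>w\<close>, and two
      \<open>x\<close>-derivatives there bound its second differences.\<close>
    have ck: "Ck_on T' (Suc (Suc 0)) v"
      using v(2) unfolding schwartz_class_solution_def smooth_on_strip_def by blast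
    have TT: "T \<in> {0..<T'}" using v(1) assms by simp
    have vw: "v x T = w x" for x
    proof -
      have "continuous_on (UNIV \<times> {0..<T'}) (\<lambda>(x, t). v x t)" using ck by simp
      from continuous_on_compose2[OF this, of "{0..<T'}" "\<lambda>t. (x, t)"]
      have "continuous_on {0..<T'} (\<lambda>t. v x t)" by (auto simp: continuous_intros)
      then have "((\<lambda>t. v x t) \<longlongrightarrow> v x T) (at T within {0..<T'})"
        using TT by (simp add: continuous_on_def)
      then have "((\<lambda>t. v x t) \<longlongrightarrow> v x T) (at T within {0..T})"
        by (rule tendsto_within_subset) (use v(1) in auto)
      then have 1: "((\<lambda>t. v x t) \<longlongrightarrow> v x T) (at_left T)"
        using assms by (simp add: at_within_Icc_at_left)
      have "filterlim (\<lambda>t. T - t) (at_right 0) (at_left T)"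
        unfolding at_left_minus[of T] filterlim_filtermap
        by (simp add: filterlim_at_right_to_0[of _ _ "- T"] filterlim_ident)
      from filterlim_compose[OF lim[of x] this] have "((\<lambda>t. U 0 x (T - t)) \<longlongrightarrow> w x) (at_left T)" .
      moreover have "\<forall>\<^sub>F t in at_left T. U 0 x (T - t) = v x t"
        using eventually_at_left_field[of _ T] v(3) assms
        by (auto simp: u_def Ut_def intro!: exI[of _ 0])
      ultimately have 2: "((\<lambda>t. v x t) \<longlongrightarrow> w x) (at_left T)" by (rule Lim_transform_eventually)
      show ?thesis by (rule tendsto_unique[OF _ 1 2]) simp
    qed
    have "(\<lambda>y. v y T) differentiable (at x)" for x using ck TT by simp
    moreover have "deriv (\<lambda>y. v y T) differentiable (at 0)"
    proof -
      have "(\<lambda>y. Dx v y T) differentiable (at 0)" using ck TT by simp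
      then show ?thesis by (simp add: Dx_def)
    qed
    ultimately obtain C h0 where "C \<ge> 0" "h0 > 0"
      and le: "\<And>h. 0 < h \<Longrightarrow> h < h0 \<Longrightarrow> \<bar>w h + w (- h) - 2 * w 0\<bar> \<le> C * h\<^sup>2"
      using second_difference_bounded[of "\<lambda>y. v y T"] unfolding vw by blast
    then show False using rough[of C h0] by force
  qed
  then show ?thesis using sol by (intro exI[of _ "{u}"]) auto
qed

end
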